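(* Let $n\ge2$ and let $f(\mathbf z)$ be a convenient non-degenerate holomorphic function of $n$ variables defined near the origin with $f(0)=0$. Let $a,b$ be integers with $a>b>0$ (respectively $0<a<b$), let $\varphi_{a,b}(\mathbf w,\bar{\mathbf w})=(w_1^a\bar w_1^b,\dots,w_n^a\bar w_n^b)$, let $g=f\circ\varphi_{a,b}$, and let $K_r=g^{-1}(0)\cap\mathbb S_r$. Then there exists $r_0>0$ such that $g$ is strictly holomorphic-like (respectively strictly anti-holomorphic-like) on the ball $B_{r_0}=\{\|\mathbf w\|\le r_0\}$ and $K_r\subset\mathbb S_r$ is a positive (respectively negative) contact submanifold for every $0<r\le r_0$. If $f$ is weighted homogeneous, then $g$ is strictly holomorphic-like (respectively strictly anti-holomorphic-like) on $\mathbb C^n$ and $K_r\subset\mathbb S_r$ is a positive (respectively negative) contact submanifold for every $r>0$.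
   Context: Convenient: the Newton boundary $\Gamma(f)$ (union of compact faces of the convex hull of $\bigcup_{c_\nu\ne0}(\nu+\mathbb R^n_{\ge0})$, $f=\sum c_\nu\mathbf z^\nu$) meets every coordinate axis. Non-degenerate: for every positive integer weight vector $P$, the face function $f_P$ (sum of terms of $f$ whose exponents minimize $\sum p_j\nu_j$ on the Newton polyhedron) has no critical point on $f_P^{-1}(0)\cap(\mathbb C^* )^n$. Weighted homogeneous: $f(t^{p_1}z_1,\dots,t^{p_n}z_n)=t^df(\mathbf z)$ for some positive integers $p_j,d$. Let $\rho(\mathbf w)=\sum|w_j|^2$, $\mathbb S_r=\{\rho=r^2\}$, and $\alpha=2\sum_j(x_jdy_j-y_jdx_j)$ ($w_j=x_j+iy_j$), which restricts to a contact form on $\mathbb S_r$. With $g_{w_j}=\partial g/\partial w_j$, $g_{\bar w_j}=\partial g/\partial \bar w_j$, set $C_g=\sum_{1\le j<k\le n}\big(|w_j\overline{g_{w_k}}-w_k\overline{g_{w_j}}|^2-|w_jg_{\bar w_k}-w_kg_{\bar w_j}|^2\big)$. $g$ (with isolated mixed singularity at $0$) is strictly holomorphic-like (resp. strictly anti-holomorphic-like) on a neighborhood $U$ of $0$ if $C_g>0$ (resp. $<0$) at every smooth point of $U\cap g^{-1}(0)\setminus\{0\}$. Orientation: $\mathbb C^n$ has the standard orientation; $K_r$ is oriented by a $(2n-3)$-form $\Omega'$ such that $d\rho\wedge\Omega'\wedge d(\Re g)\wedge d(\Im g)$ is positive. $K_r$ is a positive (resp. negative) contact submanifold of $\mathbb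 S_r$ if $(\alpha\wedge(d\alpha)^{n-2})|_{K_r}$ is a positive (resp. negative) nowhere vanishing form on $K_r$. *)

theory Defs
  imports "HOL-Analysis.Analysis"
begin

definition monom :: "complex^'n::finite \<Rightarrow> ('n \<Rightarrow> nat) \<Rightarrow> complex" where
  "monom z \<nu> = (\<Prod>j\<in>UNIV. (z$j) ^ (\<nu> j))"

definition holo_germ :: "(('n::finite \<Rightarrow> nat) \<Rightarrow> complex) \<Rightarrow> (complex^'n \<Rightarrow> complex) \<Rightarrow> bool" where
  "holo_germ c f \<longleftrightarrow> (\<exists>\<epsilon>>0. \<forall>z\<in>ball 0 \<epsilon>. ((\<lambda>\<nu>. c \<nu> * monom z \<nu>) has_sum f z) UNIV)"

definition supp :: "(('n::finite \<Rightarrow> nat) \<Rightarrow> complex) \<Rightarrow> ('n \<Rightarrow> nat) set" where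
  "supp c = {\<nu>. c \<nu> \<noteq> 0}"

definition nuvec :: "('n::finite \<Rightarrow> nat) \<Rightarrow> real^'n" where
  "nuvec \<nu> = (\<chi> j. real (\<nu> j))"

definition newton_polyhedron :: "(('n::finite \<Rightarrow> nat) \<Rightarrow> complex) \<Rightarrow> (real^'n) set" where
  "newton_polyhedron c = convex hull (\<Union>\<nu>\<in>supp c. {x. \<forall>j. x$j \<ge> real (\<nu> j)})"

definition newton_boundary :: "(('n::finite \<Rightarrow> nat) \<Rightarrow> complex) \<Rightarrow> (real^'n) set" where
  "newton_boundary c = \<Union>{F. F face_of newton_polyhedron c \<and> compact F}"

definition convenient :: "(('n::finite \<Rightarrow> nat) \<Rightarrow> complex) \<Rightarrow> bool" where
  "convenient c \<longleftrightarrow> (\<forall>j. \<exists>x\<in>newton_boundary c. \<forall>i. i \<noteq> j \<longrightarrow> x$i = 0)"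

definition face_exps :: "(('n::finite \<Rightarrow> nat) \<Rightarrow> complex) \<Rightarrow> ('n \<Rightarrow> nat) \<Rightarrow> ('n \<Rightarrow> nat) set" where
  "face_exps c P = {\<nu>\<in>supp c. \<forall>x\<in>newton_polyhedron c.
      (\<Sum>j\<in>UNIV. real (P j) * real (\<nu> j)) \<le> (\<Sum>j\<in>UNIV. real (P j) * x$j)}"

definition face_fun :: "(('n::finite \<Rightarrow> nat) \<Rightarrow> complex) \<Rightarrow> ('n \<Rightarrow> nat) \<Rightarrow> complex^'n \<Rightarrow> complex" where
  "face_fun c P z = (\<Sum>\<nu>\<in>face_exps c P. c \<nu> * monom z \<nu>)"

definition partial_zero :: "(complex^'n::finite \<Rightarrow> complex) \<Rightarrow> 'n \<Rightarrow> complex^'n \<Rightarrow> bool" where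
  "partial_zero h j z \<longleftrightarrow>
     ((\<lambda>t. h (\<chi> i. if i = j then t else z$i)) has_field_derivative 0) (at (z$j))"

definition non_degenerate :: "(('n::finite \<Rightarrow> nat) \<Rightarrow> complex) \<Rightarrow> bool" where
  "non_degenerate c \<longleftrightarrow> (\<forall>P::'n \<Rightarrow> nat. (\<forall>j. P j > 0) \<longrightarrow>
     \<not> (\<exists>z. (\<forall>j. z$j \<noteq> 0) \<and> face_fun c P z = 0 \<and> (\<forall>j. partial_zero (face_fun c P) j z)))"

definition weighted_homogeneous :: "(complex^'n::finite \<Rightarrow> complex) \<Rightarrow> bool" where
  "weighted_homogeneous f \<longleftrightarrow> (\<exists>(p::'n \<Rightarrow> nat) (d::nat). (\<forall>j. p j > 0) \<and> d > 0 \<and>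
     (\<forall>(t::complex) z. f (\<chi> j. t ^ (p j) * z$j) = t ^ d * f z))"

definition phi_ab :: "nat \<Rightarrow> nat \<Rightarrow> complex^'n::finite \<Rightarrow> complex^'n" where
  "phi_ab a b w = (\<chi> j. (w$j) ^ a * (cnj (w$j)) ^ b)"

text \<open>A fixed enumeration of the index type (the standard orientation of C^n does not depend on it).\<close>
definition idx :: "nat \<Rightarrow> 'n::finite" where
  "idx = (SOME e. bij_betw e {..<CARD('n)} (UNIV::'n set))"

definition dxj :: "(complex^'n::finite \<Rightarrow> complex) \<Rightarrow> 'n \<Rightarrow> complex^'n \<Rightarrow> complex" where
  "dxj g j w = frechet_derivative g (at w) (axis j 1)"

definition dyj :: "(complex^'n::finite \<Rightarrow> complex) \<Rightarrow> 'n \<Rightarrow> complex^'n \<Rightarrow> complex" where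
  "dyj g j w = frechet_derivative g (at w) (axis j \<i>)"

definition wirt :: "(complex^'n::finite \<Rightarrow> complex) \<Rightarrow> 'n \<Rightarrow> complex^'n \<Rightarrow> complex" where
  "wirt g j w = (dxj g j w - \<i> * dyj g j w) / 2"

definition wirt_bar :: "(complex^'n::finite \<Rightarrow> complex) \<Rightarrow> 'n \<Rightarrow> complex^'n \<Rightarrow> complex" where
  "wirt_bar g j w = (dxj g j w + \<i> * dyj g j w) / 2"

definition C_g :: "(complex^'n::finite \<Rightarrow> complex) \<Rightarrow> complex^'n \<Rightarrow> real" where
  "C_g g w = (\<Sum>(j,k)\<in>{(j,k). j < k \<and> k < CARD('n)}.
      (cmod (w$(idx j) * cnj (wirt g (idx k) w) - w$(idx k) * cnj (wirt g (idx j) w)))^2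
    - (cmod (w$(idx j) * wirt_bar g (idx k) w - w$(idx k) * wirt_bar g (idx j) w))^2)"

definition mixed_regular :: "(complex^'n::finite \<Rightarrow> complex) \<Rightarrow> complex^'n \<Rightarrow> bool" where
  "mixed_regular g w \<longleftrightarrow> g differentiable (at w) \<and> surj (frechet_derivative g (at w))"

definition isolated_mixed_sing :: "(complex^'n::finite \<Rightarrow> complex) \<Rightarrow> bool" where
  "isolated_mixed_sing g \<longleftrightarrow> g 0 = 0 \<and>
     (\<exists>\<epsilon>>0. \<forall>w. w \<noteq> 0 \<and> norm w < \<epsilon> \<and> g w = 0 \<longrightarrow> mixed_regular g w)"

definition strictly_hol_like :: "(complex^'n::finite \<Rightarrow> complex) \<Rightarrow> (complex^'n) set \<Rightarrow> bool" where
  "strictly_hol_like g U \<longleftrightarrow> isolated_mixed_sing g \<and>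
     (\<forall>w\<in>U. g w = 0 \<and> w \<noteq> 0 \<and> mixed_regular g w \<longrightarrow> C_g g w > 0)"

definition strictly_antihol_like :: "(complex^'n::finite \<Rightarrow> complex) \<Rightarrow> (complex^'n) set \<Rightarrow> bool" where
  "strictly_antihol_like g U \<longleftrightarrow> isolated_mixed_sing g \<and>
     (\<forall>w\<in>U. g w = 0 \<and> w \<noteq> 0 \<and> mixed_regular g w \<longrightarrow> C_g g w < 0)"

text \<open>Wedge product of a k-form and an l-form (determinant normalisation).\<close>
definition wedge :: "nat \<Rightarrow> nat \<Rightarrow> ((nat \<Rightarrow> 'v) \<Rightarrow> real) \<Rightarrow> ((nat \<Rightarrow> 'v) \<Rightarrow> real)
                     \<Rightarrow> (nat \<Rightarrow> 'v) \<Rightarrow> real" where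
  "wedge k l \<omega> \<eta> vs = (\<Sum>\<sigma>\<in>{\<sigma>. \<sigma> permutes {..<k+l}}.
      of_int (sign \<sigma>) * \<omega> (\<lambda>i. vs (\<sigma> i)) * \<eta> (\<lambda>i. vs (\<sigma> (k + i)))) / (fact k * fact l)"

fun wedge_pow2 :: "((nat \<Rightarrow> 'v) \<Rightarrow> real) \<Rightarrow> nat \<Rightarrow> (nat \<Rightarrow> 'v) \<Rightarrow> real" where
  "wedge_pow2 \<omega> 0 = (\<lambda>_. 1)"
| "wedge_pow2 \<omega> (Suc m) = wedge 2 (2*m) \<omega> (wedge_pow2 \<omega> m)"

definition ext_d1 :: "('v::real_normed_vector \<Rightarrow> 'v \<Rightarrow> real) \<Rightarrow> 'v \<Rightarrow> 'v \<Rightarrow> 'v \<Rightarrow> real" where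
  "ext_d1 \<beta> p u v = frechet_derivative (\<lambda>q. \<beta> q v) (at p) u - frechet_derivative (\<lambda>q. \<beta> q u) (at p) v"

definition alpha :: "complex^'n::finite \<Rightarrow> complex^'n \<Rightarrow> real" where
  "alpha p u = 2 * (\<Sum>j\<in>UNIV. Re (p$j) * Im (u$j) - Im (p$j) * Re (u$j))"

definition contact_vol :: "complex^'n::finite \<Rightarrow> (nat \<Rightarrow> complex^'n) \<Rightarrow> real" where
  "contact_vol p = wedge 1 (2 * (CARD('n) - 2)) (\<lambda>vs. alpha p (vs 0))
      (wedge_pow2 (\<lambda>vs. ext_d1 alpha p (vs 0) (vs 1)) (CARD('n) - 2))"

definition rcoord :: "nat \<Rightarrow> complex^'n::finite \<Rightarrow> real" where
  "rcoord k u = (if even k then Re (u$(idx (k div 2))) else Im (u$(idx (k div 2))))"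

definition std_det :: "(nat \<Rightarrow> complex^'n::finite) \<Rightarrow> real" where
  "std_det ws = (\<Sum>\<sigma>\<in>{\<sigma>. \<sigma> permutes {..<2 * CARD('n)}}.
      of_int (sign \<sigma>) * (\<Prod>i<2 * CARD('n). rcoord i (ws (\<sigma> i))))"

definition rho :: "complex^'n::finite \<Rightarrow> real" where
  "rho w = (norm w)^2"

definition link :: "(complex^'n::finite \<Rightarrow> complex) \<Rightarrow> real \<Rightarrow> (complex^'n) set" where
  "link g r = {w. g w = 0 \<and> rho w = r^2}"

text \<open>K_r is a smooth submanifold at p: d rho, d Re g, d Im g linearly independent at p.\<close>
definition link_smooth_at :: "(complex^'n::finite \<Rightarrow> complex) \<Rightarrow> complex^'n \<Rightarrow> bool" where
  "link_smooth_at g p \<longleftrightarrow> g differentiable (at p) \<and>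
     surj (\<lambda>u. (frechet_derivative rho (at p) u, frechet_derivative g (at p) u))"

text \<open>v_0..v_{2n-4} is a positively oriented frame of T_p K_r (orientation given by Omega' with
  d rho \<and> Omega' \<and> d Re g \<and> d Im g > 0): the v_i are tangent, and for u0,u1,u2 dual to
  d rho, d Re g, d Im g the frame (u0, v_0, ..., v_{2n-4}, u1, u2) is positive in C^n.\<close>
definition pos_tangent_frame :: "(complex^'n::finite \<Rightarrow> complex) \<Rightarrow> complex^'n \<Rightarrow> (nat \<Rightarrow> complex^'n) \<Rightarrow> bool" where
  "pos_tangent_frame g p v \<longleftrightarrow>
     (\<forall>i < 2 * CARD('n) - 3. frechet_derivative rho (at p) (v i) = 0 \<and> frechet_derivative g (at p) (v i) = 0) \<and>
     (\<forall>u0 u1 u2.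
        frechet_derivative rho (at p) u0 = 1 \<and> frechet_derivative g (at p) u0 = 0 \<and>
        frechet_derivative rho (at p) u1 = 0 \<and> frechet_derivative g (at p) u1 = 1 \<and>
        frechet_derivative rho (at p) u2 = 0 \<and> frechet_derivative g (at p) u2 = \<i> \<longrightarrow>
        std_det (\<lambda>k. if k = 0 then u0 else if k \<le> 2 * CARD('n) - 3 then v (k - 1)
                      else if k = 2 * CARD('n) - 2 then u1 else u2) > 0)"

definition positive_contact :: "(complex^'n::finite \<Rightarrow> complex) \<Rightarrow> real \<Rightarrow> bool" where
  "positive_contact g r \<longleftrightarrow> (\<forall>p\<in>link g r. link_smooth_at g p \<and>
     (\<forall>v. pos_tangent_frame g p v \<longrightarrow> contact_vol p v > 0))"

definition negative_contact :: "(complex^'n::finite \<Rightarrow> complex) \<Rightarrow> real \<Rightarrow> bool" where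
  "negative_contact g r \<longleftrightarrow> (\<forall>p\<in>link g r. link_smooth_at g p \<and>
     (\<forall>v. pos_tangent_frame g p v \<longrightarrow> contact_vol p v < 0))"

end

theory Submission
  imports Defs
begin

text \<open>
  Put \<open>z = \<phi>\<^sub>a\<^sub>,\<^sub>b w\<close> and \<open>h\<^sub>j = z\<^sub>j \<partial>f/\<partial>z\<^sub>j\<close>. In the frame rotated by the phases of \<open>w\<close> the differential of
  \<open>g\<close> multiplies the radial directions by \<open>a + b\<close> and the angular ones by \<open>i(a - b)\<close>. Hence
  \<open>C\<^sub>g = (a\<^sup>2 - b\<^sup>2) \<Sum>\<^bsub>j<k\<^esub> ||w\<^sub>j|q\<^sub>k - |w\<^sub>k|q\<^sub>j|\<^sup>2\<close> with \<open>q\<^sub>j = h\<^sub>j/|w\<^sub>j|\<close>, and every nonzero term of the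
  top form \<open>d\<rho> \<and> \<alpha> \<and> (d\<alpha>)\<^bsup>n-2\<^esup> \<and> d(Re g) \<and> d(Im g)\<close>, evaluated on a rotated real orthonormal basis starting
  with \<open>(|w\<^sub>j|)\<^sub>j\<close>, has the sign of \<open>a - b\<close>. So everything reduces to showing that \<open>h\<close> is not a complex multiple
  of the nonnegative vector \<open>(|w\<^sub>j|\<^sup>2)\<^sub>j\<close> at the zeros \<open>w \<noteq> 0\<close> of \<open>g\<close>.

  For this a compactness argument replaces the curve selection lemma. Along a sequence of
  counterexamples tending to \<open>0\<close>, divide by the sum \<open>M\<close> of the moduli of the low monomials. The
  monomials that survive in the limit are the exponents of a face function \<open>f\<^sub>P\<close>, with \<open>P\<close> a positive
  integral weight obtained by Dirichlet approximation of \<open>(- ln |z\<^sub>j|)\<^sub>j\<close>. The limit of \<open>h/M\<close> is, up to a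
  factor, the Euler vector of \<open>f\<^sub>P\<close> at a zero \<open>u\<close> of \<open>f\<^sub>P\<close> in the torus, and it is \<open>l \<theta>\<close> with \<open>\<theta> \<ge> 0\<close>. By the
  Euler relation \<open>\<Sum>\<^sub>j p\<^sub>j l \<theta>\<^sub>j = 0\<close>, so it vanishes, contradicting non-degeneracy. Zero coordinates are
  reached by continuity, and in the weighted homogeneous case every zero is moved near \<open>0\<close> by the
  weighted action.
\<close>

section \<open>Alternating forms\<close>

text \<open>A limit of counterexamples gives no point of the torus by itself, since every
  \<open>z $ j\<close> tends to 0. Only ratios of the surviving monomials converge, and these see
  the logarithms only through pairings with exponent differences. Projecting the logarithms onto the
  span of those differences leaves a bounded sequence, whose limit supplies the point. Convenience
  enters through pure powers \<open>(z $ j) ^ N j\<close>: they bound everything outside a finite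
  box of exponents by \<open>norm z\<close> times the sum M of the moduli inside it, so a lower
  bound of order M for the low part survives the tail near 0. The low part only approximates the
  Euler vector; the proportionality is therefore imposed on a separate vector and weakened to the
  closed inequality \<open>aligned\<close>, which still forces a vector to vanish once the Euler
  relation holds. On the contact side no determinant of the rotated basis is computed: top forms are
  proportional, a power of the exterior derivative of \<open>alpha\<close> and
  \<open>std_det\<close> are both positive on the standard frame, so symplectic frames are
  positively oriented. The same proportionality carries the sign of the top form to an arbitrary
  oriented tangent frame.\<close>

definition mlin :: "nat \<Rightarrow> ((nat \<Rightarrow> 'v::real_vector) \<Rightarrow> real) \<Rightarrow> bool" where
  "mlin k F \<longleftrightarrow> (\<forall>vs ws. (\<forall>i<k. vs i = ws i) \<longrightarrow> F vs = F ws) \<and>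
     (\<forall>vs i. i < k \<longrightarrow> linear (\<lambda>x. F (vs(i := x))))"

definition alternating :: "nat \<Rightarrow> ((nat \<Rightarrow> 'v::real_vector) \<Rightarrow> real) \<Rightarrow> bool" where
  "alternating k F \<longleftrightarrow> mlin k F \<and>
     (\<forall>\<tau> vs. \<tau> permutes {..<k} \<longrightarrow> F (\<lambda>i. vs (\<tau> i)) = of_int (sign \<tau>) * F vs)"

definition antisymmetrize :: "nat \<Rightarrow> ((nat \<Rightarrow> 'v) \<Rightarrow> real) \<Rightarrow> (nat \<Rightarrow> 'v) \<Rightarrow> real" where
  "antisymmetrize k F vs = (\<Sum>\<sigma> | \<sigma> permutes {..<k}. of_int (sign \<sigma>) * F (\<lambda>i. vs (\<sigma> i)))"

text \<open>Forms act on infinite sequences, as in \<open>wedge\<close>, so \<open>mlin\<close> has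
  to declare the entries from \<open>k\<close> on irrelevant. This is what allows two tuples to be
  exchanged when they agree only on the slots that count.\<close>

lemma mlin_cong: "mlin k F \<Longrightarrow> (\<And>i. i < k \<Longrightarrow> vs i = ws i) \<Longrightarrow> F vs = F ws"
  by (auto simp: mlin_def)

lemma mlin_linear: "mlin k F \<Longrightarrow> i < k \<Longrightarrow> linear (\<lambda>x. F (vs(i := x)))"
  by (auto simp: mlin_def)

lemma mlin_covector: "linear \<phi> \<Longrightarrow> mlin 1 (\<lambda>vs. \<phi> (vs 0))"
  by (auto simp: mlin_def)

lemma linear_times_const: "linear f \<Longrightarrow> linear (\<lambda>x. f x * (c::real))"
  by (auto simp: linear_iff algebra_simps)

lemma linear_const_times: "linear f \<Longrightarrow> linear (\<lambda>x. (c::real) * f x)"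
  by (auto simp: linear_iff algebra_simps)

lemma mlin_mult:
  assumes F: "mlin k F" and G: "mlin l G"
  shows "mlin (k + l) (\<lambda>vs. F vs * G (\<lambda>i. vs (k + i)))"
  unfolding mlin_def
proof (intro conjI allI impI)
  fix vs ws :: "nat \<Rightarrow> 'a" assume eq: "\<forall>i<k+l. vs i = ws i"
  have "F vs = F ws" by (rule mlin_cong[OF F]) (use eq in auto)
  moreover have "G (\<lambda>i. vs (k + i)) = G (\<lambda>i. ws (k + i))"
    by (rule mlin_cong[OF G]) (use eq in auto)
  ultimately show "F vs * G (\<lambda>i. vs (k + i)) = F ws * G (\<lambda>i. ws (k + i))" by simp
next
  fix vs :: "nat \<Rightarrow> 'a" and i assume i: "i < k + l"
  show "linear (\<lambda>x. F (vs(i := x)) * G (\<lambda>j. (vs(i := x)) (k + j)))"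
  proof (cases "i < k")
    case True
    have "(\<lambda>x. F (vs(i := x)) * G (\<lambda>j. (vs(i := x)) (k + j))) =
          (\<lambda>x. F (vs(i := x)) * G (\<lambda>j. vs (k + j)))"
      using True by (intro ext arg_cong2[where f="(*)"] refl mlin_cong[OF G]) auto
    then show ?thesis using linear_times_const[OF mlin_linear[OF F True]] by metis
  next
    case False
    then have i': "i - k < l" using i by auto
    have "(\<lambda>x. F (vs(i := x)) * G (\<lambda>j. (vs(i := x)) (k + j))) =
          (\<lambda>x. F vs * G ((\<lambda>j. vs (k + j))(i - k := x)))"
      using False by (intro ext arg_cong2[where f="(*)"] mlin_cong[OF F] arg_cong[where f=G]) auto
    then show ?thesis using linear_const_times[OF mlin_linear[OF G i']] by metis
  qed
qed

lemma mlin_permute: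
  assumes F: "mlin k F" and s: "\<sigma> permutes {..<k}"
  shows "mlin k (\<lambda>vs. F (\<lambda>i. vs (\<sigma> i)))"
  unfolding mlin_def
proof (intro conjI allI impI)
  fix vs ws :: "nat \<Rightarrow> 'a" assume eq: "\<forall>i<k. vs i = ws i"
  show "F (\<lambda>i. vs (\<sigma> i)) = F (\<lambda>i. ws (\<sigma> i))"
    by (rule mlin_cong[OF F]) (use eq permutes_in_image[OF s] in auto)
next
  fix vs :: "nat \<Rightarrow> 'a" and i assume i: "i < k"
  define j where "j = inv \<sigma> i"
  have j: "j < k" "\<sigma> j = i"
    using i permutes_in_image[OF permutes_inv[OF s], of i] permutes_inverses[OF s]
    by (auto simp: j_def)
  have "(\<lambda>i'. (vs(i := x)) (\<sigma> i')) = (\<lambda>i. vs (\<sigma> i))(j := x)" for x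
  proof
    fix i'
    have "\<sigma> i' = i \<longleftrightarrow> i' = j" using permutes_inj[OF s] j by (auto simp: inj_def)
    then show "(vs(i := x)) (\<sigma> i') = ((\<lambda>i. vs (\<sigma> i))(j := x)) i'" by auto
  qed
  then show "linear (\<lambda>x. F (\<lambda>i'. (vs(i := x)) (\<sigma> i')))"
    using mlin_linear[OF F j(1)] by simp
qed

lemma mlin_scale: "mlin k F \<Longrightarrow> mlin k (\<lambda>vs. c * F vs)"
  unfolding mlin_def by (auto intro!: linear_const_times)

lemma mlin_sum: "(\<And>s. s \<in> S \<Longrightarrow> mlin k (F s)) \<Longrightarrow> mlin k (\<lambda>vs. \<Sum>s\<in>S. F s vs)"
  unfolding mlin_def by (intro conjI allI impI sum.cong linear_compose_sum ballI) auto

lemma alternating_mlin: "alternating k F \<Longrightarrow> mlin k F"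
  by (simp add: alternating_def)

lemma alternating_permute:
  "alternating k F \<Longrightarrow> \<tau> permutes {..<k} \<Longrightarrow> F (\<lambda>i. vs (\<tau> i)) = of_int (sign \<tau>) * F vs"
  by (simp add: alternating_def)

lemma alternating_antisymmetrize:
  assumes F: "mlin k F"
  shows "alternating k (antisymmetrize k F)"
  unfolding alternating_def
proof (intro conjI allI impI)
  show "mlin k (antisymmetrize k F)"
    unfolding antisymmetrize_def
  proof (rule mlin_sum)
    fix \<sigma> assume "\<sigma> \<in> {\<sigma>. \<sigma> permutes {..<k}}"
    then show "mlin k (\<lambda>vs. of_int (sign \<sigma>) * F (\<lambda>i. vs (\<sigma> i)))"
      using mlin_scale[OF mlin_permute[OF F]] by blast
  qed
next
  fix \<tau> and vs :: "nat \<Rightarrow> 'a" assume t: "\<tau> permutes {..<k}"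
  have p: "permutation \<sigma>" if "\<sigma> permutes {..<k}" for \<sigma>
    using that permutation_permutes by blast
  have "of_int (sign \<tau>) * antisymmetrize k F vs =
     (\<Sum>\<sigma> | \<sigma> permutes {..<k}. of_int (sign \<tau>) * (of_int (sign (\<tau> \<circ> \<sigma>)) * F (\<lambda>i. vs ((\<tau> \<circ> \<sigma>) i))))"
    unfolding antisymmetrize_def sum_distrib_left
    by (rule setum_permutations_compose_left[OF t])
  also have "\<dots> = antisymmetrize k F (\<lambda>i. vs (\<tau> i))"
    unfolding antisymmetrize_def
    by (intro sum.cong refl) (auto simp: sign_compose p t simp flip: of_int_mult mult.assoc)
  finally show "antisymmetrize k F (\<lambda>i. vs (\<tau> i)) = of_int (sign \<tau>) * antisymmetrize k F vs" ..
qed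

lemma alternating_scale: "alternating k F \<Longrightarrow> alternating k (\<lambda>vs. c * F vs)"
  unfolding alternating_def by (auto intro: mlin_scale)

lemma alternating_diff: "alternating k F \<Longrightarrow> alternating k G \<Longrightarrow> alternating k (\<lambda>vs. F vs - G vs)"
  unfolding alternating_def mlin_def
  by (intro conjI allI impI linear_compose_sub) (simp_all add: right_diff_distrib, metis)

lemma wedge_eq_antisymmetrize:
  "wedge k l F G vs = antisymmetrize (k + l) (\<lambda>vs. F vs * G (\<lambda>i. vs (k + i))) vs / (fact k * fact l)"
  by (simp add: wedge_def antisymmetrize_def mult.assoc)

lemma alternating_wedge:
  assumes "mlin k F" "mlin l G"
  shows "alternating (k + l) (wedge k l F G)"
  using alternating_scale[OF alternating_antisymmetrize[OF mlin_mult[OF assms]], of "1 / (fact k * fact l)"]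
  by (simp add: wedge_eq_antisymmetrize[abs_def] divide_inverse mult.commute)

lemma alternating_wedge_pow2:
  assumes "mlin 2 F"
  shows "alternating (2 * m) (wedge_pow2 F m)"
proof (induction m)
  case 0
  show ?case by (simp add: alternating_def mlin_def sign_id)
next
  case (Suc m)
  show ?case using alternating_wedge[OF assms alternating_mlin[OF Suc]] by simp
qed

lemma alternating_repeat:
  assumes F: "alternating k F" and "i < k" "j < k" "i \<noteq> j" "vs i = vs j"
  shows "F vs = 0"
proof -
  let ?t = "Transposition.transpose i j"
  have "?t permutes {..<k}" using assms by (intro permutes_swap_id) auto
  from alternating_permute[OF F this, of vs] have "F (\<lambda>i. vs (?t i)) = - F vs"
    using assms by (simp add: sign_swap_id)
  moreover have "(\<lambda>i. vs (?t i)) = vs"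
    using assms by (auto simp: Transposition.transpose_def)
  ultimately show ?thesis by simp
qed

lemma alternating_vanish_span:
  assumes F: "alternating m F" and e: "F e = 0"
    and v: "\<And>i. i < m \<Longrightarrow> v i \<in> span (e ` {..<m})"
  shows "F v = 0"
proof -
  have basis: "F w = 0" if w: "\<And>i. i < m \<Longrightarrow> w i \<in> e ` {..<m}" for w
  proof -
    have "\<forall>i\<in>{..<m}. \<exists>j. j < m \<and> w i = e j" using w by auto
    then obtain s where s: "\<And>i. i < m \<Longrightarrow> s i < m \<and> w i = e (s i)" by (metis lessThan_iff)
    show ?thesis
    proof (cases "inj_on s {..<m}")
      case True
      define \<tau> where "\<tau> i = (if i < m then s i else i)" for i
      have "bij_betw \<tau> {..<m} {..<m}"
      proof -
        have "inj_on \<tau> {..<m}" using True by (auto simp: inj_on_def \<tau>_def)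
        moreover have "\<tau> ` {..<m} \<subseteq> {..<m}" using s by (auto simp: \<tau>_def)
        ultimately show ?thesis by (simp add: bij_betw_def endo_inj_surj)
      qed
      then have t: "\<tau> permutes {..<m}"
        by (intro bij_imp_permutes) (auto simp: \<tau>_def)
      have "F w = F (\<lambda>i. e (\<tau> i))"
        by (rule mlin_cong[OF alternating_mlin[OF F]]) (use s in \<open>auto simp: \<tau>_def\<close>)
      then show ?thesis using alternating_permute[OF F t] e by simp
    next
      case False
      then obtain i j where "i < m" "j < m" "i \<noteq> j" "s i = s j" by (auto simp: inj_on_def)
      then show ?thesis using alternating_repeat[OF F, of i j w] s by metis
    qed
  qed
  \<comment> \<open>Here \<open>k\<close> counts the slots still occupied by arbitrary vectors of
    the span; all later slots hold members of \<open>e\<close>.\<close>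
  have "F w = 0" if "k \<le> m" "\<And>i. i < k \<Longrightarrow> w i \<in> span (e ` {..<m})"
    "\<And>i. k \<le> i \<Longrightarrow> i < m \<Longrightarrow> w i \<in> e ` {..<m}" for k w
    using that
  proof (induction k arbitrary: w)
    case 0
    then show ?case by (intro basis) auto
  next
    case (Suc k)
    have lin: "linear (\<lambda>x. F (w(k := x)))"
      using Suc.prems by (intro mlin_linear[OF alternating_mlin[OF F]]) auto
    have "F (w(k := x)) = 0" if "x \<in> span (e ` {..<m})" for x
    proof (rule linear_eq_0_on_span[OF lin _ that])
      fix y assume "y \<in> e ` {..<m}"
      then show "F (w(k := y)) = 0"
        using Suc.prems by (intro Suc.IH) auto
    qed
    from this[of "w k"] show ?case using Suc.prems(2) by simp
  qed
  from this[of m v] v show ?thesis by simp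
qed

text \<open>The space of top forms is at most a line: the combination
  \<open>G e * F - F e * G\<close> vanishes at \<open>e\<close>, hence everywhere on the span. This
  is the device that transports signs between frames.\<close>

lemma alternating_proportional:
  assumes "alternating m F" "alternating m G"
    and "\<And>i. i < m \<Longrightarrow> v i \<in> span (e ` {..<m})"
  shows "F v * G e = F e * G v"
proof -
  have "alternating m (\<lambda>w. G e * F w - F e * G w)"
    by (intro alternating_diff alternating_scale assms)
  from alternating_vanish_span[OF this, of e v] assms(3) show ?thesis by (simp add: mult.commute)
qed

text \<open>In an expanded wedge product a factor sees only a block of slots, starting at
  \<open>k\<close>. Generating the permutations of that block by transpositions, each conjugated
  down by \<open>k\<close>, reduces to the alternating property of \<open>F\<close>;
  \<open>v\<close> stays general because every transposition changes the tuple.\<close>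

lemma alternating_shift:
  assumes F: "alternating l F" and s: "\<sigma> permutes {k..<k+l}"
  shows "F (\<lambda>i. v (\<sigma> (k + i))) = of_int (sign \<sigma>) * F (\<lambda>i. v (k + i))"
proof -
  have "\<forall>v. F (\<lambda>i. v (\<sigma> (k + i))) = of_int (sign \<sigma>) * F (\<lambda>i. v (k + i))"
    using s finite_atLeastLessThan
  proof (induction rule: permutes_induct)
    case (swap a b p)
    show ?case
    proof
      fix v :: "nat \<Rightarrow> 'a"
      let ?t = "Transposition.transpose a b" and ?t' = "Transposition.transpose (a - k) (b - k)"
      have t': "?t' permutes {..<l}" using swap.hyps by (intro permutes_swap_id) auto
      have "F (\<lambda>i. v ((?t \<circ> p) (k + i))) = of_int (sign p) * F (\<lambda>i. v (?t (k + i)))"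
        using swap.IH[rule_format, of "\<lambda>i. v (?t i)"] by simp
      also have "(\<lambda>i. v (?t (k + i))) = (\<lambda>i. v (k + ?t' i))"
        using swap.hyps by (intro ext arg_cong[where f=v]) (auto simp: Transposition.transpose_def)
      also have "F \<dots> = - F (\<lambda>i. v (k + i))"
        using alternating_permute[OF F t', of "\<lambda>i. v (k + i)"] swap.hyps by (auto simp: sign_swap_id)
      also have "of_int (sign p) * - F (\<lambda>i. v (k + i)) = of_int (sign (?t \<circ> p)) * F (\<lambda>i. v (k + i))"
        using swap.hyps permutation_permutes finite_atLeastLessThan
        by (subst sign_compose) (auto simp: sign_swap_id permutation_swap_id)
      finally show "F (\<lambda>i. v ((?t \<circ> p) (k + i))) = of_int (sign (?t \<circ> p)) * F (\<lambda>i. v (k + i))" .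
    qed
  qed (auto simp: sign_id)
  then show ?thesis by blast
qed

section \<open>Symplectic frames\<close>

text \<open>Only permutations fixing 0 contribute. Their \<open>fact l\<close> terms coincide, since
  the sign from \<open>G\<close> squares away, and this cancels the normalisation of
  \<open>wedge\<close>.\<close>

lemma wedge_covector_eval:
  assumes G: "alternating l G" and 0: "\<And>i. 0 < i \<Longrightarrow> i \<le> l \<Longrightarrow> \<phi> (f i) = 0"
  shows "wedge 1 l (\<lambda>vs. \<phi> (vs 0)) G f = \<phi> (f 0) * G (\<lambda>i. f (1 + i))"
proof -
  let ?T = "\<lambda>\<sigma>. of_int (sign \<sigma>) * \<phi> (f (\<sigma> 0)) * G (\<lambda>i. f (\<sigma> (1 + i)))"
  let ?S = "{\<sigma>. \<sigma> permutes {1..<1+l}}"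
  have "(\<Sum>\<sigma>\<in>{\<sigma>. \<sigma> permutes {..<1+l}}. ?T \<sigma>) = (\<Sum>\<sigma>\<in>?S. ?T \<sigma>)"
  proof (rule sum.mono_neutral_right)
    show "finite {\<sigma>. \<sigma> permutes {..<1+l}}" by (simp add: finite_permutations)
    show "?S \<subseteq> {\<sigma>. \<sigma> permutes {..<1+l}}" by (auto intro: permutes_subset)
    show "\<forall>\<sigma>\<in>{\<sigma>. \<sigma> permutes {..<1+l}} - ?S. ?T \<sigma> = 0"
    proof
      fix \<sigma> assume s: "\<sigma> \<in> {\<sigma>. \<sigma> permutes {..<1+l}} - ?S"
      then have p: "\<sigma> permutes {..<1+l}" and n: "\<not> \<sigma> permutes {1..<1+l}" by auto
      have "\<sigma> 0 \<noteq> 0"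
      proof
        assume "\<sigma> 0 = 0"
        then have "\<sigma> permutes {1..<1+l}"
          by (intro permutes_superset[OF p]) (auto simp: Suc_le_eq)
        with n show False ..
      qed
      moreover have "\<sigma> 0 < 1 + l" using permutes_in_image[OF p, of 0] by auto
      ultimately show "?T \<sigma> = 0" using 0[of "\<sigma> 0"] by simp
    qed
  qed
  also have "\<dots> = (\<Sum>\<sigma>\<in>?S. \<phi> (f 0) * G (\<lambda>i. f (1 + i)))"
  proof (rule sum.cong[OF refl])
    fix \<sigma> assume "\<sigma> \<in> ?S"
    then have p: "\<sigma> permutes {1..<1+l}" by simp
    have "\<sigma> 0 = 0" by (rule permutes_not_in[OF p]) simp
    moreover have "of_int (sign \<sigma>) * of_int (sign \<sigma>) = (1::real)"
      by (simp add: sign_def)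
    ultimately show "?T \<sigma> = \<phi> (f 0) * G (\<lambda>i. f (1 + i))"
      unfolding alternating_shift[OF G p] by (simp add: algebra_simps)
  qed
  also have "\<dots> = fact l * (\<phi> (f 0) * G (\<lambda>i. f (1 + i)))"
    by (simp add: card_permutations[OF refl])
  finally show ?thesis by (simp add: wedge_def)
qed

lemma wedge_covector_zero:
  assumes "\<And>i. i \<le> l \<Longrightarrow> \<phi> (f i) = 0"
  shows "wedge 1 l (\<lambda>vs. \<phi> (vs 0)) G f = 0"
proof -
  have "\<phi> (f (\<sigma> 0)) = 0" if p: "\<sigma> permutes {..<1+l}" for \<sigma>
    using permutes_in_image[OF p, of 0] assms[of "\<sigma> 0"] by auto
  then show ?thesis unfolding wedge_def by (auto intro!: sum.neutral)
qed

text \<open>Exchanges two blocks of consecutive indices while keeping the order inside each. It is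
  even, so symplectic pairs can be moved without changing a sign.\<close>

definition pair_swap :: "nat \<Rightarrow> nat \<Rightarrow> nat \<Rightarrow> nat" where
  "pair_swap s i = Transposition.transpose (2 * s) (2*i) \<circ> Transposition.transpose (2 * s+1) (2*i+1)"

lemma pair_swap_apply:
  "pair_swap s i x = (if x div 2 = s then 2*i + x mod 2 else if x div 2 = i then 2 * s + x mod 2 else x)"
proof (cases "even x")
  case True
  then obtain q where q: "x = 2 * q" by (auto elim: evenE)
  have "2 * q \<noteq> Suc (2 * t)" for t by presburger
  then show ?thesis unfolding q pair_swap_def Transposition.transpose_def by simp
next
  case False
  then obtain q where q: "x = 2 * q + 1" by (auto elim: oddE)
  have "Suc (2 * t) \<noteq> 2 * u" for t u by presburger
  then show ?thesis unfolding q pair_swap_def Transposition.transpose_def by simp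
qed

lemma pair_swap_permutes: "s < M \<Longrightarrow> i < M \<Longrightarrow> pair_swap s i permutes {..<2*M}"
  unfolding pair_swap_def by (intro permutes_compose permutes_swap_id) auto

lemma sign_pair_swap: "sign (pair_swap s i) = 1"
  unfolding pair_swap_def by (subst sign_compose) (auto simp: sign_swap_id permutation_swap_id)

lemma pair_swap_involutive: "pair_swap s i (pair_swap s i x) = x"
  by (auto simp: pair_swap_apply)

lemma pair_swap_div: "pair_swap s i x div 2 = (if x div 2 = s then i else if x div 2 = i then s else x div 2)"
  by (auto simp: pair_swap_apply)

text \<open>A Darboux basis up to positive scaling of each pair. Only signs are needed later, so the
  pairings are not normalised to 1.\<close>

definition symplectic_frame :: "('v \<Rightarrow> 'v \<Rightarrow> real) \<Rightarrow> nat \<Rightarrow> (nat \<Rightarrow> 'v) \<Rightarrow> bool" where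
  "symplectic_frame \<omega> m f \<longleftrightarrow> (\<forall>i<m. \<omega> (f (2*i)) (f (2*i+1)) > 0) \<and>
     (\<forall>i<2*m. \<forall>j<2*m. i div 2 \<noteq> j div 2 \<longrightarrow> \<omega> (f i) (f j) = 0)"

lemma symplectic_frame_pair_swap:
  assumes "symplectic_frame \<omega> m f" "s < m" "i < m"
  shows "symplectic_frame \<omega> m (\<lambda>x. f (pair_swap s i x))"
  unfolding symplectic_frame_def
proof (intro conjI allI impI)
  fix k assume k: "k < m"
  define k' where "k' = (if k = s then i else if k = i then s else k)"
  have "pair_swap s i (2*k) = 2*k'" "pair_swap s i (2*k+1) = 2*k'+1" "k' < m"
    using assms k by (auto simp: pair_swap_apply k'_def)
  then show "\<omega> (f (pair_swap s i (2*k))) (f (pair_swap s i (2*k+1))) > 0"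
    using assms(1) by (auto simp: symplectic_frame_def)
next
  fix k l assume kl: "k < 2*m" "l < 2*m" "k div 2 \<noteq> l div 2"
  have "pair_swap s i x < 2*m" if "x < 2*m" for x
    using permutes_in_image[OF pair_swap_permutes[OF assms(2,3)], of x] that by auto
  moreover have "pair_swap s i k div 2 \<noteq> pair_swap s i l div 2"
    using kl by (auto simp: pair_swap_div)
  ultimately show "\<omega> (f (pair_swap s i k)) (f (pair_swap s i l)) = 0"
    using assms(1) kl by (auto simp: symplectic_frame_def)
qed

lemma symplectic_frame_shift:
  assumes "symplectic_frame \<omega> m f" "k + l \<le> m"
  shows "symplectic_frame \<omega> l (\<lambda>x. f (2*k + x))"
  unfolding symplectic_frame_def
proof (intro conjI allI impI)
  fix i assume "i < l"
  then have "k + i < m" using assms by auto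
  with assms(1) have "\<omega> (f (2*(k+i))) (f (2*(k+i)+1)) > 0" by (auto simp: symplectic_frame_def)
  then show "\<omega> (f (2*k+2*i)) (f (2*k+(2*i+1))) > 0" by (simp add: algebra_simps)
next
  fix i j assume "i < 2*l" "j < 2*l" "i div 2 \<noteq> j div 2"
  then show "\<omega> (f (2*k+i)) (f (2*k+j)) = 0"
    using assms by (auto simp: symplectic_frame_def)
qed

lemma permutation_of_permutes: "p permutes {..<k::nat} \<Longrightarrow> permutation p"
  using permutation_permutes by blast

text \<open>Moving block \<open>k\<close> back to block \<open>s\<close> by an even permutation
  leaves at most a transposition inside the block. Undoing it leaves a permutation of the other
  slots, and its sign is recorded together with the order in which the pair \<open>2*k\<close>,
  \<open>2*k+1\<close> appears.\<close>

lemma permutes_pair_normal_form: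
  assumes p: "\<sigma> permutes {..<2*M}" and s: "s < M" and eq: "\<sigma> (2 * s) div 2 = \<sigma> (2 * s+1) div 2"
  obtains k \<tau> where "k < M" "\<tau> permutes {..<2*M} - {2 * s, 2 * s+1}"
    "\<forall>x. x \<noteq> 2 * s \<longrightarrow> x \<noteq> 2 * s+1 \<longrightarrow> \<sigma> x = pair_swap s k (\<tau> x)"
    "sign \<sigma> = sign \<tau> \<and> \<sigma> (2 * s) = 2*k \<and> \<sigma> (2 * s+1) = 2*k+1 \<or>
     sign \<sigma> = - sign \<tau> \<and> \<sigma> (2 * s) = 2*k+1 \<and> \<sigma> (2 * s+1) = 2*k"
proof -
  define k where "k = \<sigma> (2 * s) div 2"
  have "\<sigma> (2 * s) < 2*M" using permutes_in_image[OF p, of "2 * s"] s by auto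
  then have k: "k < M" by (auto simp: k_def)
  define \<tau>0 where "\<tau>0 = pair_swap s k \<circ> \<sigma>"
  have t0: "\<tau>0 permutes {..<2*M}"
    unfolding \<tau>0_def by (intro permutes_compose[OF p] pair_swap_permutes s k)
  have sg: "sign \<tau>0 = sign \<sigma>"
    unfolding \<tau>0_def using p pair_swap_permutes[OF s k]
    by (subst sign_compose) (auto simp: sign_pair_swap intro: permutation_of_permutes)
  have st: "\<sigma> x = pair_swap s k (\<tau>0 x)" for x
    by (simp add: \<tau>0_def pair_swap_involutive)
  have d: "\<tau>0 (2 * s) div 2 = s" "\<tau>0 (2 * s+1) div 2 = s"
    using eq by (auto simp: \<tau>0_def pair_swap_div k_def)
  have ne: "\<tau>0 (2 * s) \<noteq> \<tau>0 (2 * s+1)"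
    using injD[OF permutes_inj[OF t0], of "2 * s" "2 * s+1"] by auto
  have cases: "\<tau>0 (2 * s) = 2 * s \<and> \<tau>0 (2 * s+1) = 2 * s+1 \<or> \<tau>0 (2 * s) = 2 * s+1 \<and> \<tau>0 (2 * s+1) = 2 * s"
    using d ne by presburger
  have sw: "pair_swap s k (2 * s) = 2*k" "pair_swap s k (2 * s+1) = 2*k+1"
    by (auto simp: pair_swap_apply)
  from cases show thesis
  proof
    assume a: "\<tau>0 (2 * s) = 2 * s \<and> \<tau>0 (2 * s+1) = 2 * s+1"
    show thesis
    proof (rule that[OF k])
      show "\<tau>0 permutes {..<2*M} - {2 * s, 2 * s+1}"
        by (rule permutes_superset[OF t0]) (use a in auto)
      show "\<forall>x. x \<noteq> 2 * s \<longrightarrow> x \<noteq> 2 * s+1 \<longrightarrow> \<sigma> x = pair_swap s k (\<tau>0 x)" using st by blast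
      show "sign \<sigma> = sign \<tau>0 \<and> \<sigma> (2 * s) = 2*k \<and> \<sigma> (2 * s+1) = 2*k+1 \<or>
            sign \<sigma> = - sign \<tau>0 \<and> \<sigma> (2 * s) = 2*k+1 \<and> \<sigma> (2 * s+1) = 2*k"
        using a sg sw unfolding st by simp
    qed
  next
    assume a: "\<tau>0 (2 * s) = 2 * s+1 \<and> \<tau>0 (2 * s+1) = 2 * s"
    let ?t = "Transposition.transpose (2 * s) (2 * s+1)"
    define \<tau> where "\<tau> = \<tau>0 \<circ> ?t"
    have tp: "?t permutes {..<2*M}" using s by (intro permutes_swap_id) auto
    have t: "\<tau> permutes {..<2*M}" unfolding \<tau>_def by (intro permutes_compose tp t0)
    have sg': "sign \<tau> = - sign \<sigma>"
      unfolding \<tau>_def sg[symmetric] using t0 tp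
      by (subst sign_compose) (auto simp: sign_swap_id intro: permutation_of_permutes)
    have a': "\<tau> (2 * s) = 2 * s" "\<tau> (2 * s+1) = 2 * s+1" using a by (auto simp: \<tau>_def)
    show thesis
    proof (rule that[OF k])
      show "\<tau> permutes {..<2*M} - {2 * s, 2 * s+1}"
        by (rule permutes_superset[OF t]) (use a' in auto)
      show "\<forall>x. x \<noteq> 2 * s \<longrightarrow> x \<noteq> 2 * s+1 \<longrightarrow> \<sigma> x = pair_swap s k (\<tau> x)"
        by (simp add: st \<tau>_def Transposition.transpose_def)
      show "sign \<sigma> = sign \<tau> \<and> \<sigma> (2 * s) = 2*k \<and> \<sigma> (2 * s+1) = 2*k+1 \<or>
            sign \<sigma> = - sign \<tau> \<and> \<sigma> (2 * s) = 2*k+1 \<and> \<sigma> (2 * s+1) = 2*k"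
        using a sg' sw unfolding st by simp
    qed
  qed
qed

lemma sign_square: "of_int (sign p) * of_int (sign p) = (1::real)"
  by (simp add: sign_def)

text \<open>In the expansion, a term whose first two slots come from different blocks has a
  vanishing factor. If they form one block, the remaining blocks are again a symplectic frame and
  the induction hypothesis applies. All terms are nonnegative, and the identity gives a positive
  one.\<close>

lemma wedge_pow2_pos:
  assumes lin: "mlin 2 (\<lambda>vs. \<omega> (vs 0) (vs 1))" and anti: "\<And>u v. \<omega> u v = - \<omega> v u"
    and f: "symplectic_frame \<omega> m f"
  shows "wedge_pow2 (\<lambda>vs. \<omega> (vs 0) (vs 1)) m f > 0"
  using f
proof (induction m arbitrary: f)
  case (Suc m)
  let ?W = "wedge_pow2 (\<lambda>vs. \<omega> (vs 0) (vs 1))"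
  let ?T = "\<lambda>\<sigma>. of_int (sign \<sigma>) * \<omega> (f (\<sigma> 0)) (f (\<sigma> 1)) * ?W m (\<lambda>i. f (\<sigma> (2 + i)))"
  let ?P = "{\<sigma>. \<sigma> permutes {..<2+2*m}}"
  have alt: "alternating (2*m) (?W m)" by (rule alternating_wedge_pow2[OF lin])
  have pos: "?T \<sigma> > 0" if p: "\<sigma> permutes {..<2+2*m}" and eq: "\<sigma> 0 div 2 = \<sigma> 1 div 2" for \<sigma>
  proof -
    have p': "\<sigma> permutes {..<2 * Suc m}" using p by simp
    have eq': "\<sigma> (2*0) div 2 = \<sigma> (2*0+1) div 2" using eq by simp
    obtain k \<tau> where k: "k < Suc m" and t0: "\<tau> permutes {..<2 * Suc m} - {2*0, 2*0+1}"
      and st: "\<forall>x. x \<noteq> 2*0 \<longrightarrow> x \<noteq> 2*0+1 \<longrightarrow> \<sigma> x = pair_swap 0 k (\<tau> x)"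
      and alts: "sign \<sigma> = sign \<tau> \<and> \<sigma> (2*0) = 2*k \<and> \<sigma> (2*0+1) = 2*k+1 \<or>
        sign \<sigma> = - sign \<tau> \<and> \<sigma> (2*0) = 2*k+1 \<and> \<sigma> (2*0+1) = 2*k"
      by (rule permutes_pair_normal_form[OF p' zero_less_Suc eq'])
    have "{..<2 * Suc m} - {2*0, 2*0+1} = {2..<2+2*m}" by auto
    with t0 have t: "\<tau> permutes {2..<2+2*m}" by simp
    let ?g = "\<lambda>x. f (pair_swap 0 k x)"
    have "symplectic_frame \<omega> m (\<lambda>x. ?g (2*1 + x))"
      by (rule symplectic_frame_shift[OF symplectic_frame_pair_swap[OF Suc.prems]]) (use k in auto)
    then have W: "?W m (\<lambda>x. ?g (2 + x)) > 0" using Suc.IH by simp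
    have eqW: "?W m (\<lambda>i. f (\<sigma> (2 + i))) = of_int (sign \<tau>) * ?W m (\<lambda>i. ?g (2 + i))"
      using alternating_shift[OF alt t, of ?g] st by simp
    have w: "\<omega> (f (2*k)) (f (2*k+1)) > 0" using Suc.prems k by (auto simp: symplectic_frame_def)
    \<comment> \<open>A reversed pair costs a sign in both \<open>\<omega>\<close> and
      \<open>sign \<sigma>\<close>; the sign of \<open>\<tau>\<close> enters once more through
      \<open>eqW\<close>. Every sign therefore occurs twice.\<close>
    have "?T \<sigma> = (of_int (sign \<tau>) * of_int (sign \<tau>)) * \<omega> (f (2*k)) (f (2*k+1)) * ?W m (\<lambda>i. ?g (2 + i))"
      using alts anti[of "f (2*k+1)" "f (2*k)"] unfolding eqW by auto
    then show ?thesis using w W by (simp add: sign_square)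
  qed
  have nonneg: "?T \<sigma> \<ge> 0" if p: "\<sigma> \<in> ?P" for \<sigma>
  proof (cases "\<sigma> 0 div 2 = \<sigma> 1 div 2")
    case False
    have "\<sigma> 0 < 2 * Suc m" "\<sigma> 1 < 2 * Suc m"
      using p permutes_in_image[of \<sigma> "{..<2+2*m}"] by auto
    with False have "\<omega> (f (\<sigma> 0)) (f (\<sigma> 1)) = 0"
      using Suc.prems unfolding symplectic_frame_def by blast
    then show ?thesis by simp
  qed (use pos p less_imp_le in blast)
  have "(\<Sum>\<sigma>\<in>?P. ?T \<sigma>) > 0"
    using pos[of id] nonneg by (intro sum_pos2[of ?P id]) (auto simp: finite_permutations permutes_id)
  then show ?case by (simp add: wedge_def)
qed simp

text \<open>In each term of the expansion \<open>f i\<close> sits either in the first factor, which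
  vanishes, or in the remaining power, to which induction applies. Both orders of the arguments are
  assumed because \<open>\<omega>\<close> is arbitrary here.\<close>

lemma wedge_pow2_orthogonal:
  assumes "i < 2*m" "\<And>j. j < 2*m \<Longrightarrow> \<omega> (f i) (f j) = 0" "\<And>j. j < 2*m \<Longrightarrow> \<omega> (f j) (f i) = 0"
  shows "wedge_pow2 (\<lambda>vs. \<omega> (vs 0) (vs 1)) m f = 0"
  using assms
proof (induction m arbitrary: f i)
  case (Suc m)
  have "\<omega> (f (\<sigma> 0)) (f (\<sigma> 1)) * wedge_pow2 (\<lambda>vs. \<omega> (vs 0) (vs 1)) m (\<lambda>i. f (\<sigma> (2 + i))) = 0"
    if p: "\<sigma> permutes {..<2+2*m}" for \<sigma>
  proof -
    define j where "j = inv \<sigma> i"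
    have j: "\<sigma> j = i" using permutes_inverses[OF p] by (simp add: j_def)
    have lt: "\<sigma> x < 2 * Suc m" if "x < 2 * Suc m" for x
      using permutes_in_image[OF p, of x] that by auto
    have jl: "j < 2 * Suc m" using permutes_in_image[OF p, of j] Suc.prems(1) j by auto
    consider "j = 0" | "j = 1" | "j \<ge> 2" by linarith
    then show ?thesis
    proof cases
      case 1 then show ?thesis using Suc.prems(2)[of "\<sigma> 1"] lt[of 1] j by auto
    next
      case 2 then show ?thesis using Suc.prems(3)[of "\<sigma> 0"] lt[of 0] j by auto
    next
      case 3
      then have e: "2 + (j - 2) = j" by simp
      have "wedge_pow2 (\<lambda>vs. \<omega> (vs 0) (vs 1)) m (\<lambda>i. f (\<sigma> (2 + i))) = 0"
      proof (rule Suc.IH)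
        show "j - 2 < 2 * m" using 3 jl by auto
        show "\<omega> (f (\<sigma> (2 + (j - 2)))) (f (\<sigma> (2 + x))) = 0" if "x < 2*m" for x
          unfolding e j using Suc.prems(2)[of "\<sigma> (2+x)"] lt[of "2+x"] that by simp
        show "\<omega> (f (\<sigma> (2 + x))) (f (\<sigma> (2 + (j - 2)))) = 0" if "x < 2*m" for x
          unfolding e j using Suc.prems(3)[of "\<sigma> (2+x)"] lt[of "2+x"] that by simp
      qed
      then show ?thesis by simp
    qed
  qed
  then show ?case by (auto simp: wedge_def intro!: sum.neutral)
qed simp

section \<open>The contact form on the link\<close>

text \<open>Up to a positive constant this is \<open>\<rho> \<and> C \<and> \<gamma>\<^sub>1 \<and> \<gamma>\<^sub>2\<close> for a \<open>(2q+1)\<close>-form \<open>C\<close>, in dimension \<open>2q+4\<close>.\<close>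
definition link_form ::
  "nat \<Rightarrow> ('v \<Rightarrow> real) \<Rightarrow> ((nat \<Rightarrow> 'v) \<Rightarrow> real) \<Rightarrow> ('v \<Rightarrow> real) \<Rightarrow> ('v \<Rightarrow> real) \<Rightarrow> (nat \<Rightarrow> 'v) \<Rightarrow> real" where
  "link_form q \<rho> C \<gamma>1 \<gamma>2 = antisymmetrize (2*q+4)
     (\<lambda>vs. \<rho> (vs 0) * (C (\<lambda>i. vs (1 + i)) * (\<gamma>1 (vs (2*q+2)) * \<gamma>2 (vs (2*q+3)))))"

lemma alternating_link_form:
  assumes "linear \<rho>" "mlin (2*q+1) C" "linear \<gamma>1" "linear \<gamma>2"
  shows "alternating (2*q+4) (link_form q \<rho> C \<gamma>1 \<gamma>2)"
proof -
  have 1: "mlin (1 + 1) (\<lambda>vs. \<gamma>1 (vs 0) * \<gamma>2 (vs (1 + 0)))"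
    using mlin_mult[OF mlin_covector[OF assms(3)] mlin_covector[OF assms(4)]] .
  have 2: "mlin (2*q+1 + (1 + 1)) (\<lambda>vs. C vs * (\<gamma>1 (vs (2*q+1+0)) * \<gamma>2 (vs (2*q+1+(1+0)))))"
    using mlin_mult[OF assms(2) 1] .
  have 3: "mlin (1 + (2*q+1 + (1 + 1))) (\<lambda>vs. \<rho> (vs 0) * (C (\<lambda>i. vs (1 + i)) *
      (\<gamma>1 (vs (1+(2*q+1+0))) * \<gamma>2 (vs (1+(2*q+1+(1+0)))))))"
    using mlin_mult[OF mlin_covector[OF assms(1)] 2] .
  have "1 + (2*q+1 + (1 + 1)) = 2*q+4" "1+(2*q+1+0) = 2*q+2" "1+(2*q+1+(1+0)) = 2*q+3" by auto
  with 3 show ?thesis unfolding link_form_def by (intro alternating_antisymmetrize) metis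
qed

text \<open>Duality forces the slots of \<open>\<rho>\<close>, \<open>\<gamma>1\<close> and
  \<open>\<gamma>2\<close> to be filled by their own dual vectors. What is left permutes the
  arguments of \<open>C\<close>, and the sign from \<open>C\<close> cancels the sign of the
  permutation. This recovers the contact form on a tangent frame as the value of a top form.\<close>

lemma link_form_dual_frame:
  fixes w :: "nat \<Rightarrow> 'v::real_vector"
  assumes C: "alternating (2*q+1) C"
    and w0: "\<rho> (w 0) = 1" "\<And>i. 0 < i \<Longrightarrow> i < 2*q+4 \<Longrightarrow> \<rho> (w i) = 0"
    and w1: "\<gamma>1 (w (2*q+2)) = 1" "\<And>i. i < 2*q+4 \<Longrightarrow> i \<noteq> 2*q+2 \<Longrightarrow> \<gamma>1 (w i) = 0"
    and w2: "\<gamma>2 (w (2*q+3)) = 1" "\<And>i. i < 2*q+4 \<Longrightarrow> i \<noteq> 2*q+3 \<Longrightarrow> \<gamma>2 (w i) = 0"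
  shows "link_form q \<rho> C \<gamma>1 \<gamma>2 w = fact (2*q+1) * C (\<lambda>i. w (1 + i))"
proof -
  let ?T = "\<lambda>\<sigma>. of_int (sign \<sigma>) * (\<rho> (w (\<sigma> 0)) * (C (\<lambda>i. w (\<sigma> (1 + i))) *
     (\<gamma>1 (w (\<sigma> (2*q+2))) * \<gamma>2 (w (\<sigma> (2*q+3))))))"
  let ?S = "{\<sigma>. \<sigma> permutes {1..<1+(2*q+1)}}" and ?P = "{\<sigma>. \<sigma> permutes {..<2*q+4}}"
  have "sum ?T ?P = sum ?T ?S"
  proof (rule sum.mono_neutral_right)
    show "finite ?P" by (simp add: finite_permutations)
    show "?S \<subseteq> ?P" by (auto intro: permutes_subset)
    show "\<forall>\<sigma>\<in>?P - ?S. ?T \<sigma> = 0"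
    proof
      fix \<sigma> assume s: "\<sigma> \<in> ?P - ?S"
      then have p: "\<sigma> permutes {..<2*q+4}" and n: "\<not> \<sigma> permutes {1..<1+(2*q+1)}" by auto
      have lt: "\<sigma> x < 2*q+4" if "x < 2*q+4" for x using permutes_in_image[OF p, of x] that by auto
      have "\<not> (\<sigma> 0 = 0 \<and> \<sigma> (2*q+2) = 2*q+2 \<and> \<sigma> (2*q+3) = 2*q+3)"
      proof
        assume a: "\<sigma> 0 = 0 \<and> \<sigma> (2*q+2) = 2*q+2 \<and> \<sigma> (2*q+3) = 2*q+3"
        have "\<sigma> permutes {1..<1+(2*q+1)}"
        proof (rule permutes_superset[OF p])
          fix x assume "x \<in> {..<2*q+4} - {1..<1+(2*q+1)}"
          then have "x = 0 \<or> x = 2*q+2 \<or> x = 2*q+3" by auto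
          then show "\<sigma> x = x" using a by auto
        qed
        with n show False ..
      qed
      then show "?T \<sigma> = 0"
        using w0(2)[of "\<sigma> 0"] w1(2)[of "\<sigma> (2*q+2)"] w2(2)[of "\<sigma> (2*q+3)"] lt[of 0] lt[of "2*q+2"] lt[of "2*q+3"]
        by auto
    qed
  qed
  also have "\<dots> = (\<Sum>\<sigma>\<in>?S. C (\<lambda>i. w (1 + i)))"
  proof (rule sum.cong[OF refl])
    fix \<sigma> assume "\<sigma> \<in> ?S"
    then have p: "\<sigma> permutes {1..<1+(2*q+1)}" by simp
    have fx: "\<sigma> 0 = 0" "\<sigma> (2*q+2) = 2*q+2" "\<sigma> (2*q+3) = 2*q+3"
      by (rule permutes_not_in[OF p]; simp)+
    show "?T \<sigma> = C (\<lambda>i. w (1 + i))"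
      unfolding alternating_shift[OF C p] fx w0(1) w1(1) w2(1)
      by (simp add: sign_square flip: mult.assoc)
  qed
  also have "\<dots> = fact (2*q+1) * C (\<lambda>i. w (1 + i))"
  proof -
    have "card ?S = fact (2*q+1)"
      using card_permutations[OF refl, of "{1..<1+(2*q+1)}"] by simp
    then show ?thesis by (simp only: sum_constant of_nat_fact)
  qed
  finally show ?thesis by (simp add: link_form_def antisymmetrize_def)
qed

text \<open>Nonzero terms have \<open>e 0\<close> in the slot of \<open>\<rho>\<close> and
  \<open>e 1\<close> among the arguments of \<open>C\<close>. The covectors
  \<open>\<gamma>1\<close>, \<open>\<gamma>2\<close> must then consume one whole block: otherwise a
  vector whose partner is missing remains for the power of \<open>\<omega>\<close>, which vanishes.
  The two orders inside a block enter with opposite signs, which explains the opposite inequalities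
  in the hypotheses; block \<open>k0\<close> makes the sum strictly nonzero.\<close>

lemma link_form_symplectic_frame:
  fixes e :: "nat \<Rightarrow> 'v::real_vector"
  assumes lin: "mlin 2 (\<lambda>vs. \<omega> (vs 0) (vs 1))" and anti: "\<And>u v. \<omega> u v = - \<omega> v u"
    and \<alpha>: "linear \<alpha>"
    and e: "symplectic_frame \<omega> (q+2) e"
    and r: "\<rho> (e 0) > 0" "\<And>i. 0 < i \<Longrightarrow> i < 2*q+4 \<Longrightarrow> \<rho> (e i) = 0"
    and al: "\<alpha> (e 1) > 0" "\<And>i. i < 2*q+4 \<Longrightarrow> i \<noteq> 1 \<Longrightarrow> \<alpha> (e i) = 0"
    and nn: "\<And>k. 0 < k \<Longrightarrow> k < q+2 \<Longrightarrow> s * (\<gamma>1 (e (2*k)) * \<gamma>2 (e (2*k+1))) \<ge> 0"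
            "\<And>k. 0 < k \<Longrightarrow> k < q+2 \<Longrightarrow> s * (\<gamma>1 (e (2*k+1)) * \<gamma>2 (e (2*k))) \<le> 0"
    and k0: "0 < k0" "k0 < q+2"
      "s * (\<gamma>1 (e (2*k0)) * \<gamma>2 (e (2*k0+1))) > 0 \<or> s * (\<gamma>1 (e (2*k0+1)) * \<gamma>2 (e (2*k0))) < 0"
  defines "\<eta> \<equiv> wedge_pow2 (\<lambda>vs. \<omega> (vs 0) (vs 1)) q"
  shows "s * link_form q \<rho> (wedge 1 (2*q) (\<lambda>vs. \<alpha> (vs 0)) \<eta>) \<gamma>1 \<gamma>2 e > 0"
proof -
  let ?C = "wedge 1 (2*q) (\<lambda>vs. \<alpha> (vs 0)) \<eta>"
  let ?P = "{\<sigma>. \<sigma> permutes {..<2*q+4}}"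
  have alt: "alternating (2*q) \<eta>" unfolding \<eta>_def by (rule alternating_wedge_pow2[OF lin])
  have altC: "alternating (2*q+1) ?C"
    using alternating_wedge[OF mlin_covector[OF \<alpha>] alternating_mlin[OF alt]] by simp
  define T where "T \<sigma> = s * (of_int (sign \<sigma>) * (\<rho> (e (\<sigma> 0)) * (?C (\<lambda>i. e (\<sigma> (1 + i))) *
     (\<gamma>1 (e (\<sigma> (2*q+2))) * \<gamma>2 (e (\<sigma> (2*q+3)))))))" for \<sigma>
  \<comment> \<open>The case in which both covectors see the same block \<open>k\<close>. The
    constant \<open>c\<close> collects the values of \<open>\<rho>\<close>, \<open>\<alpha>\<close>
    and the power of \<open>\<omega>\<close> on the other blocks, all positive.\<close>
  have T_block: "\<exists>k c. 0 < k \<and> k < q+2 \<and> 0 < c \<and>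
      (\<sigma> (2*q+2) = 2*k \<and> T \<sigma> = c * (s * (\<gamma>1 (e (2*k)) * \<gamma>2 (e (2*k+1)))) \<or>
       \<sigma> (2*q+2) = 2*k+1 \<and> T \<sigma> = - c * (s * (\<gamma>1 (e (2*k+1)) * \<gamma>2 (e (2*k)))))"
    if p: "\<sigma> permutes {..<2*q+4}" and s0: "\<sigma> 0 = 0" and s1: "\<sigma> 1 = 1"
      and eq: "\<sigma> (2*q+2) div 2 = \<sigma> (2*q+3) div 2" for \<sigma>
  proof -
    have "2*(q+2) = 2*q+4" by simp
    with p have p': "\<sigma> permutes {..<2*(q+2)}" by metis
    have eq': "\<sigma> (2*(q+1)) div 2 = \<sigma> (2*(q+1)+1) div 2" using eq by (simp add: eval_nat_numeral)
    have lt: "q + 1 < q + 2" by simp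
    obtain k \<tau> where k: "k < q+2" and t0: "\<tau> permutes {..<2*(q+2)} - {2*(q+1), 2*(q+1)+1}"
      and st: "\<forall>x. x \<noteq> 2*(q+1) \<longrightarrow> x \<noteq> 2*(q+1)+1 \<longrightarrow> \<sigma> x = pair_swap (q+1) k (\<tau> x)"
      and alts: "sign \<sigma> = sign \<tau> \<and> \<sigma> (2*(q+1)) = 2*k \<and> \<sigma> (2*(q+1)+1) = 2*k+1 \<or>
        sign \<sigma> = - sign \<tau> \<and> \<sigma> (2*(q+1)) = 2*k+1 \<and> \<sigma> (2*(q+1)+1) = 2*k"
      by (rule permutes_pair_normal_form[OF p' lt eq'])
    have kpos: "k \<noteq> 0"
    proof
      assume "k = 0"
      then have "\<sigma> (2*(q+1)) = 0 \<or> \<sigma> (2*(q+1)) = 1" using alts by auto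
      then have "\<sigma> (2*(q+1)) = \<sigma> 0 \<or> \<sigma> (2*(q+1)) = \<sigma> 1" using s0 s1 by simp
      then show False using injD[OF permutes_inj[OF p], of "2*(q+1)" 0] injD[OF permutes_inj[OF p], of "2*(q+1)" 1]
        by auto
    qed
    have fx: "\<tau> x = x" if "x < 2" for x
    proof -
      have "\<sigma> x = x" using s0 s1 that by (cases x) auto
      then have "pair_swap (q+1) k (\<tau> x) = x" using st that by auto
      then have "pair_swap (q+1) k (pair_swap (q+1) k (\<tau> x)) = pair_swap (q+1) k x" by simp
      then show ?thesis unfolding pair_swap_involutive using that kpos by (simp add: pair_swap_apply)
    qed
    have t: "\<tau> permutes {2..<2+2*q}"
    proof (rule permutes_superset[OF t0])
      fix x assume "x \<in> {..<2*(q+2)} - {2*(q+1), 2*(q+1)+1} - {2..<2+2*q}"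
      then have "x < 2" by auto
      then show "\<tau> x = x" by (rule fx)
    qed
    let ?g = "\<lambda>x. e (pair_swap (q+1) k x)"
    have "symplectic_frame \<omega> q (\<lambda>x. ?g (2*1 + x))"
      by (rule symplectic_frame_shift[OF symplectic_frame_pair_swap[OF e]]) (use k in auto)
    then have W: "\<eta> (\<lambda>x. ?g (2 + x)) > 0"
      unfolding \<eta>_def using wedge_pow2_pos[OF lin anti] by simp
    have "\<eta> (\<lambda>i. e (\<sigma> (2 + i))) = \<eta> (\<lambda>i. ?g (\<tau> (2 + i)))"
      by (rule mlin_cong[OF alternating_mlin[OF alt]]) (use st in auto)
    then have eqW: "\<eta> (\<lambda>i. e (\<sigma> (2 + i))) = of_int (sign \<tau>) * \<eta> (\<lambda>i. ?g (2 + i))"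
      using alternating_shift[OF alt t, of ?g] by simp
    have al0: "\<alpha> (e (\<sigma> (1 + i))) = 0" if "0 < i" "i \<le> 2*q" for i
    proof (rule al(2))
      show "\<sigma> (1 + i) < 2*q+4" using permutes_in_image[OF p, of "1+i"] that by auto
      show "\<sigma> (1 + i) \<noteq> 1" using injD[OF permutes_inj[OF p], of "1+i" 1] s1 that by auto
    qed
    have "?C (\<lambda>i. e (\<sigma> (1 + i))) = \<alpha> (e (\<sigma> (1 + 0))) * \<eta> (\<lambda>i. e (\<sigma> (1 + (1 + i))))"
      by (rule wedge_covector_eval[OF alt, where \<phi>=\<alpha> and f="\<lambda>i. e (\<sigma> (1 + i))"]) (rule al0)
    also have "\<dots> = \<alpha> (e 1) * (of_int (sign \<tau>) * \<eta> (\<lambda>i. ?g (2 + i)))"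
      using s1 eqW by simp
    finally have CC: "?C (\<lambda>i. e (\<sigma> (1 + i))) = \<alpha> (e 1) * (of_int (sign \<tau>) * \<eta> (\<lambda>i. ?g (2 + i)))" .
    define c where "c = \<rho> (e 0) * (\<alpha> (e 1) * \<eta> (\<lambda>i. ?g (2 + i)))"
    have c: "c > 0" unfolding c_def using r(1) al(1) W by simp
    have TT: "T \<sigma> = (of_int (sign \<sigma>) * of_int (sign \<tau>)) * c * (s * (\<gamma>1 (e (\<sigma> (2*q+2))) * \<gamma>2 (e (\<sigma> (2*q+3)))))"
      unfolding T_def CC c_def s0 by (simp add: algebra_simps)
    have i2: "2*(q+1) = 2*q+2" "2*q+2+1 = 2*q+3" by auto
    have sq: "of_int (sign \<sigma>) * of_int (sign \<tau>) = (if sign \<sigma> = sign \<tau> then 1 else -1 :: real)"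
      by (auto simp: sign_def)
    have "sign \<tau> \<noteq> - sign \<tau>" by (auto simp: sign_def)
    then have "\<sigma> (2*q+2) = 2*k \<and> T \<sigma> = c * (s * (\<gamma>1 (e (2*k)) * \<gamma>2 (e (2*k+1)))) \<or>
       \<sigma> (2*q+2) = 2*k+1 \<and> T \<sigma> = - c * (s * (\<gamma>1 (e (2*k+1)) * \<gamma>2 (e (2*k))))"
      using alts[unfolded i2] unfolding TT sq by (elim disjE conjE) simp_all
    then show ?thesis using c k kpos by blast
  qed
  have T_norm: "T \<sigma> \<ge> 0" if p: "\<sigma> permutes {..<2*q+4}" and s0: "\<sigma> 0 = 0" and s1: "\<sigma> 1 = 1" for \<sigma>
  proof (cases "\<sigma> (2*q+2) div 2 = \<sigma> (2*q+3) div 2")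
    case True
    from T_block[OF p s0 s1 True] show ?thesis using nn
      by (elim exE conjE disjE) (auto simp: mult_le_0_iff)
  next
    case False
    \<comment> \<open>The partner of \<open>\<sigma> (2*q+2)\<close> in its block. It is in no slot
      of \<open>\<rho>\<close>, of \<open>\<gamma>1\<close> or \<open>\<gamma>2\<close>, nor in slot
      1, so it is an argument of \<open>\<eta>\<close>, where nothing pairs with it.\<close>
    define x where "x = (if even (\<sigma> (2*q+2)) then \<sigma> (2*q+2) + 1 else \<sigma> (2*q+2) - 1)"
    have xd: "x div 2 = \<sigma> (2*q+2) div 2" and xn: "x \<noteq> \<sigma> (2*q+2)"
      unfolding x_def by (auto elim!: evenE oddE)
    have lt: "\<sigma> y < 2*q+4" if "y < 2*q+4" for y using permutes_in_image[OF p, of y] that by auto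
    have inj: "\<sigma> y = \<sigma> y' \<Longrightarrow> y = y'" for y y' using injD[OF permutes_inj[OF p]] .
    define j where "j = inv \<sigma> x"
    have j: "\<sigma> j = x" using permutes_inverses[OF p] by (simp add: j_def)
    have "\<sigma> (2*q+2) < 2*(q+2)" using lt[of "2*q+2"] by simp
    then have "x < 2*(q+2)" using xd by (metis div_less_iff_less_mult mult.commute pos2)
    then have jl: "j < 2*q+4" using permutes_in_image[OF p, of j] j by auto
    have n0: "\<sigma> (2*q+2) \<noteq> 0" "\<sigma> (2*q+2) \<noteq> 1"
      using inj[of "2*q+2" 0] inj[of "2*q+2" 1] s0 s1 by auto
    then have "\<sigma> (2*q+2) div 2 \<noteq> 0" by auto
    then have "x \<noteq> 0" "x \<noteq> 1" using xd by auto
    then have "j \<noteq> 0" "j \<noteq> 1" using j s0 s1 by metis+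
    moreover have "j \<noteq> 2*q+2" "j \<noteq> 2*q+3" using j xn xd False by metis+
    ultimately have j2: "j = 2 + (j - 2)" "j - 2 < 2*q" using jl by auto
    \<comment> \<open>Blocks have two elements, so a third index lies in another block.\<close>
    have block: "a div 2 \<noteq> b div 2" if "b div 2 = c div 2" "b \<noteq> c" "a \<noteq> b" "a \<noteq> c" for a b c :: nat
    proof
      assume "a div 2 = b div 2"
      with that have "a mod 2 \<noteq> b mod 2" "a mod 2 \<noteq> c mod 2" "b mod 2 \<noteq> c mod 2"
        by (metis div_mult_mod_eq)+
      then show False by (simp add: mod2_eq_if split: if_splits)
    qed
    have orth: "\<omega> (e x) (e (\<sigma> (2 + i))) = 0" "\<omega> (e (\<sigma> (2 + i))) (e x) = 0" if i: "i < 2*q" "2 + i \<noteq> j" for i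
    proof -
      have "\<sigma> (2 + i) \<noteq> x" "\<sigma> (2 + i) \<noteq> \<sigma> (2*q+2)" using inj[of "2+i" j] inj[of "2+i" "2*q+2"] i j by auto
      then have "\<sigma> (2 + i) div 2 \<noteq> x div 2" using block[OF xd xn] by blast
      then show "\<omega> (e x) (e (\<sigma> (2 + i))) = 0" "\<omega> (e (\<sigma> (2 + i))) (e x) = 0"
        using e \<open>x < 2*(q+2)\<close> lt[of "2+i"] i unfolding symplectic_frame_def by auto
    qed
    have self: "\<omega> (e x) (e x) = 0" using anti[of "e x" "e x"] by simp
    have "\<eta> (\<lambda>i. e (\<sigma> (2 + i))) = 0"
      unfolding \<eta>_def
    proof (rule wedge_pow2_orthogonal[OF j2(2)])
      fix i assume i: "i < 2*q"
      show "\<omega> (e (\<sigma> (2 + (j - 2)))) (e (\<sigma> (2 + i))) = 0"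
        unfolding j2(1)[symmetric] j using orth(1)[OF i] self j by (cases "2 + i = j") auto
      show "\<omega> (e (\<sigma> (2 + i))) (e (\<sigma> (2 + (j - 2)))) = 0"
        unfolding j2(1)[symmetric] j using orth(2)[OF i] self j by (cases "2 + i = j") auto
    qed
    moreover have "?C (\<lambda>i. e (\<sigma> (1 + i))) = \<alpha> (e (\<sigma> (1 + 0))) * \<eta> (\<lambda>i. e (\<sigma> (1 + (1 + i))))"
    proof (rule wedge_covector_eval[OF alt, where \<phi>=\<alpha> and f="\<lambda>i. e (\<sigma> (1 + i))"])
      fix i :: nat assume i: "0 < i" "i \<le> 2*q"
      show "\<alpha> (e (\<sigma> (1 + i))) = 0"
        by (rule al(2)) (use i lt[of "1+i"] inj[of "1+i" 1] s1 in auto)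
    qed
    ultimately show ?thesis by (simp add: T_def)
  qed
  have T_nonneg: "T \<sigma> \<ge> 0" if p: "\<sigma> permutes {..<2*q+4}" for \<sigma>
  proof (cases "\<sigma> 0 = 0")
    case False
    have "\<sigma> 0 < 2*q+4" using permutes_in_image[OF p, of 0] by auto
    with False show ?thesis using r(2)[of "\<sigma> 0"] by (simp add: T_def)
  next
    case s0: True
    have lt: "\<sigma> y < 2*q+4" if "y < 2*q+4" for y using permutes_in_image[OF p, of y] that by auto
    define j where "j = inv \<sigma> 1"
    have j: "\<sigma> j = 1" using permutes_inverses[OF p] by (simp add: j_def)
    have jl: "j < 2*q+4" using permutes_in_image[OF p, of j] j by auto
    have j0: "j \<noteq> 0" using j s0 by (metis zero_neq_one)
    show ?thesis
    proof (cases "j < 2*q+2")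
      \<comment> \<open>Now \<open>e 1\<close> occupies a slot of \<open>\<gamma>1\<close> or
        \<open>\<gamma>2\<close>, and \<open>\<alpha>\<close> vanishes on every argument of
        \<open>C\<close>.\<close>
      case False
      have "?C (\<lambda>i. e (\<sigma> (1 + i))) = 0"
      proof (rule wedge_covector_zero[where \<phi>=\<alpha> and f="\<lambda>i. e (\<sigma> (1 + i))"])
        fix i assume i: "i \<le> 2*q"
        have "\<sigma> (1 + i) \<noteq> 1" using injD[OF permutes_inj[OF p], of "1+i" j] j False i by auto
        then show "\<alpha> (e (\<sigma> (1 + i))) = 0" using al(2) lt[of "1+i"] i by auto
      qed
      then show ?thesis by (simp add: T_def)
    next
      case True
      \<comment> \<open>The transposition brings \<open>e 1\<close> to the first slot of
        \<open>C\<close>. Since \<open>C\<close> is alternating, its sign cancels that of the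
        permutation, so \<open>T\<close> is unchanged and \<open>T_norm\<close> applies.\<close>
      let ?t = "Transposition.transpose 1 j"
      have tp: "?t permutes {1..<1+(2*q+1)}" using True j0 by (intro permutes_swap_id) auto
      then have tp': "?t permutes {..<2*q+4}" by (rule permutes_subset) auto
      have st: "(\<sigma> \<circ> ?t) permutes {..<2*q+4}" by (rule permutes_compose[OF tp' p])
      have "T (\<sigma> \<circ> ?t) \<ge> 0"
        by (rule T_norm[OF st]) (use j j0 s0 in \<open>auto simp: Transposition.transpose_def\<close>)
      moreover have "T (\<sigma> \<circ> ?t) = T \<sigma>"
      proof -
        have sg: "sign (\<sigma> \<circ> ?t) = sign \<sigma> * sign ?t"
          using p tp' by (intro sign_compose) (auto intro: permutation_of_permutes)
        have "?C (\<lambda>i. e ((\<sigma> \<circ> ?t) (1 + i))) = of_int (sign ?t) * ?C (\<lambda>i. e (\<sigma> (1 + i)))"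
          using alternating_shift[OF altC tp, of "\<lambda>i. e (\<sigma> i)"] by simp
        moreover have "(\<sigma> \<circ> ?t) 0 = \<sigma> 0" "(\<sigma> \<circ> ?t) (2*q+2) = \<sigma> (2*q+2)" "(\<sigma> \<circ> ?t) (2*q+3) = \<sigma> (2*q+3)"
          using True j0 by (auto simp: Transposition.transpose_def)
        ultimately show ?thesis unfolding T_def sg
          by (simp add: sign_square mult.left_commute[of _ "of_int (sign ?t)"] flip: mult.assoc)
      qed
      ultimately show ?thesis by simp
    qed
  qed
  have "\<exists>\<sigma>\<in>?P. T \<sigma> > 0"
  proof -
    \<comment> \<open>Two candidates for a positive term: block \<open>k0\<close> placed in the last
      two slots, in its own order or reversed, according to which alternative of
      \<open>k0(3)\<close> holds.\<close>
    let ?pi = "pair_swap (q+1) k0" and ?t = "Transposition.transpose (2*q+2) (2*q+3)"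
    have pp: "?pi permutes {..<2*q+4}" 
    proof -
      have "2*(q+2) = 2*q+4" by simp
      then show ?thesis using pair_swap_permutes[of "q+1" "q+2" k0] k0 by (metis add_strict_left_mono one_less_numeral_iff semiring_norm(76))
    qed
    have tp: "?t permutes {..<2*q+4}" by (intro permutes_swap_id) auto
    have pip: "(?pi \<circ> ?t) permutes {..<2*q+4}" by (rule permutes_compose[OF tp pp])
    have v: "?pi 0 = 0" "?pi 1 = 1" "?pi (2*q+2) = 2*k0" "?pi (2*q+3) = 2*k0+1"
      using k0 by (auto simp: pair_swap_apply)
    have tv: "?t 0 = 0" "?t 1 = 1" "?t (2*q+2) = 2*q+3" "?t (2*q+3) = 2*q+2"
      by (auto simp: Transposition.transpose_def)
    have v': "(?pi \<circ> ?t) 0 = 0" "(?pi \<circ> ?t) 1 = 1" "(?pi \<circ> ?t) (2*q+2) = 2*k0+1" "(?pi \<circ> ?t) (2*q+3) = 2*k0"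
      unfolding o_def tv v by auto
    from k0(3) show ?thesis
    proof
      assume pos: "s * (\<gamma>1 (e (2*k0)) * \<gamma>2 (e (2*k0+1))) > 0"
      have eq: "?pi (2*q+2) div 2 = ?pi (2*q+3) div 2" unfolding v by simp
      obtain k c where kc: "0 < k" "k < q+2" "0 < c"
        "?pi (2*q+2) = 2*k \<and> T ?pi = c * (s * (\<gamma>1 (e (2*k)) * \<gamma>2 (e (2*k+1)))) \<or>
         ?pi (2*q+2) = 2*k+1 \<and> T ?pi = - c * (s * (\<gamma>1 (e (2*k+1)) * \<gamma>2 (e (2*k))))"
        using T_block[OF pp v(1,2) eq] by blast
      have "2*k0 \<noteq> 2*k+1" by presburger
      then have "k = k0" "T ?pi = c * (s * (\<gamma>1 (e (2*k)) * \<gamma>2 (e (2*k+1))))" using kc(4) unfolding v(3) by auto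
      then have "T ?pi > 0" using pos kc(3) by simp
      then show ?thesis using pp by blast
    next
      assume neg: "s * (\<gamma>1 (e (2*k0+1)) * \<gamma>2 (e (2*k0))) < 0"
      have eq: "(?pi \<circ> ?t) (2*q+2) div 2 = (?pi \<circ> ?t) (2*q+3) div 2" unfolding v' by simp
      obtain k c where kc: "0 < k" "k < q+2" "0 < c"
        "(?pi \<circ> ?t) (2*q+2) = 2*k \<and> T (?pi \<circ> ?t) = c * (s * (\<gamma>1 (e (2*k)) * \<gamma>2 (e (2*k+1)))) \<or>
         (?pi \<circ> ?t) (2*q+2) = 2*k+1 \<and> T (?pi \<circ> ?t) = - c * (s * (\<gamma>1 (e (2*k+1)) * \<gamma>2 (e (2*k))))"
        using T_block[OF pip v'(1,2) eq] by blast
      have "2*k \<noteq> 2*k0+1" by presburger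
      then have "k = k0" "T (?pi \<circ> ?t) = - c * (s * (\<gamma>1 (e (2*k+1)) * \<gamma>2 (e (2*k))))"
        using kc(4) unfolding v' by auto
      then have "T (?pi \<circ> ?t) > 0" using neg kc(3) by (simp add: mult_pos_neg)
      then show ?thesis using pip by blast
    qed
  qed
  then obtain \<sigma>0 where s0: "\<sigma>0 \<in> ?P" "T \<sigma>0 > 0" by blast
  have "finite ?P" by (simp add: finite_permutations)
  then have "sum T ?P > 0" using s0 T_nonneg by (intro sum_pos2[of ?P \<sigma>0]) auto
  then show ?thesis by (simp add: link_form_def antisymmetrize_def T_def[abs_def] sum_distrib_left)
qed

section \<open>Coordinates, the standard contact form and the orientation of complex n-space\<close>

lemma idx_bij: "bij_betw (idx :: nat \<Rightarrow> 'n::finite) {..<CARD('n)} UNIV"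
proof -
  obtain h :: "nat \<Rightarrow> 'n" where "bij_betw h {0..<CARD('n)} UNIV"
    using ex_bij_betw_nat_finite[of "UNIV :: 'n set"] by auto
  then have "bij_betw h {..<CARD('n)} UNIV" by (simp add: atLeast0LessThan)
  then show ?thesis unfolding idx_def by (rule someI[where P="\<lambda>e. bij_betw e {..<CARD('n)} UNIV"])
qed

lemma idx_inj: "i < CARD('n) \<Longrightarrow> j < CARD('n) \<Longrightarrow> (idx i :: 'n::finite) = idx j \<longleftrightarrow> i = j"
  using idx_bij[where 'n='n] by (auto simp: bij_betw_def inj_on_def)

lemma idx_surj: obtains i where "i < CARD('n)" "(x :: 'n::finite) = idx i"
  using idx_bij[where 'n='n] by (auto simp: bij_betw_def)

lemma frechet_derivative_rho:
  fixes p :: "complex^'n::finite"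
  shows "(rho has_derivative (\<lambda>u. 2 * (p \<bullet> u))) (at p)"
  "frechet_derivative rho (at p) = (\<lambda>u. 2 * (p \<bullet> u))"
proof -
  have "rho = (\<lambda>w :: complex^'n. w \<bullet> w)" by (auto simp: rho_def power2_norm_eq_inner)
  moreover have "((\<lambda>w. w \<bullet> w) has_derivative (\<lambda>u. 2 * (p \<bullet> u))) (at p)"
    by (auto intro!: derivative_eq_intros simp: inner_commute)
  ultimately show d: "(rho has_derivative (\<lambda>u. 2 * (p \<bullet> u))) (at p)" by simp
  then show "frechet_derivative rho (at p) = (\<lambda>u. 2 * (p \<bullet> u))"
    by (simp add: frechet_derivative_at[symmetric])
qed

lemma alpha_antisym: "alpha u v = - alpha v u"
  by (simp add: alpha_def sum_negf[symmetric] algebra_simps)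

lemma linear_alpha_right: "linear (alpha p)"
  by (rule linearI) (simp_all add: alpha_def algebra_simps sum.distrib sum_distrib_left sum_subtractf)

lemma linear_alpha_left: "linear (\<lambda>p. alpha p u)"
  by (rule linearI) (simp_all add: alpha_def algebra_simps sum.distrib sum_distrib_left sum_subtractf)

text \<open>\<open>alpha\<close> is linear in its base point, so its exterior derivative does not
  depend on \<open>p\<close>; it is four times the standard symplectic form, the sum of dx_j wedge
  dy_j.\<close>

lemma ext_d1_alpha: "ext_d1 alpha p u v = 2 * alpha u v"
proof -
  have "frechet_derivative (\<lambda>q. alpha q x) (at p) = (\<lambda>q. alpha q x)" for x
    by (intro frechet_derivative_at[symmetric] linear_imp_has_derivative linear_alpha_left)
  then show ?thesis using alpha_antisym[of v u] by (simp add: ext_d1_def)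
qed

lemma mlin_alpha: "mlin 2 (\<lambda>vs. 2 * alpha (vs 0) (vs 1))"
  unfolding mlin_def
proof (intro conjI allI impI)
  fix vs :: "nat \<Rightarrow> complex^'n" and i :: nat assume "i < 2"
  then consider "i = 0" | "i = 1" by linarith
  then show "linear (\<lambda>x. 2 * alpha ((vs(i := x)) 0) ((vs(i := x)) 1))"
    by cases (auto intro!: linear_const_times linear_alpha_left linear_alpha_right)
qed auto

lemma mlin_prod:
  assumes "\<And>i. i < k \<Longrightarrow> linear (\<phi> i)"
  shows "mlin k (\<lambda>vs. \<Prod>i<k. \<phi> i (vs i))"
  using assms
proof (induction k)
  case 0
  show ?case by (simp add: mlin_def)
next
  case (Suc k)
  then show ?case using mlin_mult[OF Suc.IH mlin_covector[of "\<phi> k"]] by simp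
qed

lemma linear_rcoord: "linear (rcoord k)"
  by (cases "even k") (auto intro!: linearI simp: rcoord_def)

lemma alternating_std_det: "alternating (2 * CARD('n)) (std_det :: (nat \<Rightarrow> complex^'n::finite) \<Rightarrow> real)"
  using alternating_antisymmetrize[OF mlin_prod[of "2 * CARD('n)" "rcoord :: nat \<Rightarrow> complex^'n \<Rightarrow> real"]]
  by (simp add: linear_rcoord std_det_def[abs_def] antisymmetrize_def[abs_def])

definition std_frame :: "nat \<Rightarrow> complex^'n::finite" where
  "std_frame k = axis (idx (k div 2)) (if even k then 1 else \<i>)"

lemma rcoord_std_frame:
  assumes "i < 2 * CARD('n)" "j < 2 * CARD('n)"
  shows "rcoord i (std_frame j :: complex^'n::finite) = (if i = j then 1 else 0)"
proof -
  have "i div 2 < CARD('n)" "j div 2 < CARD('n)" using assms by auto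
  then have "(idx (i div 2) :: 'n) = idx (j div 2) \<longleftrightarrow> i div 2 = j div 2" by (rule idx_inj)
  moreover have "i = j \<longleftrightarrow> i div 2 = j div 2 \<and> even i = even j"
    by (metis div_mult_mod_eq even_iff_mod_2_eq_zero odd_iff_mod_2_eq_one)
  ultimately show ?thesis by (auto simp: rcoord_def std_frame_def axis_def)
qed

lemma std_det_std_frame: "std_det (std_frame :: nat \<Rightarrow> complex^'n::finite) = 1"
proof -
  let ?N = "2 * CARD('n)"
  let ?T = "\<lambda>\<sigma>. of_int (sign \<sigma>) * (\<Prod>i<?N. rcoord i (std_frame (\<sigma> i) :: complex^'n))"
  have "(\<Sum>\<sigma>\<in>{\<sigma>. \<sigma> permutes {..<?N}}. ?T \<sigma>) = (\<Sum>\<sigma>\<in>{id}. ?T \<sigma>)"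
  proof (rule sum.mono_neutral_right)
    show "\<forall>\<sigma>\<in>{\<sigma>. \<sigma> permutes {..<?N}} - {id}. ?T \<sigma> = 0"
    proof
      fix \<sigma> assume s: "\<sigma> \<in> {\<sigma>. \<sigma> permutes {..<?N}} - {id}"
      then have p: "\<sigma> permutes {..<?N}" by simp
      obtain i where i: "\<sigma> i \<noteq> i" using s by (auto simp: fun_eq_iff)
      then have "i < ?N" using permutes_not_in[OF p, of i] by auto
      moreover from this have "\<sigma> i < ?N" using permutes_in_image[OF p, of i] by auto
      ultimately have "rcoord i (std_frame (\<sigma> i) :: complex^'n) = 0"
        using i by (simp add: rcoord_std_frame)
      then have "(\<Prod>i<?N. rcoord i (std_frame (\<sigma> i) :: complex^'n)) = 0"
        using \<open>i < ?N\<close> by (intro prod_zero) auto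
      then show "?T \<sigma> = 0" by simp
    qed
  qed (auto simp: finite_permutations permutes_id)
  then show ?thesis by (simp add: std_det_def rcoord_std_frame sign_id)
qed

lemma span_std_frame: "x \<in> span ((std_frame :: nat \<Rightarrow> complex^'n::finite) ` {..<2 * CARD('n)})"
proof -
  let ?S = "span ((std_frame :: nat \<Rightarrow> complex^'n) ` {..<2 * CARD('n)})"
  have "axis j (x $ j) \<in> ?S" for j
  proof -
    obtain i where i: "i < CARD('n)" "j = idx i" by (rule idx_surj)
    have "axis j (x $ j) = Re (x $ j) *\<^sub>R std_frame (2 * i) + Im (x $ j) *\<^sub>R std_frame (2 * i + 1)"
      using i by (auto simp: std_frame_def axis_def vec_eq_iff complex_eq_iff)
    also have "\<dots> \<in> ?S"
      using i by (intro span_add span_scale span_base imageI) auto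
    finally show ?thesis .
  qed
  then have "(\<Sum>j\<in>UNIV. axis j (x $ j)) \<in> ?S" by (intro span_sum) auto
  moreover have "(\<Sum>j\<in>UNIV. axis j (x $ j)) = x"
    by (auto simp: vec_eq_iff axis_def if_distrib cong: if_cong)
  ultimately show ?thesis by simp
qed

lemma alpha_axis: "alpha (axis i x) (axis j y) = (if i = j then 2 * (Re x * Im y - Im x * Re y) else 0)"
proof -
  have "(\<Sum>k\<in>UNIV. Re (axis i x $ k) * Im (axis j y $ k) - Im (axis i x $ k) * Re (axis j y $ k)) =
        (\<Sum>k\<in>{i}. Re (axis i x $ k) * Im (axis j y $ k) - Im (axis i x $ k) * Re (axis j y $ k))"
    by (rule sum.mono_neutral_right) (auto simp: axis_def)
  then show ?thesis by (simp add: alpha_def axis_def)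
qed

lemma symplectic_std_frame:
  "symplectic_frame (\<lambda>u v. 2 * alpha u v) CARD('n) (std_frame :: nat \<Rightarrow> complex^'n::finite)"
proof -
  have "idx (i div 2) \<noteq> (idx (j div 2) :: 'n)"
    if "i < 2 * CARD('n)" "j < 2 * CARD('n)" "i div 2 \<noteq> j div 2" for i j
  proof -
    have "i div 2 < CARD('n)" "j div 2 < CARD('n)" using that by auto
    then show ?thesis using that idx_inj by blast
  qed
  then show ?thesis by (auto simp: symplectic_frame_def std_frame_def alpha_axis)
qed

text \<open>The top power of the symplectic form is proportional to \<open>std_det\<close>, and both
  are positive on \<open>std_frame\<close>. A frame on which that power is positive is therefore
  positively oriented.\<close>

lemma std_det_symplectic_pos:
  assumes e: "symplectic_frame (\<lambda>u v. 2 * alpha u v) CARD('n) (e :: nat \<Rightarrow> complex^'n::finite)"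
  shows "std_det e > 0"
proof -
  let ?W = "wedge_pow2 (\<lambda>vs. 2 * alpha (vs 0) (vs 1)) CARD('n) :: (nat \<Rightarrow> complex^'n) \<Rightarrow> real"
  have anti: "2 * alpha u v = - (2 * alpha v u)" for u v :: "complex^'n" using alpha_antisym[of u v] by simp
  have "alternating (2 * CARD('n)) ?W" by (rule alternating_wedge_pow2[OF mlin_alpha])
  then have "std_det e * ?W std_frame = std_det (std_frame :: nat \<Rightarrow> complex^'n) * ?W e"
    by (intro alternating_proportional[OF alternating_std_det] span_std_frame)
  moreover have "?W std_frame > 0" "?W e > 0"
    using wedge_pow2_pos[of "\<lambda>u v. 2 * alpha u v", OF mlin_alpha anti] symplectic_std_frame e by blast+
  ultimately have "std_det e * ?W std_frame > 0" "?W std_frame > 0" by (auto simp: std_det_std_frame)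
  then show ?thesis by (rule zero_less_mult_pos2)
qed

lemma orthonormal_enumeration:
  fixes a :: "'a::euclidean_space"
  assumes "norm a = 1"
  obtains s where "s 0 = a" "\<And>i j. i < DIM('a) \<Longrightarrow> j < DIM('a) \<Longrightarrow> s i \<bullet> s j = (if i = j then 1 else 0)"
    "span (s ` {..<DIM('a)}) = UNIV"
proof -
  obtain S where S: "a \<in> S" "pairwise orthogonal S" "\<forall>x\<in>S. norm x = 1"
    "independent S" "card S = DIM('a)" "span S = UNIV"
    by (rule vector_in_orthonormal_basis[OF assms]) blast
  have fin: "finite S" using S(4) finiteI_independent by blast
  obtain h where h: "bij_betw h {0..<DIM('a)} S" using ex_bij_betw_nat_finite[OF fin] S(5) by auto
  then obtain k where k: "k < DIM('a)" "h k = a" using S(1) by (auto simp: bij_betw_def)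
  let ?t = "Transposition.transpose 0 k"
  have tp: "?t permutes {..<DIM('a)}" using k by (intro permutes_swap_id) auto
  define s where "s = h \<circ> ?t"
  have b: "bij_betw s {..<DIM('a)} S"
    unfolding s_def using h permutes_imp_bij[OF tp] by (auto intro: bij_betw_trans simp: atLeast0LessThan)
  show thesis
  proof
    show "s 0 = a" using k by (simp add: s_def)
    show "span (s ` {..<DIM('a)}) = UNIV" using b S(6) by (simp add: bij_betw_def)
    fix i j assume ij: "i < DIM('a)" "j < DIM('a)"
    then have in': "s i \<in> S" "s j \<in> S" using b by (auto simp: bij_betw_def)
    show "s i \<bullet> s j = (if i = j then 1 else 0)"
    proof (cases "i = j")
      case True
      then show ?thesis using S(3) in'(1) by (simp add: norm_eq_1)
    next
      case False
      then have "s i \<noteq> s j" using b ij by (auto simp: bij_betw_def inj_on_def)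
      then show ?thesis using S(2) in' False by (auto simp: pairwise_def orthogonal_def)
    qed
  qed
qed

lemma alpha_eq_Im: "alpha p u = 2 * (\<Sum>j\<in>UNIV. Im (cnj (p $ j) * u $ j))"
  by (simp add: alpha_def)

lemma inner_eq_Re: "p \<bullet> u = (\<Sum>j\<in>UNIV. Re (cnj (p $ j) * u $ j))" for p u :: "complex^'n::finite"
  by (simp add: inner_vec_def inner_complex_def)

text \<open>The differential at \<open>w\<close> of \<open>f \<circ> \<phi>\<^sub>a\<^sub>,\<^sub>b\<close>, in polar form: \<open>\<epsilon> j\<close> is the phase of \<open>w $ j\<close> and
  \<open>q j * cmod (w $ j)\<close> is \<open>z\<^sub>j \<partial>f/\<partial>z\<^sub>j\<close> at \<open>z = \<phi>\<^sub>a\<^sub>,\<^sub>b w\<close>.\<close>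
locale polar_differential =
  fixes w :: "complex^'n::finite" and L :: "complex^'n \<Rightarrow> complex" and q \<epsilon> :: "'n \<Rightarrow> complex"
    and a b :: real
  assumes card2: "CARD('n) \<ge> 2" and unit: "\<And>j. cmod (\<epsilon> j) = 1"
    and polar: "\<And>j. w $ j = \<epsilon> j * of_real (cmod (w $ j))"
    and L: "\<And>u. L u = (\<Sum>j\<in>UNIV. q j * (of_real a * cnj (\<epsilon> j) * u $ j + of_real b * \<epsilon> j * cnj (u $ j)))"
    and apos: "a > 0" and bpos: "b > 0" and ab: "a \<noteq> b" and w0: "w \<noteq> 0"
    and not_prop: "\<not> (\<exists>l. \<forall>j. q j = l * of_real (cmod (w $ j)))"
begin

definition rot :: "('n \<Rightarrow> complex) \<Rightarrow> complex^'n" where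
  "rot x = (\<chi> j. \<epsilon> j * x j)"

lemma unit_cnj: "cnj (\<epsilon> j) * \<epsilon> j = 1"
  unfolding mult.commute[of "cnj (\<epsilon> j)"] complex_norm_square[symmetric] unit by simp

lemma rot_prod: "cnj (rot x $ j) * rot y $ j = cnj (x j) * y j"
proof -
  have "cnj (rot x $ j) * rot y $ j = (cnj (\<epsilon> j) * \<epsilon> j) * (cnj (x j) * y j)"
    by (simp add: rot_def algebra_simps)
  then show ?thesis by (simp add: unit_cnj)
qed

lemma alpha_rot: "alpha (rot x) (rot y) = 2 * (\<Sum>j\<in>UNIV. Im (cnj (x j) * y j))"
  by (simp only: alpha_eq_Im rot_prod)

lemma inner_rot: "rot x \<bullet> rot y = (\<Sum>j\<in>UNIV. Re (cnj (x j) * y j))"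
  by (simp only: inner_eq_Re rot_prod)

lemma w_rot: "w = rot (\<lambda>j. of_real (cmod (w $ j)))"
  unfolding rot_def vec_eq_iff vec_lambda_beta by (intro allI polar)

lemma L_rot_real: "L (rot (\<lambda>j. of_real (x j))) = of_real (a + b) * (\<Sum>j\<in>UNIV. q j * of_real (x j))"
proof -
  have "q j * (of_real a * cnj (\<epsilon> j) * (\<epsilon> j * of_real (x j)) + of_real b * \<epsilon> j * cnj (\<epsilon> j * of_real (x j)))
    = of_real (a + b) * (q j * of_real (x j)) * (cnj (\<epsilon> j) * \<epsilon> j)" for j
    by (simp add: algebra_simps)
  then show ?thesis unfolding L rot_def vec_lambda_beta sum_distrib_left by (simp only: unit_cnj mult_1_right)
qed

lemma L_rot_imag: "L (rot (\<lambda>j. \<i> * of_real (x j))) = of_real (a - b) * (\<i> * (\<Sum>j\<in>UNIV. q j * of_real (x j)))"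
proof -
  have "q j * (of_real a * cnj (\<epsilon> j) * (\<epsilon> j * (\<i> * of_real (x j))) + of_real b * \<epsilon> j * cnj (\<epsilon> j * (\<i> * of_real (x j))))
    = of_real (a - b) * (\<i> * (q j * of_real (x j))) * (cnj (\<epsilon> j) * \<epsilon> j)" for j
    by (simp add: algebra_simps)
  then show ?thesis unfolding L rot_def vec_lambda_beta sum_distrib_left by (simp only: unit_cnj mult_1_right)
qed

lemma linear_L: "linear L"
proof (rule linearI)
  show "L (x + y) = L x + L y" for x y by (simp add: L algebra_simps sum.distrib)
  show "L (r *\<^sub>R x) = r *\<^sub>R L x" for r x
    unfolding L scaleR_sum_right by (rule sum.cong) (simp_all add: scaleR_conv_of_real[where 'a=complex] algebra_simps)
qed

text \<open>Choose a real orthonormal basis \<open>s\<close> with \<open>s 0\<close> along the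
  vector of moduli of \<open>w\<close>; rotate it by the phases to get the even vectors, and
  multiply by the imaginary unit for the odd ones. Then \<open>w\<close> is a positive multiple of
  \<open>e 0\<close>, hence orthogonal to the other vectors, and \<open>alpha w\<close> sees only
  \<open>e 1\<close>. \<open>H k\<close> is the component of \<open>q\<close> along
  \<open>s k\<close>; if it vanished for all \<open>k > 0\<close>, then \<open>q\<close> would be a
  complex multiple of the moduli.\<close>

lemma adapted_frame:
  obtains e H k where "symplectic_frame (\<lambda>u v. 2 * alpha u v) CARD('n) e"
    "w \<bullet> e 0 > 0" "\<forall>i. 0 < i \<longrightarrow> i < 2 * CARD('n) \<longrightarrow> w \<bullet> e i = 0"
    "alpha w (e 1) > 0" "\<forall>i. i < 2 * CARD('n) \<longrightarrow> i \<noteq> 1 \<longrightarrow> alpha w (e i) = 0"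
    "\<forall>k. L (e (2*k)) = of_real (a + b) * H k" "\<forall>k. L (e (2*k+1)) = of_real (a - b) * (\<i> * H k)"
    "0 < k" "k < CARD('n)" "H k \<noteq> 0"
proof -
  define m :: "real^'n" where "m = (\<chi> j. cmod (w $ j))"
  have "m \<noteq> 0" using w0 by (auto simp: m_def vec_eq_iff)
  then have nm: "norm m > 0" by simp
  have "norm ((1 / norm m) *\<^sub>R m) = 1" using nm by simp
  then obtain s :: "nat \<Rightarrow> real^'n" where s0: "s 0 = (1 / norm m) *\<^sub>R m"
    and ons: "\<And>i j. i < DIM(real^'n) \<Longrightarrow> j < DIM(real^'n) \<Longrightarrow> s i \<bullet> s j = (if i = j then 1 else 0)"
    and span: "span (s ` {..<DIM(real^'n)}) = UNIV"
    using orthonormal_enumeration by (metis (no_types, lifting))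
  have ons: "s i \<bullet> s j = (if i = j then 1 else 0)" if "i < CARD('n)" "j < CARD('n)" for i j
    using ons[of i j] that by simp
  have m_s: "m = norm m *\<^sub>R s 0" using nm by (simp add: s0)
  have ms: "m \<bullet> s i = (if i = 0 then norm m else 0)" if "i < CARD('n)" for i
    using ons[of 0 i] that card2 by (subst m_s) auto
  define e where "e i = (if even i then rot (\<lambda>j. of_real (s (i div 2) $ j))
    else rot (\<lambda>j. \<i> * of_real (s (i div 2) $ j)))" for i
  define H where "H k = (\<Sum>j\<in>UNIV. q j * of_real (s k $ j))" for k
  have inner_sum: "(\<Sum>j\<in>UNIV. x $ j * y $ j) = x \<bullet> y" for x y :: "real^'n"
    by (simp add: inner_vec_def)
  have e_even: "e (2*k) = rot (\<lambda>j. of_real (s k $ j))" and e_odd: "e (2*k+1) = rot (\<lambda>j. \<i> * of_real (s k $ j))" for k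
    by (auto simp: e_def)
  have al: "alpha (e i) (e j) = (if even i \<and> odd j then 2 * (s (i div 2) \<bullet> s (j div 2)) else
      if odd i \<and> even j then - 2 * (s (i div 2) \<bullet> s (j div 2)) else 0)" for i j
    by (simp add: e_def alpha_rot inner_sum sum_negf)
  have alw: "alpha w (e i) = (if odd i then 2 * (m \<bullet> s (i div 2)) else 0)" for i
    by (subst w_rot) (simp add: e_def alpha_rot m_def flip: inner_sum)
  have inw: "w \<bullet> e i = (if even i then m \<bullet> s (i div 2) else 0)" for i
    by (subst w_rot) (simp add: e_def inner_rot m_def flip: inner_sum)
  have half: "i div 2 < CARD('n)" if "i < 2 * CARD('n)" for i using that by auto
  have "\<exists>k. 0 < k \<and> k < CARD('n) \<and> H k \<noteq> 0"
  proof (rule ccontr)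
    assume "\<not> ?thesis"
    then have H0: "H k = 0" if "0 < k" "k < CARD('n)" for k using that by blast
    have proj: "x = (x \<bullet> s 0) *\<^sub>R s 0" if x: "\<And>k. 0 < k \<Longrightarrow> k < CARD('n) \<Longrightarrow> x \<bullet> s k = 0" for x
    proof -
      let ?y = "x - (x \<bullet> s 0) *\<^sub>R s 0"
      have "?y \<bullet> v = 0" if "v \<in> s ` {..<DIM(real^'n)}" for v
      proof -
        from that obtain i where i: "i < CARD('n)" "v = s i" by auto
        have o: "s 0 \<bullet> s i = (if i = 0 then 1 else 0)" using ons[of 0 i] i card2 by simp
        show ?thesis
        proof (cases "i = 0")
          case True
          then show ?thesis using o i by (simp add: inner_diff_left)
        next
          case False
          then show ?thesis using o i x[of i] by (simp add: inner_diff_left)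
        qed
      qed
      then have o: "orthogonal ?y v" if "v \<in> s ` {..<DIM(real^'n)}" for v
        using that unfolding orthogonal_def by blast
      have "?y \<in> span (s ` {..<DIM(real^'n)})" unfolding span by simp
      then have "orthogonal ?y ?y" by (rule orthogonal_to_span) (rule o)
      then have "?y = 0" by (simp add: orthogonal_self)
      then show ?thesis by simp
    qed
    \<comment> \<open>The basis \<open>s\<close> is real, so the argument is applied to the real and
      imaginary parts of \<open>q\<close> separately.\<close>
    define x y :: "real^'n" where "x = (\<chi> j. Re (q j))" and "y = (\<chi> j. Im (q j))"
    have RH: "x \<bullet> s k = Re (H k)" "y \<bullet> s k = Im (H k)" for k
      by (simp_all add: H_def x_def y_def flip: inner_sum)
    have xp: "x = (x \<bullet> s 0) *\<^sub>R s 0" by (rule proj) (simp add: RH H0)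
    have yp: "y = (y \<bullet> s 0) *\<^sub>R s 0" by (rule proj) (simp add: RH H0)
    have "q j = Complex ((x \<bullet> s 0) / norm m) ((y \<bullet> s 0) / norm m) * of_real (cmod (w $ j))" for j
    proof -
      have "Re (q j) = x $ j" "Im (q j) = y $ j" by (simp_all add: x_def y_def)
      moreover have "x $ j = (x \<bullet> s 0) * (cmod (w $ j) / norm m)"
        by (subst xp) (simp add: s0 m_def)
      moreover have "y $ j = (y \<bullet> s 0) * (cmod (w $ j) / norm m)"
        by (subst yp) (simp add: s0 m_def)
      ultimately show ?thesis by (simp add: complex_eq_iff)
    qed
    with not_prop show False by blast
  qed
  then obtain k where k: "0 < k" "k < CARD('n)" "H k \<noteq> 0" by blast
  show thesis
  proof (rule that[of e H k])
    show "0 < k" "k < CARD('n)" "H k \<noteq> 0" by (rule k)+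
    show "symplectic_frame (\<lambda>u v. 2 * alpha u v) CARD('n) e"
      unfolding symplectic_frame_def al using ons half by auto
    show "w \<bullet> e 0 > 0" using ms[of 0] nm card2 by (simp add: inw)
    show "alpha w (e 1) > 0" using ms[of 0] nm card2 by (simp add: alw)
    show "\<forall>i. 0 < i \<longrightarrow> i < 2 * CARD('n) \<longrightarrow> w \<bullet> e i = 0"
      using ms half by (auto simp: inw elim!: evenE)
    show "\<forall>i. i < 2 * CARD('n) \<longrightarrow> i \<noteq> 1 \<longrightarrow> alpha w (e i) = 0"
      using ms half by (auto simp: alw elim!: oddE)
    show "\<forall>k. L (e (2*k)) = of_real (a + b) * H k" by (simp only: e_even L_rot_real H_def) simp
    show "\<forall>k. L (e (2*k+1)) = of_real (a - b) * (\<i> * H k)" by (simp only: e_odd L_rot_imag H_def) simp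
  qed
qed

text \<open>\<open>e 0\<close> adjusts the radial component. The pair \<open>e (2*k)\<close>,
  \<open>e (2*k+1)\<close> is orthogonal to \<open>w\<close>, and its images under \<open>L\<close>
  are real multiples of \<open>H k\<close> and \<open>\<i> * H k\<close> with nonzero factors, so
  they span the complex plane over the reals.\<close>

lemma surj_rho_L: "surj (\<lambda>u. (2 * (w \<bullet> u), L u))"
proof -
  obtain e H k where w_e0: "w \<bullet> e 0 > 0" and w_e: "\<forall>i. 0 < i \<longrightarrow> i < 2 * CARD('n) \<longrightarrow> w \<bullet> e i = 0"
    and L1: "\<forall>k. L (e (2*k)) = of_real (a + b) * H k" and L2: "\<forall>k. L (e (2*k+1)) = of_real (a - b) * (\<i> * H k)"
    and k: "0 < k" "k < CARD('n)" "H k \<noteq> 0"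
    by (rule adapted_frame)
  show ?thesis
  proof (rule surjI[where f="\<lambda>(r, z). let c = r / (2 * (w \<bullet> e 0)); z' = (z - of_real c * L (e 0)) / H k in
      c *\<^sub>R e 0 + (Re z' / (a + b)) *\<^sub>R e (2*k) + (Im z' / (a - b)) *\<^sub>R e (2*k+1)"])
    fix p :: "real \<times> complex"
    obtain r z where p: "p = (r, z)" by force
    define c where "c = r / (2 * (w \<bullet> e 0))"
    define z' where "z' = (z - of_real c * L (e 0)) / H k"
    define u where "u = c *\<^sub>R e 0 + (Re z' / (a + b)) *\<^sub>R e (2*k) + (Im z' / (a - b)) *\<^sub>R e (2*k+1)"
    have "w \<bullet> e (2*k) = 0" "w \<bullet> e (2*k+1) = 0" using w_e k by auto
    then have "2 * (w \<bullet> u) = r" using w_e0 by (simp add: u_def c_def inner_add_right)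
    moreover have "L u = z"
    proof -
      have "L u = c *\<^sub>R L (e 0) + (Re z' / (a + b)) *\<^sub>R L (e (2*k)) + (Im z' / (a - b)) *\<^sub>R L (e (2*k+1))"
        unfolding u_def by (simp only: linear_add[OF linear_L] linear_scale[OF linear_L])
      also have "\<dots> = of_real c * L (e 0) + (of_real (Re z') + \<i> * of_real (Im z')) * H k"
        unfolding L1[rule_format] L2[rule_format] using apos bpos ab
        by (simp add: scaleR_conv_of_real field_simps flip: of_real_add of_real_diff)
      also have "of_real (Re z') + \<i> * of_real (Im z') = z'" by (simp add: complex_eq_iff)
      also have "of_real c * L (e 0) + z' * H k = z" using k by (simp add: z'_def)
      finally show ?thesis .
    qed
    ultimately show "(\<lambda>u. (2 * (w \<bullet> u), L u)) (case p of (r, z) \<Rightarrow>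
        let c = r / (2 * (w \<bullet> e 0)); z' = (z - of_real c * L (e 0)) / H k in
        c *\<^sub>R e 0 + (Re z' / (a + b)) *\<^sub>R e (2*k) + (Im z' / (a - b)) *\<^sub>R e (2*k+1)) = p"
      by (simp add: p Let_def c_def z'_def u_def)
  qed
qed

lemma link_smooth:
  assumes "(g has_derivative L) (at w)"
  shows "link_smooth_at g w" "mixed_regular g w"
proof -
  have D: "frechet_derivative g (at w) = L" using assms by (simp add: frechet_derivative_at[symmetric])
  have d: "g differentiable (at w)" using assms by (auto simp: differentiable_def)
  show "link_smooth_at g w"
    using surj_rho_L by (simp add: link_smooth_at_def d D frechet_derivative_rho)
  have "\<exists>u. z = L u" for z using surjD[OF surj_rho_L, of "(0, z)"] by auto
  then have "surj L" unfolding surj_def by blast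
  then show "mixed_regular g w" by (simp add: mixed_regular_def d D)
qed

text \<open>The Wirtinger derivatives are \<open>a\<close> and \<open>b\<close> times
  \<open>q j\<close> up to phase. In each bracket of \<open>C_g\<close> the phases factor out as the
  unimodular \<open>\<epsilon> j * \<epsilon> k\<close>, leaving the same minor twice.\<close>

lemma C_g_eq:
  assumes "(g has_derivative L) (at w)"
  shows "C_g g w = (a\<^sup>2 - b\<^sup>2) * (\<Sum>(j,k)\<in>{(j,k). j < k \<and> k < CARD('n)}.
     (cmod (of_real (cmod (w $ idx j)) * q (idx k) - of_real (cmod (w $ idx k)) * q (idx j)))\<^sup>2)"
proof -
  have D: "frechet_derivative g (at w) = L" using assms by (simp add: frechet_derivative_at[symmetric])
  have ax: "L (axis j x) = q j * (of_real a * cnj (\<epsilon> j) * x + of_real b * \<epsilon> j * cnj x)" for j x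
  proof -
    have "L (axis j x) = (\<Sum>i\<in>{j}. q i * (of_real a * cnj (\<epsilon> i) * axis j x $ i + of_real b * \<epsilon> i * cnj (axis j x $ i)))"
      unfolding L by (rule sum.mono_neutral_right) (auto simp: axis_def)
    then show ?thesis by simp
  qed
  have W: "wirt g j w = of_real a * q j * cnj (\<epsilon> j)" "wirt_bar g j w = of_real b * q j * \<epsilon> j" for j
    by (simp_all add: wirt_def wirt_bar_def dxj_def dyj_def D ax algebra_simps)
  have T1: "cmod (w $ j * cnj (wirt g k w) - w $ k * cnj (wirt g j w)) =
      a * cmod (of_real (cmod (w $ j)) * q k - of_real (cmod (w $ k)) * q j)" for j k
  proof -
    have "w $ j * cnj (wirt g k w) - w $ k * cnj (wirt g j w) =
        of_real a * (\<epsilon> j * \<epsilon> k) * cnj (of_real (cmod (w $ j)) * q k - of_real (cmod (w $ k)) * q j)"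
      unfolding W by (subst polar[of j], subst polar[of k]) (simp add: algebra_simps)
    then show ?thesis using unit apos by (simp only: norm_mult complex_mod_cnj) simp
  qed
  have T2: "cmod (w $ j * wirt_bar g k w - w $ k * wirt_bar g j w) =
      b * cmod (of_real (cmod (w $ j)) * q k - of_real (cmod (w $ k)) * q j)" for j k
  proof -
    have "w $ j * wirt_bar g k w - w $ k * wirt_bar g j w =
        of_real b * (\<epsilon> j * \<epsilon> k) * (of_real (cmod (w $ j)) * q k - of_real (cmod (w $ k)) * q j)"
      unfolding W by (subst polar[of j], subst polar[of k]) (simp add: algebra_simps)
    then show ?thesis using unit bpos by (simp only: norm_mult) simp
  qed
  show ?thesis
    unfolding C_g_def T1 T2 sum_distrib_left
    by (rule sum.cong[OF refl]) (auto simp: power_mult_distrib left_diff_distrib)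
qed

text \<open>The factor \<open>a - b\<close> treats both signs at once, because
  \<open>(a - b) * (a\<^sup>2 - b\<^sup>2)\<close> is \<open>(a - b)\<^sup>2 * (a + b)\<close>.
  Non-proportionality yields a nonzero minor once an index with \<open>w $ i \<noteq> 0\<close> is
  fixed.\<close>

lemma C_g_sign:
  assumes "(g has_derivative L) (at w)"
  shows "(a - b) * C_g g w > 0"
proof -
  obtain i where i: "w $ i \<noteq> 0" using w0 by (auto simp: vec_eq_iff)
  have "\<not> (\<forall>j. q j = q i / of_real (cmod (w $ i)) * of_real (cmod (w $ j)))" using not_prop by blast
  then obtain j where "q j \<noteq> q i / of_real (cmod (w $ i)) * of_real (cmod (w $ j))" by blast
  then have ij: "of_real (cmod (w $ i)) * q j - of_real (cmod (w $ j)) * q i \<noteq> 0"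
    using i by (simp add: field_simps)
  obtain i' j' where ij': "i' < CARD('n)" "i = idx i'" "j' < CARD('n)" "j = idx j'"
    by (metis idx_surj)
  have "i' \<noteq> j'" using ij ij' by auto
  define A where "A = {(j,k). j < k \<and> k < CARD('n)}"
  have fA: "finite A" by (rule finite_subset[of _ "{..<CARD('n)} \<times> {..<CARD('n)}"]) (auto simp: A_def)
  let ?t = "\<lambda>(j,k). (cmod (of_real (cmod (w $ idx j)) * q (idx k) - of_real (cmod (w $ idx k)) * q (idx j)))\<^sup>2"
  have "\<exists>p\<in>A. ?t p > 0"
  proof (cases "i' < j'")
    case True
    then show ?thesis using ij ij' by (intro bexI[of _ "(i',j')"]) (auto simp: A_def)
  next
    case False
    then show ?thesis using ij ij' \<open>i' \<noteq> j'\<close>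
      by (intro bexI[of _ "(j',i')"]) (auto simp: A_def algebra_simps)
  qed
  then obtain p where p: "p \<in> A" "?t p > 0" by blast
  have S: "sum ?t A > 0" using p by (intro sum_pos2[of A p ?t] fA) (auto split: prod.splits)
  have "(a - b) * C_g g w = ((a - b)\<^sup>2 * (a + b)) * sum ?t A"
    unfolding C_g_eq[OF assms] A_def by (simp add: power2_eq_square algebra_simps)
  moreover have "(a - b)\<^sup>2 * (a + b) > 0" using apos bpos ab by simp
  ultimately show ?thesis using S by simp
qed

text \<open>The link form is a constant multiple of \<open>std_det\<close>. Its sign on the adapted
  frame, which is positively oriented, determines that constant. On the tangent frame completed by
  dual vectors it equals a positive factor times the contact form, and that completion is positively
  oriented by assumption.\<close>

lemma contact_sign:
  assumes d: "(g has_derivative L) (at w)" and v: "pos_tangent_frame g w v"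
  shows "(a - b) * contact_vol w v > 0"
proof -
  define m where "m = CARD('n) - 2"
  have n: "CARD('n) = m + 2" using card2 by (simp add: m_def)
  have D: "frechet_derivative g (at w) = L" using d by (simp add: frechet_derivative_at[symmetric])
  obtain e H k where e: "symplectic_frame (\<lambda>u v. 2 * alpha u v) CARD('n) e"
    and w_e: "w \<bullet> e 0 > 0" "\<forall>i. 0 < i \<longrightarrow> i < 2 * CARD('n) \<longrightarrow> w \<bullet> e i = 0"
    and al: "alpha w (e 1) > 0" "\<forall>i. i < 2 * CARD('n) \<longrightarrow> i \<noteq> 1 \<longrightarrow> alpha w (e i) = 0"
    and L1: "\<forall>k. L (e (2*k)) = of_real (a + b) * H k" and L2: "\<forall>k. L (e (2*k+1)) = of_real (a - b) * (\<i> * H k)"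
    and k: "0 < k" "k < CARD('n)" "H k \<noteq> 0"
    by (rule adapted_frame)
  define \<rho> where "\<rho> u = 2 * (w \<bullet> u)" for u
  define \<gamma>1 \<gamma>2 where "\<gamma>1 u = Re (L u)" and "\<gamma>2 u = Im (L u)" for u
  have lin: "linear \<rho>" "linear \<gamma>1" "linear \<gamma>2"
    unfolding \<rho>_def \<gamma>1_def \<gamma>2_def
    by (auto intro!: linearI simp: inner_add_right algebra_simps linear_add[OF linear_L] linear_scale[OF linear_L])
  have anti: "2 * alpha u v = - (2 * alpha v u)" for u v :: "complex^'n" using alpha_antisym[of u v] by simp
  define \<eta> :: "(nat \<Rightarrow> complex^'n) \<Rightarrow> real" where "\<eta> = wedge_pow2 (\<lambda>vs. 2 * alpha (vs 0) (vs 1)) m"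
  define C where "C = wedge 1 (2*m) (\<lambda>vs. alpha w (vs 0)) \<eta>"
  have CV: "contact_vol w = C"
    unfolding contact_vol_def C_def \<eta>_def m_def by (simp add: ext_d1_alpha)
  have altC: "alternating (2*m+1) C"
    unfolding C_def \<eta>_def using alternating_wedge[OF mlin_covector[OF linear_alpha_right]
        alternating_mlin[OF alternating_wedge_pow2[OF mlin_alpha]]] by simp
  let ?\<Psi> = "link_form m \<rho> C \<gamma>1 \<gamma>2"
  have alt\<Psi>: "alternating (2*m+4) ?\<Psi>"
    by (rule alternating_link_form[OF lin(1) alternating_mlin[OF altC] lin(2,3)])
  have N: "2 * CARD('n) = 2*m+4" by (simp add: n)
  have g1: "(a - b) * (\<gamma>1 (e (2*i)) * \<gamma>2 (e (2*i+1))) = ((a - b)\<^sup>2 * (a + b)) * (Re (H i))\<^sup>2" for i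
    by (simp only: \<gamma>1_def \<gamma>2_def L1[rule_format] L2[rule_format]) (simp add: power2_eq_square algebra_simps)
  have g2: "(a - b) * (\<gamma>1 (e (2*i+1)) * \<gamma>2 (e (2*i))) = - ((a - b)\<^sup>2 * (a + b)) * (Im (H i))\<^sup>2" for i
    by (simp only: \<gamma>1_def \<gamma>2_def L1[rule_format] L2[rule_format]) (simp add: power2_eq_square algebra_simps)
  have pos: "(a - b)\<^sup>2 * (a + b) > 0" using apos bpos ab by simp
  have "(a - b) * ?\<Psi> e > 0"
    unfolding C_def \<eta>_def
  proof (rule link_form_symplectic_frame[where \<omega>="\<lambda>u v. 2 * alpha u v" and ?k0.0=k, OF mlin_alpha anti linear_alpha_right])
    show "symplectic_frame (\<lambda>u v. 2 * alpha u v) (m+2) e" using e n by simp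
    show "\<rho> (e 0) > 0" using w_e by (simp add: \<rho>_def)
    show "\<And>i. 0 < i \<Longrightarrow> i < 2*m+4 \<Longrightarrow> \<rho> (e i) = 0" using w_e(2) N by (simp add: \<rho>_def)
    show "alpha w (e 1) > 0" by (rule al)
    show "\<And>i. i < 2*m+4 \<Longrightarrow> i \<noteq> 1 \<Longrightarrow> alpha w (e i) = 0" using al(2) N by simp
    show "(a - b) * (\<gamma>1 (e (2*i)) * \<gamma>2 (e (2*i+1))) \<ge> 0" for i unfolding g1 using pos by simp
    show "(a - b) * (\<gamma>1 (e (2*i+1)) * \<gamma>2 (e (2*i))) \<le> 0" for i unfolding g2 using pos by simp
    show "0 < k" "k < m+2" using k n by auto
    have "Re (H k) \<noteq> 0 \<or> Im (H k) \<noteq> 0" using k(3) by (simp add: complex_eq_iff)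
    then show "(a - b) * (\<gamma>1 (e (2*k)) * \<gamma>2 (e (2*k+1))) > 0 \<or> (a - b) * (\<gamma>1 (e (2*k+1)) * \<gamma>2 (e (2*k))) < 0"
      unfolding g1 g2 using pos by auto
  qed
  \<comment> \<open>Dual vectors exist, so the quantified clause of \<open>pos_tangent_frame\<close>
    really yields a positive determinant; \<open>W\<close> below repeats the arrangement used
    there.\<close>
  obtain u0 where u0: "2 * (w \<bullet> u0) = 1" "L u0 = 0" using surjD[OF surj_rho_L, of "(1, 0)"] by auto
  obtain u1 where u1: "2 * (w \<bullet> u1) = 0" "L u1 = 1" using surjD[OF surj_rho_L, of "(0, 1)"] by auto
  obtain u2 where u2: "2 * (w \<bullet> u2) = 0" "L u2 = \<i>" using surjD[OF surj_rho_L, of "(0, \<i>)"] by auto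
  define W where "W k = (if k = 0 then u0 else if k \<le> 2 * CARD('n) - 3 then v (k - 1)
                      else if k = 2 * CARD('n) - 2 then u1 else u2)" for k
  have vt: "2 * (w \<bullet> v i) = 0" "L (v i) = 0" if "i < 2*m+1" for i
    using v that unfolding pos_tangent_frame_def D frechet_derivative_rho(2) n by auto
  have det: "std_det W > 0"
    using v u0 u1 u2 unfolding pos_tangent_frame_def D frechet_derivative_rho(2) W_def[abs_def] by auto
  have W: "W 0 = u0" "W (2*m+2) = u1" "W (2*m+3) = u2" by (auto simp: W_def n)
  have Wv: "W (1 + i) = v i" if "i < 2*m+1" for i using that by (auto simp: W_def n)
  have W_cases: "i = 0 \<and> W i = u0 \<or> (\<exists>i'<2*m+1. i = 1 + i' \<and> W i = v i') \<or>
      i = 2*m+2 \<and> W i = u1 \<or> i = 2*m+3 \<and> W i = u2" if "i < 2*m+4" for i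
  proof -
    have "i = 0 \<or> i - 1 < 2*m+1 \<and> i = 1 + (i - 1) \<or> i = 2*m+2 \<or> i = 2*m+3" using that by linarith
    then show ?thesis using W Wv by metis
  qed
  have "?\<Psi> W = fact (2*m+1) * C (\<lambda>i. W (1 + i))"
  proof (rule link_form_dual_frame[OF altC])
    show "\<rho> (W 0) = 1" "\<gamma>1 (W (2*m+2)) = 1" "\<gamma>2 (W (2*m+3)) = 1"
      unfolding W \<rho>_def \<gamma>1_def \<gamma>2_def using u0 u1 u2 by auto
    show "\<rho> (W i) = 0" if "0 < i" "i < 2*m+4" for i
      using W_cases[OF that(2)] that(1) vt u1 u2 unfolding \<rho>_def by auto
    show "\<gamma>1 (W i) = 0" if "i < 2*m+4" "i \<noteq> 2*m+2" for i
      using W_cases[OF that(1)] that(2) vt u0 u2 unfolding \<gamma>1_def by auto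
    show "\<gamma>2 (W i) = 0" if "i < 2*m+4" "i \<noteq> 2*m+3" for i
      using W_cases[OF that(1)] that(2) vt u0 u1 unfolding \<gamma>2_def by auto
  qed
  also have "C (\<lambda>i. W (1 + i)) = C v"
    by (rule mlin_cong[OF alternating_mlin[OF altC]]) (rule Wv)
  finally have \<Psi>W: "?\<Psi> W = fact (2*m+1) * C v" .
  have scal: "?\<Psi> x = ?\<Psi> std_frame * std_det x" for x
    using alternating_proportional[OF alt\<Psi>[folded N] alternating_std_det span_std_frame, of x]
    by (simp add: std_det_std_frame)
  have "(a - b) * ?\<Psi> std_frame > 0"
    using \<open>(a - b) * ?\<Psi> e > 0\<close> std_det_symplectic_pos[OF e] unfolding scal[of e]
    by (metis mult.assoc zero_less_mult_pos2)
  then have "(a - b) * ?\<Psi> W > 0" using det unfolding scal[of W] by (metis mult.assoc mult_pos_pos)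
  then have "fact (2*m+1) * ((a - b) * C v) > 0" unfolding \<Psi>W by (simp only: mult.left_commute)
  then have "(a - b) * C v > 0" by (rule zero_less_mult_pos) simp
  then show ?thesis by (simp add: CV)
qed

end

section \<open>Power series of a holomorphic germ\<close>

definition mdeg :: "('n::finite \<Rightarrow> nat) \<Rightarrow> nat" where
  "mdeg \<nu> = (\<Sum>j\<in>UNIV. \<nu> j)"

text \<open>Written without division by \<open>z $ j\<close>, so that it is correct on the
  coordinate hyperplanes too. For \<open>\<nu> j = 0\<close> the leading factor makes the truncated
  exponent harmless.\<close>

definition monom_deriv :: "complex^'n::finite \<Rightarrow> ('n \<Rightarrow> nat) \<Rightarrow> 'n \<Rightarrow> complex" where
  "monom_deriv z \<nu> j = of_nat (\<nu> j) * (z $ j) ^ (\<nu> j - 1) * (\<Prod>i\<in>UNIV - {j}. (z $ i) ^ \<nu> i)"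

lemma has_derivative_monom:
  "((\<lambda>z. monom z \<nu>) has_derivative (\<lambda>h. \<Sum>j\<in>UNIV. monom_deriv z \<nu> j * h $ j)) (at z within S)"
proof -
  have "((\<lambda>z. \<Prod>j\<in>UNIV. (z $ j) ^ \<nu> j) has_derivative
      (\<lambda>h. \<Sum>j\<in>UNIV. (of_nat (\<nu> j) * h $ j * (z $ j) ^ (\<nu> j - 1)) * (\<Prod>i\<in>UNIV - {j}. (z $ i) ^ \<nu> i))) (at z within S)"
    by (intro has_derivative_prod has_derivative_power bounded_linear_imp_has_derivative bounded_linear_vec_nth)
  then show ?thesis by (simp add: monom_def monom_deriv_def mult_ac)
qed

lemma monom_split: "monom z \<nu> = (z $ j) ^ \<nu> j * (\<Prod>i\<in>UNIV - {j}. (z $ i) ^ \<nu> i)"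
  unfolding monom_def by (rule prod.remove) auto

lemma mdeg_split: "mdeg \<nu> = \<nu> j + (\<Sum>i\<in>UNIV - {j}. \<nu> i)"
  unfolding mdeg_def by (rule sum.remove) auto

lemma mult_monom_deriv: "z $ j * monom_deriv z \<nu> j = of_nat (\<nu> j) * monom z \<nu>"
  by (cases "\<nu> j") (auto simp: monom_deriv_def monom_split[of z \<nu> j])

lemma cmod_monom: "cmod (monom z \<nu>) = (\<Prod>j\<in>UNIV. cmod (z $ j) ^ \<nu> j)"
  by (simp add: monom_def norm_power flip: prod_norm)

lemma norm_prod_power_le:
  assumes "\<And>i. i \<in> I \<Longrightarrow> cmod (z $ i) \<le> r"
  shows "cmod (\<Prod>i\<in>I. (z $ i) ^ \<nu> i) \<le> r ^ (\<Sum>i\<in>I. \<nu> i)"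
proof -
  have "cmod (\<Prod>i\<in>I. (z $ i) ^ \<nu> i) \<le> (\<Prod>i\<in>I. r ^ \<nu> i)"
    unfolding prod_norm[symmetric] norm_power by (intro prod_mono) (auto intro: power_mono assms)
  then show ?thesis by (simp add: power_sum)
qed

text \<open>The factor \<open>\<nu> j\<close> is at most \<open>2 ^ mdeg \<nu>\<close>, which is
  absorbed by doubling the radius. This is why summability is later arranged at radius
  \<open>2 * r\<close>.\<close>

lemma norm_monom_deriv_le:
  assumes z: "\<And>i. cmod (z $ i) \<le> r" and r: "r > 0"
  shows "cmod (monom_deriv z \<nu> j) \<le> (2 * r) ^ mdeg \<nu> / r"
proof (cases "\<nu> j")
  case 0
  then show ?thesis using r by (simp add: monom_deriv_def)
next
  case (Suc k)
  have "cmod (monom_deriv z \<nu> j) = of_nat (\<nu> j) * (cmod (z $ j) ^ k * cmod (\<Prod>i\<in>UNIV - {j}. (z $ i) ^ \<nu> i))"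
    using Suc by (simp only: monom_deriv_def norm_mult norm_power norm_of_nat diff_Suc_1 mult.assoc)
  also have "\<dots> \<le> 2 ^ mdeg \<nu> * (r ^ k * r ^ (\<Sum>i\<in>UNIV - {j}. \<nu> i))"
  proof (intro mult_mono norm_prod_power_le power_mono z)
    have "\<nu> j \<le> mdeg \<nu>" using mdeg_split[of \<nu> j] by simp
    also have "\<dots> \<le> 2 ^ mdeg \<nu>" by (simp add: less_imp_le)
    finally have "real (\<nu> j) \<le> real (2 ^ mdeg \<nu>)" by (rule of_nat_mono)
    then show "real (\<nu> j) \<le> 2 ^ mdeg \<nu>" by simp
  qed (use r in auto)
  also have "r ^ k * r ^ (\<Sum>i\<in>UNIV - {j}. \<nu> i) = r ^ mdeg \<nu> / r"
    using r mdeg_split[of \<nu> j] Suc by (simp add: power_add)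
  finally show ?thesis by (simp add: power_mult_distrib)
qed

lemma norm_vec_le_sum: "norm (z :: complex^'n::finite) \<le> (\<Sum>j\<in>UNIV. cmod (z $ j))"
  unfolding norm_vec_def by (rule L2_set_le_sum) auto

text \<open>Convergence at the one point with all coordinates \<open>2 * r\<close> is absolute and
  dominates the differentiated series on the ball of radius \<open>r\<close>. The Weierstrass test
  then permits termwise differentiation, and multiplying a partial derivative by its coordinate
  gives the Euler series.\<close>

lemma holo_germ_expansion:
  fixes c :: "('n::finite \<Rightarrow> nat) \<Rightarrow> complex" and f :: "complex^'n \<Rightarrow> complex"
  assumes "holo_germ c f"
  obtains r pd where "0 < r" "r < 1" "(\<lambda>\<nu>. cmod (c \<nu>) * (2 * r) ^ mdeg \<nu>) summable_on UNIV"
    "\<forall>z\<in>ball 0 r. ((\<lambda>\<nu>. c \<nu> * monom z \<nu>) has_sum f z) UNIV"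
    "\<forall>z\<in>ball 0 r. (f has_derivative (\<lambda>h. \<Sum>j\<in>UNIV. pd z j * h $ j)) (at z)"
    "\<forall>z\<in>ball 0 r. \<forall>j. ((\<lambda>\<nu>. of_nat (\<nu> j) * (c \<nu> * monom z \<nu>)) has_sum (z $ j * pd z j)) UNIV"
proof -
  obtain \<epsilon> where \<epsilon>: "\<epsilon> > 0" and sum_f: "\<And>z. z \<in> ball 0 \<epsilon> \<Longrightarrow> ((\<lambda>\<nu>. c \<nu> * monom z \<nu>) has_sum f z) UNIV"
    using assms unfolding holo_germ_def by blast
  let ?n = "real CARD('n)"
  have n: "?n \<ge> 1" by (simp add: Suc_leI)
  \<comment> \<open>The second bound puts the point with all coordinates \<open>2 * r\<close> inside
    the given ball, its norm being at most \<open>2 * r * ?n\<close>; the first makes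
    \<open>r < 1\<close>, needed for the tail.\<close>
  define r where "r = min (1/2) (\<epsilon> / (4 * ?n))"
  have r: "0 < r" "r < 1" using \<epsilon> n by (auto simp: r_def)
  have "r \<le> \<epsilon> / (4 * ?n)" by (simp add: r_def)
  then have rn: "4 * r * ?n \<le> \<epsilon>" using n by (simp add: field_simps)
  have r_ball: "z \<in> ball 0 \<epsilon>" if "z \<in> ball 0 r" for z :: "complex^'n"
  proof -
    have "r * 1 \<le> r * (4 * ?n)" using n r by (intro mult_left_mono) linarith+
    then show ?thesis using that rn by (simp add: algebra_simps)
  qed
  define z0 :: "complex^'n" where "z0 = (\<chi> j. of_real (2 * r))"
  have "norm z0 \<le> ?n * (2 * r)"
    using norm_vec_le_sum[of z0] r by (simp add: z0_def)
  also have "\<dots> < ?n * (4 * r)" using n r by (intro mult_strict_left_mono) linarith+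
  also have "\<dots> \<le> \<epsilon>" using rn by (simp only: mult.commute)
  finally have "((\<lambda>\<nu>. c \<nu> * monom z0 \<nu>) has_sum f z0) UNIV" by (intro sum_f) simp
  then have "(\<lambda>\<nu>. c \<nu> * monom z0 \<nu>) summable_on UNIV" by (rule has_sum_imp_summable)
  then have "(\<lambda>\<nu>. norm (c \<nu> * monom z0 \<nu>)) summable_on UNIV"
    unfolding summable_on_iff_abs_summable_on_complex .
  moreover have "cmod (monom z0 \<nu>) = (2 * r) ^ mdeg \<nu>" for \<nu>
    using r by (simp add: cmod_monom z0_def mdeg_def power_sum norm_mult)
  ultimately have S: "(\<lambda>\<nu>. cmod (c \<nu>) * (2 * r) ^ mdeg \<nu>) summable_on UNIV"
    by (simp add: norm_mult)
  \<comment> \<open>An enumeration of the exponents turns the unordered family into a sequence, as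
    required for the theorems on uniform limits and derivatives of series.\<close>
  obtain e :: "nat \<Rightarrow> ('n \<Rightarrow> nat)" where e: "bij_betw e UNIV UNIV"
  proof -
    have "infinite (UNIV :: ('n \<Rightarrow> nat) set)"
    proof -
      have "inj (\<lambda>k. (\<lambda>_. k) :: 'n \<Rightarrow> nat)" by (auto simp: inj_def fun_eq_iff)
      then show ?thesis using finite_imageD[of "\<lambda>k. (\<lambda>_. k) :: 'n \<Rightarrow> nat" UNIV]
        by (metis finite_subset infinite_UNIV_nat subset_UNIV)
    qed
    then show thesis using that bij_betw_from_nat_into[of "UNIV :: ('n \<Rightarrow> nat) set"] by blast
  qed
  define K where "K i = cmod (c (e i)) * (2 * r) ^ mdeg (e i) / r" for i
  have K: "summable K"
  proof -
    have "(\<lambda>i. cmod (c (e i)) * (2 * r) ^ mdeg (e i)) summable_on UNIV"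
      using S by (subst summable_on_reindex_bij_betw[OF e])
    then show ?thesis unfolding K_def by (intro summable_divide summable_on_imp_summable)
  qed
  have comp: "cmod (z $ i) \<le> r" if "z \<in> ball 0 r" for z :: "complex^'n" and i
    using that Finite_Cartesian_Product.norm_nth_le[of z i] by simp
  have bound: "norm (c (e i) * monom_deriv z (e i) j) \<le> K i" if "z \<in> ball 0 r" for i z j
  proof -
    have "cmod (c (e i)) * cmod (monom_deriv z (e i) j) \<le> cmod (c (e i)) * ((2 * r) ^ mdeg (e i) / r)"
      by (intro mult_left_mono norm_monom_deriv_le comp[OF that] r) auto
    then show ?thesis by (simp add: norm_mult K_def)
  qed
  define pd where "pd z j = (\<Sum>i. c (e i) * monom_deriv z (e i) j)" for z j
  have unif: "uniform_limit (ball 0 r) (\<lambda>n z. \<Sum>i<n. c (e i) * monom_deriv z (e i) j) (\<lambda>z. pd z j) sequentially" for j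
    unfolding pd_def by (rule Weierstrass_m_test[OF bound K])
  have f_sums: "(\<lambda>i. c (e i) * monom z (e i)) sums f z" if "z \<in> ball 0 r" for z
    using sum_f[OF r_ball[OF that]] has_sum_reindex_bij_betw[OF e, of "\<lambda>\<nu>. c \<nu> * monom z \<nu>"]
    by (auto intro: has_sum_imp_sums)
  have der: "(f has_derivative (\<lambda>h. \<Sum>j\<in>UNIV. pd z j * h $ j)) (at z)" if z: "z \<in> ball 0 r" for z
  proof -
    have "\<exists>g. \<forall>x\<in>ball 0 r. (\<lambda>i. c (e i) * monom x (e i)) sums (g x) \<and>
        (g has_derivative (\<lambda>h. \<Sum>j\<in>UNIV. pd x j * h $ j)) (at x within ball 0 r)"
    proof (rule has_derivative_series)
      show "convex (ball (0 :: complex^'n) r)" by (rule convex_ball)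
      show "((\<lambda>x. c (e i) * monom x (e i)) has_derivative
         (\<lambda>h. c (e i) * (\<Sum>j\<in>UNIV. monom_deriv x (e i) j * h $ j))) (at x within ball 0 r)" for i x
        by (intro has_derivative_mult_right has_derivative_monom)
      show "0 \<in> ball (0 :: complex^'n) r" using r by simp
      then show "(\<lambda>i. c (e i) * monom 0 (e i)) sums f 0" by (rule f_sums)
      fix \<delta> :: real assume \<delta>: "\<delta> > 0"
      have "\<forall>\<^sub>F n in sequentially. \<forall>j\<in>UNIV. \<forall>x\<in>ball 0 r. dist (\<Sum>i<n. c (e i) * monom_deriv x (e i) j) (pd x j) < \<delta> / ?n"
        using unif \<delta> n by (intro eventually_ball_finite) (auto simp: uniform_limit_iff)
      then show "\<forall>\<^sub>F n in sequentially. \<forall>x\<in>ball 0 r. \<forall>h.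
          norm ((\<Sum>i<n. c (e i) * (\<Sum>j\<in>UNIV. monom_deriv x (e i) j * h $ j)) - (\<Sum>j\<in>UNIV. pd x j * h $ j)) \<le> \<delta> * norm h"
      proof (eventually_elim, intro ballI allI)
        fix n and x h :: "complex^'n"
        assume ev: "\<forall>j\<in>UNIV. \<forall>x\<in>ball 0 r. dist (\<Sum>i<n. c (e i) * monom_deriv x (e i) j) (pd x j) < \<delta> / ?n"
          and x: "x \<in> ball 0 r"
        have "(\<Sum>i<n. c (e i) * (\<Sum>j\<in>UNIV. monom_deriv x (e i) j * h $ j)) =
            (\<Sum>j\<in>UNIV. (\<Sum>i<n. c (e i) * monom_deriv x (e i) j) * h $ j)"
          unfolding sum_distrib_left sum_distrib_right by (subst sum.swap) (simp add: mult.assoc)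
        then have "norm ((\<Sum>i<n. c (e i) * (\<Sum>j\<in>UNIV. monom_deriv x (e i) j * h $ j)) - (\<Sum>j\<in>UNIV. pd x j * h $ j)) =
            norm (\<Sum>j\<in>UNIV. ((\<Sum>i<n. c (e i) * monom_deriv x (e i) j) - pd x j) * h $ j)"
          by (simp add: sum_subtractf left_diff_distrib)
        also have "\<dots> \<le> (\<Sum>j\<in>(UNIV :: 'n set). \<delta> / ?n * norm h)"
        proof (rule sum_norm_le)
          fix j :: 'n
          have "norm ((\<Sum>i<n. c (e i) * monom_deriv x (e i) j) - pd x j) \<le> \<delta> / ?n"
            using ev x by (auto simp: dist_norm less_imp_le)
          moreover have "norm (h $ j) \<le> norm h" by (rule Finite_Cartesian_Product.norm_nth_le)
          ultimately show "norm (((\<Sum>i<n. c (e i) * monom_deriv x (e i) j) - pd x j) * h $ j) \<le> \<delta> / ?n * norm h"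
            unfolding norm_mult using \<delta> n by (intro mult_mono) auto
        qed
        also have "\<dots> = \<delta> * norm h" using n by simp
        finally show "norm ((\<Sum>i<n. c (e i) * (\<Sum>j\<in>UNIV. monom_deriv x (e i) j * h $ j)) - (\<Sum>j\<in>UNIV. pd x j * h $ j)) \<le> \<delta> * norm h" .
      qed
    qed
    then obtain g where g: "\<And>x. x \<in> ball 0 r \<Longrightarrow> (\<lambda>i. c (e i) * monom x (e i)) sums (g x)"
      "\<And>x. x \<in> ball 0 r \<Longrightarrow> (g has_derivative (\<lambda>h. \<Sum>j\<in>UNIV. pd x j * h $ j)) (at x within ball 0 r)" by blast
    have eq: "g x = f x" if "x \<in> ball 0 r" for x using sums_unique2[OF g(1)[OF that] f_sums[OF that]] .
    have "(g has_derivative (\<lambda>h. \<Sum>j\<in>UNIV. pd z j * h $ j)) (at z)"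
      using g(2)[OF z] at_within_open[OF z open_ball] by simp
    then show ?thesis
      by (rule has_derivative_transform_within_open[OF _ open_ball z]) (rule eq)
  qed
  have hs: "((\<lambda>\<nu>. of_nat (\<nu> j) * (c \<nu> * monom z \<nu>)) has_sum (z $ j * pd z j)) UNIV" if z: "z \<in> ball 0 r" for z j
  proof -
    have sn: "summable (\<lambda>i. norm (c (e i) * monom_deriv z (e i) j))"
      by (rule summable_comparison_test'[OF K, of 0]) (use bound[OF z] in auto)
    have "(\<lambda>i. c (e i) * monom_deriv z (e i) j) sums pd z j"
      unfolding pd_def by (rule summable_sums[OF summable_norm_cancel[OF sn]])
    with sn have "((\<lambda>i. c (e i) * monom_deriv z (e i) j) has_sum pd z j) UNIV"
      by (rule norm_summable_imp_has_sum)
    then have "((\<lambda>i. z $ j * (c (e i) * monom_deriv z (e i) j)) has_sum (z $ j * pd z j)) UNIV"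
      by (rule has_sum_cmult_right)
    moreover have "z $ j * (c \<nu> * monom_deriv z \<nu> j) = of_nat (\<nu> j) * (c \<nu> * monom z \<nu>)" for \<nu>
      using mult_monom_deriv[of z j \<nu>] by (metis mult.left_commute)
    ultimately show ?thesis
      using has_sum_reindex_bij_betw[OF e, of "\<lambda>\<nu>. of_nat (\<nu> j) * (c \<nu> * monom z \<nu>)"] by simp
  qed
  show thesis
    by (rule that[of r pd]) (use r S sum_f r_ball der hs in auto)
qed

section \<open>Low exponents and the tail of the series\<close>

definition axis_exp :: "nat \<Rightarrow> 'n \<Rightarrow> 'n::finite \<Rightarrow> nat" where
  "axis_exp N j = (\<lambda>i. if i = j then N else 0)"

lemma monom_axis_exp: "monom z (axis_exp N j) = (z $ j) ^ N"
  by (simp add: monom_split[of z _ j] axis_exp_def)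

text \<open>In the positive orthant, a convex combination lies on a coordinate axis only if the points that
  contribute to it do.\<close>
lemma convenient_axis_exponent:
  assumes conv: "convenient c"
  obtains N where "axis_exp N j \<in> supp c"
proof -
  obtain x where x: "x \<in> newton_boundary c" and x0: "\<And>i. i \<noteq> j \<Longrightarrow> x $ i = 0"
    using conv unfolding convenient_def by blast
  have "x \<in> newton_polyhedron c"
    using x unfolding newton_boundary_def by (auto dest: face_of_imp_subset)
  then obtain S u where S: "finite S" "S \<subseteq> (\<Union>\<nu>\<in>supp c. {x. \<forall>j. x $ j \<ge> real (\<nu> j)})"
    and u: "\<forall>y\<in>S. 0 \<le> u y" "sum u S = 1" and xs: "(\<Sum>y\<in>S. u y *\<^sub>R y) = x"
    unfolding newton_polyhedron_def convex_hull_explicit by blast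
  have "\<exists>y\<in>S. u y \<noteq> 0" using u(2) by (metis sum.neutral zero_neq_one)
  then obtain y where y: "y \<in> S" "u y > 0" using u(1) by force
  then obtain \<nu> where \<nu>: "\<nu> \<in> supp c" "\<And>i. y $ i \<ge> real (\<nu> i)" using S(2) by blast
  have nn: "y' $ i \<ge> 0" if "y' \<in> S" for y' i
  proof -
    from that S(2) obtain \<mu> where "y' $ i \<ge> real (\<mu> i)" by blast
    then show ?thesis using of_nat_0_le_iff order_trans by blast
  qed
  have "\<nu> i = 0" if "i \<noteq> j" for i
  proof -
    have "0 = (\<Sum>y'\<in>S. u y' * y' $ i)" using x0[OF that] unfolding xs[symmetric] by simp
    also have "\<dots> \<ge> u y * y $ i"
      using y(1) S(1) u(1) nn by (intro member_le_sum) auto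
    finally have "u y * y $ i \<le> 0" .
    then have "y $ i \<le> 0" using y(2) by (simp add: mult_le_0_iff)
    then show ?thesis using \<nu>(2)[of i] by simp
  qed
  then have "\<nu> = axis_exp (\<nu> j) j" by (auto simp: axis_exp_def)
  then show thesis using that \<nu>(1) by metis
qed

text \<open>The box will have pure powers of the series at its axis corners. An exponent outside it
  exceeds \<open>N j\<close> for some \<open>j\<close>, so its monomial is divisible by
  \<open>(z $ j) ^ (N j + 1)\<close>.\<close>

definition low_exps :: "(('n::finite \<Rightarrow> nat) \<Rightarrow> complex) \<Rightarrow> ('n \<Rightarrow> nat) \<Rightarrow> ('n \<Rightarrow> nat) set" where
  "low_exps c N = {\<nu> \<in> supp c. \<forall>j. \<nu> j \<le> N j}"

definition monom_size :: "('n::finite \<Rightarrow> nat) set \<Rightarrow> complex^'n \<Rightarrow> real" where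
  "monom_size A z = (\<Sum>\<nu>\<in>A. cmod (monom z \<nu>))"

lemma finite_low_exps: "finite (low_exps c N)"
proof (rule finite_subset)
  show "low_exps c N \<subseteq> PiE UNIV (\<lambda>j. {..N j})" by (auto simp: low_exps_def PiE_def)
  show "finite (PiE UNIV (\<lambda>j. {..N j}))" by (intro finite_PiE) auto
qed

lemma monom_size_axis:
  assumes "finite A" "axis_exp (N j) j \<in> A"
  shows "cmod (z $ j) ^ N j \<le> monom_size A z"
  unfolding monom_size_def using member_le_sum[of "axis_exp (N j) j" A "\<lambda>\<nu>. cmod (monom z \<nu>)"] assms
  by (simp add: monom_axis_exp norm_power)

text \<open>A monomial outside the box splits off \<open>(z $ j) ^ N j\<close>, bounded by the low
  monomials, and one more factor \<open>z $ j\<close>, bounded by \<open>norm z\<close>; the rest is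
  summable. The multiplier \<open>p\<close> allows the same constant to serve for the function
  (\<open>p\<close> constantly 1) and for each Euler component
  (\<open>p \<nu> = \<nu> j\<close>).\<close>

lemma tail_estimate:
  fixes c :: "('n::finite \<Rightarrow> nat) \<Rightarrow> complex"
  assumes r: "0 < r" "r < 1" and S: "(\<lambda>\<nu>. cmod (c \<nu>) * (2 * r) ^ mdeg \<nu>) summable_on UNIV"
    and N: "\<And>j. axis_exp (N j) j \<in> supp c"
  obtains K where "K > 0"
    "\<And>z w p. z \<in> ball 0 r \<Longrightarrow> (\<And>\<nu>. p \<nu> \<le> mdeg \<nu> + 1) \<Longrightarrow>
       ((\<lambda>\<nu>. of_nat (p \<nu>) * (c \<nu> * monom z \<nu>)) has_sum w) UNIV \<Longrightarrow>
       cmod (w - (\<Sum>\<nu>\<in>low_exps c N. of_nat (p \<nu>) * (c \<nu> * monom z \<nu>))) \<le> K * norm z * monom_size (low_exps c N) z"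
proof -
  let ?A = "low_exps c N"
  define T where "T = infsum (\<lambda>\<nu>. cmod (c \<nu>) * (2 * r) ^ mdeg \<nu>) UNIV"
  have T0: "T \<ge> 0" unfolding T_def using r by (intro infsum_nonneg) auto
  \<comment> \<open>Since \<open>r < 1\<close>, the exponent \<open>mdeg N + 1\<close> gives a
    denominator that works for every \<open>j\<close>; the summand 1 keeps \<open>K\<close>
    positive.\<close>
  define K where "K = (T + 1) / r ^ (mdeg N + 1)"
  have K: "K > 0" using r T0 by (simp add: K_def)
  have axisA: "axis_exp (N j) j \<in> ?A" for j using N[of j] by (auto simp: low_exps_def axis_exp_def)
  show thesis
  proof (rule that[OF K])
    fix z w and p :: "('n \<Rightarrow> nat) \<Rightarrow> nat"
    assume z: "z \<in> ball 0 r" and p: "\<And>\<nu>. p \<nu> \<le> mdeg \<nu> + 1"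
      and hs: "((\<lambda>\<nu>. of_nat (p \<nu>) * (c \<nu> * monom z \<nu>)) has_sum w) UNIV"
    let ?M = "monom_size ?A z"
    have M0: "?M \<ge> 0" unfolding monom_size_def by (intro sum_nonneg) auto
    have zr: "cmod (z $ i) \<le> r" for i using z Finite_Cartesian_Product.norm_nth_le[of z i] by simp
    have mon: "cmod (monom z \<nu>) \<le> (norm z * ?M / r ^ (mdeg N + 1)) * r ^ mdeg \<nu>" if gt: "\<nu> j > N j" for \<nu> j
    proof -
      obtain k where k: "\<nu> j = Suc (N j + k)" using less_imp_Suc_add[OF gt] by blast
      let ?s = "\<Sum>i\<in>UNIV - {j}. \<nu> i"
      have "cmod (monom z \<nu>) = cmod (z $ j) ^ N j * cmod (z $ j) * (cmod (z $ j) ^ k * cmod (\<Prod>i\<in>UNIV - {j}. (z $ i) ^ \<nu> i))"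
        by (simp add: monom_split[of z \<nu> j] norm_mult norm_power k power_add)
      also have "\<dots> \<le> ?M * norm z * (r ^ k * r ^ ?s)"
        using M0 r zr
        by (intro mult_mono monom_size_axis finite_low_exps axisA Finite_Cartesian_Product.norm_nth_le power_mono norm_prod_power_le) auto
      also have "r ^ k * r ^ ?s = r ^ mdeg \<nu> / r ^ (N j + 1)"
        using r by (simp add: mdeg_split[of \<nu> j] k power_add)
      also have "?M * norm z * (r ^ mdeg \<nu> / r ^ (N j + 1)) \<le> ?M * norm z * (r ^ mdeg \<nu> / r ^ (mdeg N + 1))"
      proof (intro mult_left_mono divide_left_mono)
        have "N j \<le> mdeg N" using mdeg_split[of N j] by simp
        then show "r ^ (mdeg N + 1) \<le> r ^ (N j + 1)" using r by (intro power_decreasing) auto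
      qed (use r M0 in auto)
      finally show ?thesis by (simp add: mult_ac)
    qed
    define B where "B = norm z * ?M / r ^ (mdeg N + 1)"
    have B0: "B \<ge> 0" using M0 r by (simp add: B_def)
    have "((\<lambda>\<nu>. of_nat (p \<nu>) * (c \<nu> * monom z \<nu>)) has_sum (w - (\<Sum>\<nu>\<in>?A. of_nat (p \<nu>) * (c \<nu> * monom z \<nu>)))) (UNIV - ?A)"
      by (intro has_sum_Diff hs has_sum_finite finite_low_exps) auto
    moreover have "((\<lambda>\<nu>. B * (cmod (c \<nu>) * (2 * r) ^ mdeg \<nu>)) has_sum
        B * infsum (\<lambda>\<nu>. cmod (c \<nu>) * (2 * r) ^ mdeg \<nu>) (UNIV - ?A)) (UNIV - ?A)"
      by (intro has_sum_cmult_right has_sum_infsum summable_on_subset_banach[OF S]) auto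
    moreover have "norm (of_nat (p \<nu>) * (c \<nu> * monom z \<nu>)) \<le> B * (cmod (c \<nu>) * (2 * r) ^ mdeg \<nu>)"
      if nu: "\<nu> \<in> UNIV - ?A" for \<nu>
    proof (cases "c \<nu> = 0")
      case False
      then obtain j where j: "\<nu> j > N j" using nu by (auto simp: low_exps_def supp_def not_le)
      have "p \<nu> \<le> 2 ^ mdeg \<nu>" using p[of \<nu>] less_exp[of "mdeg \<nu>"] by linarith
      then have p2: "real (p \<nu>) \<le> 2 ^ mdeg \<nu>" by (metis of_nat_le_iff of_nat_numeral of_nat_power)
      have "norm (of_nat (p \<nu>) * (c \<nu> * monom z \<nu>)) = real (p \<nu>) * (cmod (c \<nu>) * cmod (monom z \<nu>))"
        by (simp only: norm_mult norm_of_nat)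
      also have "\<dots> \<le> 2 ^ mdeg \<nu> * (cmod (c \<nu>) * (B * r ^ mdeg \<nu>))"
        using mon[where j=j and \<nu>=\<nu>, OF j] p2 by (intro mult_mono) (auto simp: B_def)
      also have "\<dots> = B * (cmod (c \<nu>) * (2 * r) ^ mdeg \<nu>)" by (simp add: power_mult_distrib mult_ac)
      finally show ?thesis .
    qed simp
    ultimately have "cmod (w - (\<Sum>\<nu>\<in>?A. of_nat (p \<nu>) * (c \<nu> * monom z \<nu>))) \<le>
        B * infsum (\<lambda>\<nu>. cmod (c \<nu>) * (2 * r) ^ mdeg \<nu>) (UNIV - ?A)"
      by (rule norm_infsum_le)
    also have "\<dots> \<le> B * (T + 1)"
    proof (intro mult_left_mono B0)
      have "infsum (\<lambda>\<nu>. cmod (c \<nu>) * (2 * r) ^ mdeg \<nu>) (UNIV - ?A) \<le> T"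
        unfolding T_def using r by (intro infsum_mono2 summable_on_subset_banach[OF S] S) auto
      then show "infsum (\<lambda>\<nu>. cmod (c \<nu>) * (2 * r) ^ mdeg \<nu>) (UNIV - ?A) \<le> T + 1" by simp
    qed
    also have "\<dots> = K * norm z * ?M" by (simp add: B_def K_def)
    finally show "cmod (w - (\<Sum>\<nu>\<in>?A. of_nat (p \<nu>) * (c \<nu> * monom z \<nu>))) \<le> K * norm z * ?M" .
  qed
qed

section \<open>Newton polyhedra and non-degeneracy\<close>

lemma finite_convergent_subsequence:
  fixes X :: "nat \<Rightarrow> 'i \<Rightarrow> 'a::heine_borel"
  assumes "finite I" "\<And>i. i \<in> I \<Longrightarrow> bounded (range (\<lambda>m. X m i))"
  obtains s l where "strict_mono (s :: nat \<Rightarrow> nat)" "\<And>i. i \<in> I \<Longrightarrow> (\<lambda>m. X (s m) i) \<longlonglongrightarrow> l i"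
proof -
  have "\<exists>s. strict_mono (s :: nat \<Rightarrow> nat) \<and> (\<forall>i\<in>I. \<exists>l. (\<lambda>m. X (s m) i) \<longlonglongrightarrow> l)"
    using assms
  proof (induction I rule: finite_induct)
    case empty
    show ?case by (auto intro: exI[of _ id] strict_mono_id)
  next
    case (insert i I)
    then obtain s where s: "strict_mono (s :: nat \<Rightarrow> nat)" "\<forall>i\<in>I. \<exists>l. (\<lambda>m. X (s m) i) \<longlonglongrightarrow> l"
      by (metis insertCI)
    have "bounded (range (\<lambda>m. X (s m) i))"
      by (rule bounded_subset[OF insert.prems[of i]]) auto
    then obtain l t where t: "strict_mono (t :: nat \<Rightarrow> nat)" "((\<lambda>m. X (s m) i) \<circ> t) \<longlonglongrightarrow> l"
      using bounded_imp_convergent_subsequence by metis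
    have "\<exists>l. (\<lambda>m. X ((s \<circ> t) m) i') \<longlonglongrightarrow> l" if i': "i' \<in> insert i I" for i'
    proof (cases "i' = i")
      case True
      then show ?thesis using t(2) by (auto simp: o_def)
    next
      case False
      then obtain l' where "(\<lambda>m. X (s m) i') \<longlonglongrightarrow> l'" using s(2) i' by auto
      from LIMSEQ_subseq_LIMSEQ[OF this t(1)] show ?thesis by (auto simp: o_def)
    qed
    then show ?case using strict_mono_o[OF s(1) t(1)] by blast
  qed
  then obtain s where s: "strict_mono (s :: nat \<Rightarrow> nat)" "\<forall>i\<in>I. \<exists>l. (\<lambda>m. X (s m) i) \<longlonglongrightarrow> l" by blast
  then obtain l where "\<forall>i\<in>I. (\<lambda>m. X (s m) i) \<longlonglongrightarrow> l i" by metis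
  with s(1) show thesis using that by blast
qed

text \<open>Rounding a long weight vector by simultaneous Dirichlet approximation: an integer that is
  close to a bounded quantity divided by a large scale must vanish.\<close>
lemma integral_weight:
  fixes A :: "('n::finite \<Rightarrow> nat) set" and \<l> :: "nat \<Rightarrow> 'n \<Rightarrow> real"
  defines "d \<equiv> \<lambda>m \<nu> \<nu>0. (\<Sum>j\<in>UNIV. (real (\<nu> j) - real (\<nu>0 j)) * \<l> m j)"
  assumes A: "finite A" "\<Delta> \<subseteq> A"
    and bdd: "\<And>\<nu>. \<nu> \<in> \<Delta> \<Longrightarrow> bounded (range (\<lambda>m. d m \<nu> \<nu>0))"
    and inf: "\<And>\<nu>. \<nu> \<in> A - \<Delta> \<Longrightarrow> filterlim (\<lambda>m. d m \<nu> \<nu>0) at_top sequentially"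
    and \<l>: "\<And>j. filterlim (\<lambda>m. \<l> m j) at_top sequentially"
  obtains P :: "'n \<Rightarrow> nat" where "\<And>j. P j > 0"
    "\<And>\<nu>. \<nu> \<in> \<Delta> \<Longrightarrow> (\<Sum>j\<in>UNIV. P j * \<nu> j) = (\<Sum>j\<in>UNIV. P j * \<nu>0 j)"
    "\<And>\<nu>. \<nu> \<in> A - \<Delta> \<Longrightarrow> (\<Sum>j\<in>UNIV. P j * \<nu> j) > (\<Sum>j\<in>UNIV. P j * \<nu>0 j)"
proof -
  have fD: "finite \<Delta>" using A finite_subset by blast
  have "\<forall>\<nu>\<in>\<Delta>. \<exists>B. \<forall>m. \<bar>d m \<nu> \<nu>0\<bar> \<le> B" using bdd by (auto simp: bounded_iff)
  then obtain Bf where Bf: "\<And>\<nu> m. \<nu> \<in> \<Delta> \<Longrightarrow> \<bar>d m \<nu> \<nu>0\<bar> \<le> Bf \<nu>" by metis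
  define B where "B = 1 + (\<Sum>\<nu>\<in>\<Delta>. \<bar>Bf \<nu>\<bar>)"
  have B1: "B \<ge> 1" by (simp add: B_def sum_nonneg)
  have B: "\<bar>d m \<nu> \<nu>0\<bar> \<le> B" if "\<nu> \<in> \<Delta>" for m \<nu>
  proof -
    have "\<bar>Bf \<nu>\<bar> \<le> (\<Sum>\<nu>\<in>\<Delta>. \<bar>Bf \<nu>\<bar>)" using that fD by (intro member_le_sum) auto
    then show ?thesis using Bf[OF that, of m] by (simp add: B_def)
  qed
  define s where "s \<nu> = (\<Sum>j\<in>UNIV. \<bar>real (\<nu> j) - real (\<nu>0 j)\<bar>)" for \<nu>
  have s0: "s \<nu> \<ge> 0" for \<nu> by (simp add: s_def sum_nonneg)
  define V where "V = (\<Sum>\<nu>\<in>A. s \<nu>)"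
  \<comment> \<open>Chosen so that rounding each weight by at most \<open>1 / N\<close> changes the
    pairing with any exponent difference by at most 1/4.\<close>
  obtain N :: nat where N: "4 + 4 * V \<le> real N" using real_arch_simple by blast
  have "0 \<le> V" unfolding V_def using s0 by (rule sum_nonneg)
  then have N4: "real N \<ge> 4" using N by linarith
  have sN: "s \<nu> / real N \<le> 1/4" if "\<nu> \<in> A" for \<nu>
  proof -
    have "s \<nu> \<le> V" unfolding V_def using that A s0 by (intro member_le_sum) auto
    then have "4 * s \<nu> \<le> real N" using N by linarith
    then show ?thesis using N4 by (simp add: field_simps)
  qed
  define Q where "Q = real (N ^ CARD('n))"
  have Q1: "Q \<ge> 1" using N4 by (simp add: Q_def)
  \<comment> \<open>After scaling by \<open>q / t\<close> with \<open>1 \<le> q \<le> Q\<close>, a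
    quantity bounded by \<open>B\<close> is at most 1/4, while one that is at least \<open>t\<close>
    remains at least 1. With the rounding error of 1/4, the integer \<open>D \<nu>\<close> is zero
    in the first case and positive in the second.\<close>
  define t where "t = 4 * Q * B"
  have t1: "t \<ge> 1"
  proof -
    have "1 \<le> Q * B" using mult_mono[OF Q1 B1] Q1 by simp
    then show ?thesis unfolding t_def by linarith
  qed
  have "\<forall>\<^sub>F m in sequentially. (\<forall>\<nu>\<in>A - \<Delta>. d m \<nu> \<nu>0 \<ge> t) \<and> (\<forall>j\<in>UNIV. \<l> m j \<ge> t)"
    using inf \<l> A by (intro eventually_conj eventually_ball_finite ballI) (auto simp: filterlim_at_top)
  then obtain m where m: "\<And>\<nu>. \<nu> \<in> A - \<Delta> \<Longrightarrow> d m \<nu> \<nu>0 \<ge> t" "\<And>j. \<l> m j \<ge> t"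
    by (auto simp: eventually_sequentially)
  obtain h :: "'n \<Rightarrow> nat" where h: "bij_betw h UNIV {0..<CARD('n)}"
    using ex_bij_betw_finite_nat[of "UNIV :: 'n set"] by auto
  obtain q p where q: "0 < q" "q \<le> int (N ^ CARD('n))"
    and p: "\<forall>i<CARD('n). \<bar>of_int q * (\<l> m (inv h i) / t) - of_int (p i)\<bar> < 1 / real N"
    by (rule Dirichlet_approx_simult[of N "CARD('n)" "\<lambda>i. \<l> m (inv h i) / t"]) (use N4 in auto)
  define x where "x j = real_of_int q * (\<l> m j / t)" for j
  define P where "P j = p (h j)" for j
  have hj: "h j < CARD('n)" "inv h (h j) = j" for j
    using h by (auto simp: bij_betw_def inv_f_f)
  have P: "\<bar>x j - of_int (P j)\<bar> \<le> 1 / real N" for j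
    using p[rule_format, OF hj(1)[of j]] by (simp add: x_def P_def hj(2))
  have q1: "real_of_int q \<ge> 1" using q(1) by simp
  have qQ: "real_of_int q \<le> Q" using q(2) unfolding Q_def by (metis of_int_le_iff of_int_of_nat_eq)
  have Ppos: "P j > 0" for j
  proof -
    have "1 * 1 \<le> real_of_int q * (\<l> m j / t)" using m(2)[of j] t1 q1 by (intro mult_mono) auto
    moreover have "1 / real N \<le> 1/4" using N4 by (simp add: field_simps)
    ultimately have "real_of_int (P j) > 0" using P[of j] by (simp add: x_def)
    then show ?thesis by simp
  qed
  define D where "D \<nu> = (\<Sum>j\<in>UNIV. (int (\<nu> j) - int (\<nu>0 j)) * P j)" for \<nu>
  have D: "\<bar>of_int q * (d m \<nu> \<nu>0 / t) - of_int (D \<nu>)\<bar> \<le> 1/4" if "\<nu> \<in> A" for \<nu>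
  proof -
    have "of_int q * (d m \<nu> \<nu>0 / t) - of_int (D \<nu>) = (\<Sum>j\<in>UNIV. (real (\<nu> j) - real (\<nu>0 j)) * (x j - of_int (P j)))"
    proof -
      have "of_int q * (d m \<nu> \<nu>0 / t) = (\<Sum>j\<in>UNIV. (real (\<nu> j) - real (\<nu>0 j)) * x j)"
        by (simp add: d_def x_def sum_distrib_left sum_divide_distrib mult_ac)
      moreover have "real_of_int (D \<nu>) = (\<Sum>j\<in>UNIV. (real (\<nu> j) - real (\<nu>0 j)) * of_int (P j))"
        by (simp add: D_def)
      ultimately show ?thesis by (simp only: right_diff_distrib sum_subtractf)
    qed
    also have "\<bar>\<dots>\<bar> \<le> (\<Sum>j\<in>UNIV. \<bar>real (\<nu> j) - real (\<nu>0 j)\<bar> * (1 / real N))"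
      by (rule order_trans[OF sum_abs], rule sum_mono) (unfold abs_mult, intro mult_left_mono P, simp)
    also have "\<dots> = s \<nu> / real N" by (simp add: s_def sum_divide_distrib)
    finally show ?thesis using sN[OF that] by linarith
  qed
  have D0: "D \<nu> = 0" if "\<nu> \<in> \<Delta>" for \<nu>
  proof -
    have "\<bar>of_int q * (d m \<nu> \<nu>0 / t)\<bar> = of_int q * (\<bar>d m \<nu> \<nu>0\<bar> / t)" using q1 t1 by (simp add: abs_mult)
    also have "\<dots> \<le> Q * (B / t)" using qQ q1 B[OF that] t1 Q1 B1 by (intro mult_mono divide_right_mono) auto
    also have "\<dots> = 1/4" using Q1 B1 by (simp add: t_def)
    finally have "\<bar>of_int q * (d m \<nu> \<nu>0 / t)\<bar> \<le> 1/4" .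
    moreover have "\<bar>of_int q * (d m \<nu> \<nu>0 / t) - of_int (D \<nu>)\<bar> \<le> 1/4" using that A by (intro D) blast
    ultimately have "\<bar>real_of_int (D \<nu>)\<bar> < 1" by linarith
    then show ?thesis by linarith
  qed
  have D1: "D \<nu> > 0" if "\<nu> \<in> A - \<Delta>" for \<nu>
  proof -
    have "1 * 1 \<le> real_of_int q * (d m \<nu> \<nu>0 / t)" using m(1)[OF that] t1 q1 by (intro mult_mono) auto
    moreover have "\<bar>of_int q * (d m \<nu> \<nu>0 / t) - of_int (D \<nu>)\<bar> \<le> 1/4" using that by (intro D) blast
    ultimately have "real_of_int (D \<nu>) > 0" by linarith
    then show ?thesis by simp
  qed
  have DP: "int (\<Sum>j\<in>UNIV. nat (P j) * \<nu> j) - int (\<Sum>j\<in>UNIV. nat (P j) * \<nu>0 j) = D \<nu>" for \<nu>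
    using Ppos by (simp add: D_def sum_subtractf[symmetric] less_imp_le algebra_simps)
  show thesis
  proof (rule that[of "\<lambda>j. nat (P j)"])
    show "nat (P j) > 0" for j using Ppos[of j] by simp
    show "(\<Sum>j\<in>UNIV. nat (P j) * \<nu> j) = (\<Sum>j\<in>UNIV. nat (P j) * \<nu>0 j)" if "\<nu> \<in> \<Delta>" for \<nu>
      using DP[of \<nu>] D0[OF that] by linarith
    show "(\<Sum>j\<in>UNIV. nat (P j) * \<nu> j) > (\<Sum>j\<in>UNIV. nat (P j) * \<nu>0 j)" if "\<nu> \<in> A - \<Delta>" for \<nu>
      using DP[of \<nu>] D1[OF that] by linarith
  qed
qed

text \<open>Take for \<open>b m\<close> the orthogonal projection of \<open>\<l> m\<close> to the
  span of \<open>D\<close>; this leaves the pairings unchanged. The map \<open>T\<close> is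
  injective on the span, hence bounded below there, and bounded pairings bound
  \<open>T (b m)\<close>.\<close>

lemma bounded_lift:
  fixes D :: "'a::euclidean_space set" and \<l> :: "nat \<Rightarrow> 'a"
  assumes D: "finite D" and bdd: "\<And>x. x \<in> D \<Longrightarrow> bounded (range (\<lambda>m. x \<bullet> \<l> m))"
  obtains b where "bounded (range b)" "\<And>x m. x \<in> D \<Longrightarrow> x \<bullet> b m = x \<bullet> \<l> m"
proof -
  have "\<exists>y z. y \<in> span D \<and> (\<forall>w\<in>span D. orthogonal z w) \<and> \<l> m = y + z" for m
    using orthogonal_subspace_decomp_exists[of D "\<l> m"] by metis
  then obtain b z where b: "\<And>m. b m \<in> span D" and z: "\<And>m w. w \<in> span D \<Longrightarrow> orthogonal (z m) w"
    and \<l>: "\<And>m. \<l> m = b m + z m" by metis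
  have eq: "x \<bullet> b m = x \<bullet> \<l> m" if "x \<in> D" for x m
    using z[of x m] span_base[OF that] by (simp add: \<l> inner_add_right orthogonal_def inner_commute)
  define T where "T y = (\<Sum>x\<in>D. (x \<bullet> y) *\<^sub>R x)" for y
  have "bounded_linear T"
    unfolding T_def by (intro bounded_linear_sum bounded_linear_scaleR_const bounded_linear_inner_right)
  moreover have "y = 0" if y: "y \<in> span D" "T y = 0" for y
  proof -
    have "(\<Sum>x\<in>D. (x \<bullet> y)\<^sup>2) = T y \<bullet> y" by (simp add: T_def inner_sum_left power2_eq_square)
    then have "(\<Sum>x\<in>D. (x \<bullet> y)\<^sup>2) = 0" using y by simp
    then have "\<forall>x\<in>D. x \<bullet> y = 0" using D by (subst (asm) sum_nonneg_eq_0_iff) auto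
    then have "orthogonal y y"
      by (intro orthogonal_to_span[OF y(1)]) (auto simp: orthogonal_def inner_commute)
    then show ?thesis by (simp add: orthogonal_self)
  qed
  ultimately obtain e where e: "e > 0" "\<And>y. y \<in> span D \<Longrightarrow> norm (T y) \<ge> e * norm y"
    using injective_imp_isometric[of "span D" T] closed_subspace[OF subspace_span] subspace_span by blast
  have "\<forall>x\<in>D. \<exists>B. \<forall>m. \<bar>x \<bullet> \<l> m\<bar> \<le> B" using bdd by (auto simp: bounded_iff)
  then obtain B where B: "\<And>x m. x \<in> D \<Longrightarrow> \<bar>x \<bullet> \<l> m\<bar> \<le> B x" by metis
  have "norm (b m) \<le> (\<Sum>x\<in>D. B x * norm x) / e" for m
  proof -
    have "e * norm (b m) \<le> norm (T (b m))" by (rule e(2)[OF b])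
    also have "\<dots> \<le> (\<Sum>x\<in>D. B x * norm x)"
      unfolding T_def using B eq by (intro sum_norm_le) (auto intro!: mult_right_mono)
    finally show ?thesis using e(1) by (simp add: field_simps)
  qed
  then have "bounded (range b)" unfolding bounded_iff by blast
  then show thesis using that eq by blast
qed

lemma monom_nonzero: "(\<And>j. z $ j \<noteq> 0) \<Longrightarrow> monom z \<nu> \<noteq> 0"
  by (simp add: monom_def)

lemma tendsto_monom:
  assumes "\<And>j. ((\<lambda>x. z x $ j) \<longlongrightarrow> w $ j) F"
  shows "((\<lambda>x. monom (z x) \<nu>) \<longlongrightarrow> monom w \<nu>) F"
  unfolding monom_def by (intro tendsto_prod tendsto_power assms)

lemma monom_polar:
  assumes "\<And>j. z $ j = \<theta> j * of_real (exp (- l j))"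
  shows "monom z \<nu> = (\<Prod>j\<in>UNIV. \<theta> j ^ \<nu> j) * of_real (exp (- (\<Sum>j\<in>UNIV. real (\<nu> j) * l j)))"
proof -
  have "exp (- (\<Sum>j\<in>UNIV. real (\<nu> j) * l j)) = (\<Prod>j\<in>UNIV. exp (- l j) ^ \<nu> j)"
    by (simp add: exp_sum sum_negf[symmetric] exp_of_nat_mult[symmetric])
  then show ?thesis by (simp add: monom_def assms power_mult_distrib prod.distrib)
qed

lemma newton_polyhedron_exponent: "\<nu> \<in> supp c \<Longrightarrow> nuvec \<nu> \<in> newton_polyhedron c"
  unfolding newton_polyhedron_def by (rule hull_inc) (auto simp: nuvec_def)

lemma newton_polyhedron_weight_ge:
  assumes "\<And>\<nu>. \<nu> \<in> supp c \<Longrightarrow> (\<Sum>j\<in>UNIV. real (P j) * real (\<nu> j)) \<ge> d"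
    and x: "x \<in> newton_polyhedron c"
  shows "(\<Sum>j\<in>UNIV. real (P j) * x $ j) \<ge> d"
proof -
  let ?p = "(\<chi> j. real (P j)) :: real^'a"
  let ?H = "{x. ?p \<bullet> x \<ge> d}"
  have in_eq: "?p \<bullet> x = (\<Sum>j\<in>UNIV. real (P j) * x $ j)" for x by (simp add: inner_vec_def)
  have "(\<Union>\<nu>\<in>supp c. {x. \<forall>j. x $ j \<ge> real (\<nu> j)}) \<subseteq> ?H"
  proof clarify
    fix \<nu> and x :: "real^'a" assume n: "\<nu> \<in> supp c" and x: "\<forall>j. x $ j \<ge> real (\<nu> j)"
    have "d \<le> (\<Sum>j\<in>UNIV. real (P j) * real (\<nu> j))" by (rule assms(1)[OF n])
    also have "\<dots> \<le> (\<Sum>j\<in>UNIV. real (P j) * x $ j)" using x by (intro sum_mono mult_left_mono) auto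
    finally show "d \<le> ?p \<bullet> x" by (simp add: in_eq)
  qed
  then have "newton_polyhedron c \<subseteq> ?H"
    unfolding newton_polyhedron_def by (rule hull_minimal) (rule convex_halfspace_ge)
  then show ?thesis using x in_eq by auto
qed

text \<open>A linear functional with nonnegative coefficients has the same lower bounds on the
  polyhedron as on the support, so a face can be recognised from the exponents alone.\<close>

lemma face_exps_eq:
  assumes D: "\<Delta> \<subseteq> supp c" "\<nu>0 \<in> \<Delta>"
    and eq: "\<And>\<nu>. \<nu> \<in> \<Delta> \<Longrightarrow> (\<Sum>j\<in>UNIV. P j * \<nu> j) = (\<Sum>j\<in>UNIV. P j * \<nu>0 j)"
    and gt: "\<And>\<nu>. \<nu> \<in> supp c - \<Delta> \<Longrightarrow> (\<Sum>j\<in>UNIV. P j * \<nu> j) > (\<Sum>j\<in>UNIV. P j * \<nu>0 j)"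
  shows "face_exps c P = \<Delta>"
proof -
  define wt where "wt \<nu> = (\<Sum>j\<in>UNIV. P j * \<nu> j)" for \<nu>
  have wt: "(\<Sum>j\<in>UNIV. real (P j) * real (\<nu> j)) = real (wt \<nu>)" for \<nu> by (simp add: wt_def)
  have wt_eq: "wt \<nu> = wt \<nu>0" if "\<nu> \<in> \<Delta>" for \<nu> using eq[OF that] by (simp add: wt_def)
  have ge: "wt \<nu> \<ge> wt \<nu>0" if "\<nu> \<in> supp c" for \<nu>
    using eq[of \<nu>] gt[of \<nu>] that unfolding wt_def by (cases "\<nu> \<in> \<Delta>") auto
  have hull: "real (wt \<nu>0) \<le> (\<Sum>j\<in>UNIV. real (P j) * x $ j)" if "x \<in> newton_polyhedron c" for x
    by (rule newton_polyhedron_weight_ge[OF _ that]) (simp add: wt ge)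
  have "\<nu> \<in> \<Delta>" if "\<nu> \<in> face_exps c P" for \<nu>
  proof (rule ccontr)
    assume "\<nu> \<notin> \<Delta>"
    moreover have "\<nu> \<in> supp c" using that by (simp add: face_exps_def)
    ultimately have "wt \<nu> > wt \<nu>0" using gt[of \<nu>] by (simp add: wt_def)
    moreover have "real (wt \<nu>) \<le> (\<Sum>j\<in>UNIV. real (P j) * nuvec \<nu>0 $ j)"
      using that newton_polyhedron_exponent[of \<nu>0 c] D unfolding face_exps_def wt by blast
    ultimately show False by (simp add: nuvec_def wt)
  qed
  moreover have "\<nu> \<in> face_exps c P" if "\<nu> \<in> \<Delta>" for \<nu>
    using that D hull wt_eq[OF that] unfolding face_exps_def wt by auto
  ultimately show ?thesis by blast
qed

text \<open>On the torus a partial derivative is the Euler component divided by the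
  coordinate.\<close>

lemma partial_zero_face_fun:
  assumes fin: "finite (face_exps c P)" and u: "u $ j \<noteq> 0"
    and H: "(\<Sum>\<nu>\<in>face_exps c P. of_nat (\<nu> j) * (c \<nu> * monom u \<nu>)) = 0"
  shows "partial_zero (face_fun c P) j u"
proof -
  let ?u = "\<lambda>t. (\<chi> i. if i = j then t else u $ i) :: complex^'a"
  have m: "monom (?u t) \<nu> = t ^ \<nu> j * (\<Prod>i\<in>UNIV - {j}. (u $ i) ^ \<nu> i)" for t \<nu>
    by (simp add: monom_split[of _ _ j])
  have "((\<lambda>t. \<Sum>\<nu>\<in>face_exps c P. c \<nu> * (t ^ \<nu> j * (\<Prod>i\<in>UNIV - {j}. (u $ i) ^ \<nu> i))) has_field_derivative
     (\<Sum>\<nu>\<in>face_exps c P. c \<nu> * (of_nat (\<nu> j) * u $ j ^ (\<nu> j - 1) * (\<Prod>i\<in>UNIV - {j}. (u $ i) ^ \<nu> i)))) (at (u $ j))"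
    by (auto intro!: derivative_eq_intros sum.cong simp: mult_ac)
  also have "(\<Sum>\<nu>\<in>face_exps c P. c \<nu> * (of_nat (\<nu> j) * u $ j ^ (\<nu> j - 1) * (\<Prod>i\<in>UNIV - {j}. (u $ i) ^ \<nu> i))) =
     (\<Sum>\<nu>\<in>face_exps c P. of_nat (\<nu> j) * (c \<nu> * monom u \<nu>)) / u $ j"
    unfolding sum_divide_distrib
  proof (rule sum.cong[OF refl])
    fix \<nu>
    have "u $ j * monom_deriv u \<nu> j = of_nat (\<nu> j) * monom u \<nu>" by (rule mult_monom_deriv)
    then have "monom_deriv u \<nu> j = of_nat (\<nu> j) * monom u \<nu> / u $ j" using u by (simp add: field_simps)
    then show "c \<nu> * (of_nat (\<nu> j) * u $ j ^ (\<nu> j - 1) * (\<Prod>i\<in>UNIV - {j}. (u $ i) ^ \<nu> i)) =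
        of_nat (\<nu> j) * (c \<nu> * monom u \<nu>) / u $ j" by (simp add: monom_deriv_def)
  qed
  finally show ?thesis by (simp add: partial_zero_def face_fun_def m H)
qed

text \<open>A closed condition that holds for \<open>l \<theta>\<close> whenever \<open>l\<close> is a complex number and all \<open>\<theta>\<^sub>j \<ge> 0\<close>.\<close>
definition aligned :: "('n::finite \<Rightarrow> complex) \<Rightarrow> bool" where
  "aligned v \<longleftrightarrow> (\<forall>P. (\<forall>j. P j > 0) \<longrightarrow> (\<Sum>j\<in>UNIV. cmod (v j)) \<le> cmod (\<Sum>j\<in>UNIV. of_nat (P j) * v j))"

text \<open>Nonnegative \<open>\<theta>\<close> cannot cancel in the weighted sum, and positive
  integral weights are at least 1.\<close>

lemma aligned_cone:
  assumes "\<And>j. \<theta> j \<ge> 0"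
  shows "aligned (\<lambda>j. l * of_real (\<theta> j))"
  unfolding aligned_def
proof (intro allI impI)
  fix P :: "'a \<Rightarrow> nat" assume P: "\<forall>j. P j > 0"
  have "(\<Sum>j\<in>UNIV. cmod (l * of_real (\<theta> j))) = cmod l * (\<Sum>j\<in>UNIV. \<theta> j)"
    using assms by (simp add: norm_mult sum_distrib_left)
  also have "\<dots> \<le> cmod l * (\<Sum>j\<in>UNIV. real (P j) * \<theta> j)"
  proof (intro mult_left_mono sum_mono)
    fix j
    have "1 * \<theta> j \<le> real (P j) * \<theta> j" using P[rule_format, of j] assms by (intro mult_right_mono) auto
    then show "\<theta> j \<le> real (P j) * \<theta> j" by simp
  qed simp
  also have "\<dots> = cmod l * cmod (of_real (\<Sum>j\<in>UNIV. real (P j) * \<theta> j))"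
    using assms by (simp only: norm_of_real) (simp add: sum_nonneg)
  also have "\<dots> = cmod (\<Sum>j\<in>UNIV. of_nat (P j) * (l * of_real (\<theta> j)))"
    unfolding norm_mult[symmetric] by (simp add: sum_distrib_left mult_ac)
  finally show "(\<Sum>j\<in>UNIV. cmod (l * of_real (\<theta> j))) \<le> cmod (\<Sum>j\<in>UNIV. of_nat (P j) * (l * of_real (\<theta> j)))" .
qed

section \<open>Truncation to low exponents and the lower bound on the torus\<close>

definition low_poly :: "(('n::finite \<Rightarrow> nat) \<Rightarrow> complex) \<Rightarrow> ('n \<Rightarrow> nat) set \<Rightarrow> complex^'n \<Rightarrow> complex" where
  "low_poly c A z = (\<Sum>\<nu>\<in>A. c \<nu> * monom z \<nu>)"

definition low_euler :: "(('n::finite \<Rightarrow> nat) \<Rightarrow> complex) \<Rightarrow> ('n \<Rightarrow> nat) set \<Rightarrow> complex^'n \<Rightarrow> 'n \<Rightarrow> complex" where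
  "low_euler c A z j = (\<Sum>\<nu>\<in>A. of_nat (\<nu> j) * (c \<nu> * monom z \<nu>))"

text \<open>Measures the failure of the truncated function to vanish with truncated Euler vector
  \<open>v\<close>. The vector is a separate argument because the true Euler vector differs from the
  truncated one by a tail.\<close>

definition defect :: "(('n::finite \<Rightarrow> nat) \<Rightarrow> complex) \<Rightarrow> ('n \<Rightarrow> nat) set \<Rightarrow> complex^'n \<Rightarrow> ('n \<Rightarrow> complex) \<Rightarrow> real" where
  "defect c A z v = cmod (low_poly c A z) + (\<Sum>j\<in>UNIV. cmod (low_euler c A z j - v j))"

text \<open>The bound is linear in \<open>monom_size\<close>, so it outweighs a tail of order
  \<open>norm z\<close> times \<open>monom_size\<close> near the origin. In the contradiction,
  subsequences are extracted for the normalised monomials, the phases and the projected logarithms;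
  moduli and phases are treated apart because only the moduli degenerate.\<close>

lemma torus_lower_bound:
  fixes c :: "('n::finite \<Rightarrow> nat) \<Rightarrow> complex"
  assumes nondeg: "non_degenerate c" and N: "\<And>j. axis_exp (N j) j \<in> supp c"
  defines "A \<equiv> low_exps c N"
  shows "\<exists>\<delta>>0. \<exists>\<epsilon>>0. \<forall>z v. (\<forall>j. z $ j \<noteq> 0 \<and> cmod (z $ j) < \<epsilon>) \<longrightarrow> aligned v \<longrightarrow>
    \<delta> * monom_size A z \<le> defect c A z v"
proof (rule ccontr)
  assume neg: "\<not> ?thesis"
  have finA: "finite A" unfolding A_def by (rule finite_low_exps)
  have axisA: "axis_exp (N j) j \<in> A" for j using N[of j] by (auto simp: A_def low_exps_def axis_exp_def)
  have "\<exists>z v. (\<forall>j. z $ j \<noteq> 0 \<and> cmod (z $ j) < 1 / real (Suc m)) \<and> aligned v \<and>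
      defect c A z v < 1 / real (Suc m) * monom_size A z" for m
  proof -
    have pos: "1 / real (Suc m) > 0" by simp
    from neg have "\<not> (\<forall>z v. (\<forall>j. z $ j \<noteq> 0 \<and> cmod (z $ j) < 1 / real (Suc m)) \<longrightarrow> aligned v \<longrightarrow>
      1 / real (Suc m) * monom_size A z \<le> defect c A z v)" using pos by blast
    then show ?thesis by (meson not_le)
  qed
  then obtain z0 v0 where z0: "\<And>m j. z0 m $ j \<noteq> 0 \<and> cmod (z0 m $ j) < 1 / real (Suc m)"
    and v0: "\<And>m. aligned (v0 m)"
    and df0: "\<And>m. defect c A (z0 m) (v0 m) < 1 / real (Suc m) * monom_size A (z0 m)" by metis
  have M0: "monom_size A (z0 m) > 0" for m
  proof -
    have "0 < cmod (z0 m $ j) ^ N j" for j using z0 by simp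
    also have "\<dots> j \<le> monom_size A (z0 m)" for j by (rule monom_size_axis[OF finA axisA])
    finally show ?thesis .
  qed
  \<comment> \<open>Normalisation makes the moduli sum to 1, so a limit exists along a subsequence
    and is not identically zero.\<close>
  define y0 where "y0 m \<nu> = monom (z0 m) \<nu> / of_real (monom_size A (z0 m))" for m \<nu>
  have "bounded (range (\<lambda>m. y0 m \<nu>))" if "\<nu> \<in> A" for \<nu>
  proof -
    have "cmod (monom (z0 m) \<nu>) \<le> monom_size A (z0 m)" for m
      unfolding monom_size_def using that finA by (intro member_le_sum) auto
    then have "norm (y0 m \<nu>) \<le> 1" for m using M0[of m] by (simp add: y0_def norm_divide)
    then show ?thesis unfolding bounded_iff by blast
  qed
  then obtain s1 Y where s1: "strict_mono (s1 :: nat \<Rightarrow> nat)" and Y1: "\<And>\<nu>. \<nu> \<in> A \<Longrightarrow> (\<lambda>m. y0 (s1 m) \<nu>) \<longlonglongrightarrow> Y \<nu>"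
    using finite_convergent_subsequence[OF finA] by metis
  have "bounded (range (\<lambda>m. sgn (z0 (s1 m) $ j)))" for j
    unfolding bounded_iff by (rule exI[of _ 1]) (auto simp: norm_sgn)
  then obtain s2 \<Theta> where s2: "strict_mono (s2 :: nat \<Rightarrow> nat)"
    and T2: "\<And>j. (\<lambda>m. sgn (z0 (s1 (s2 m)) $ j)) \<longlonglongrightarrow> \<Theta> j"
    using finite_convergent_subsequence[of UNIV "\<lambda>m j. sgn (z0 (s1 m) $ j)"] by (metis UNIV_I finite_class.finite_UNIV)
  define s where "s = s1 \<circ> s2"
  have sm: "strict_mono s" unfolding s_def by (rule strict_mono_o[OF s1 s2])
  define z where "z m = z0 (s m)" for m
  define v where "v m = v0 (s m)" for m
  define M where "M m = monom_size A (z m)" for m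
  define y where "y m \<nu> = monom (z m) \<nu> / of_real (M m)" for m \<nu>
  define \<theta> where "\<theta> m j = sgn (z m $ j)" for m j
  have M: "M m > 0" for m using M0 by (simp add: M_def z_def)
  have znz: "z m $ j \<noteq> 0" for m j using z0 by (simp add: z_def)
  have Y: "(\<lambda>m. y m \<nu>) \<longlonglongrightarrow> Y \<nu>" if "\<nu> \<in> A" for \<nu>
    using LIMSEQ_subseq_LIMSEQ[OF Y1[OF that] s2] by (simp add: o_def y_def y0_def M_def z_def s_def)
  have \<Theta>: "(\<lambda>m. \<theta> m j) \<longlonglongrightarrow> \<Theta> j" for j using T2[of j] by (simp add: \<theta>_def z_def s_def)
  have inv0: "(\<lambda>m. 1 / real (Suc (s m))) \<longlonglongrightarrow> 0"
    using LIMSEQ_subseq_LIMSEQ[OF LIMSEQ_inverse_real_of_nat sm] by (simp add: o_def inverse_eq_divide)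
  have zlim: "(\<lambda>m. cmod (z m $ j)) \<longlonglongrightarrow> 0" for j
    by (rule tendsto_sandwich[OF _ _ tendsto_const inv0]) (use z0 in \<open>auto simp: z_def intro!: always_eventually less_imp_le\<close>)
  have dfn: "0 \<le> defect c A (z m) (v m) / M m" for m
    using M[of m] by (simp add: defect_def sum_nonneg)
  have dlim: "(\<lambda>m. defect c A (z m) (v m) / M m) \<longlonglongrightarrow> 0"
  proof (rule tendsto_sandwich[OF _ _ tendsto_const inv0])
    have "defect c A (z m) (v m) / M m \<le> 1 / real (Suc (s m))" for m
      using df0[of "s m"] M[of m] by (simp add: M_def z_def v_def pos_divide_le_eq less_imp_le)
    then show "\<forall>\<^sub>F m in sequentially. defect c A (z m) (v m) / M m \<le> 1 / real (Suc (s m))" by simp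
  qed (use dfn in simp)
  have "(\<Sum>\<nu>\<in>A. cmod (y m \<nu>)) = 1" for m
    using M[of m] by (simp add: y_def norm_divide flip: sum_divide_distrib) (simp add: M_def monom_size_def)
  moreover have "(\<lambda>m. \<Sum>\<nu>\<in>A. cmod (y m \<nu>)) \<longlonglongrightarrow> (\<Sum>\<nu>\<in>A. cmod (Y \<nu>))"
    by (intro tendsto_sum tendsto_norm Y)
  ultimately have Y1: "(\<Sum>\<nu>\<in>A. cmod (Y \<nu>)) = 1" by (simp add: LIMSEQ_const_iff)
  define \<Delta> where "\<Delta> = {\<nu> \<in> A. Y \<nu> \<noteq> 0}"
  have "\<exists>\<nu>\<in>A. Y \<nu> \<noteq> 0"
  proof (rule ccontr)
    assume "\<not> ?thesis"
    then have "(\<Sum>\<nu>\<in>A. cmod (Y \<nu>)) = 0" by (intro sum.neutral) auto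
    then show False using Y1 by simp
  qed
  then obtain \<nu>0 where n0: "\<nu>0 \<in> A" "Y \<nu>0 \<noteq> 0" by blast
  have DA: "\<Delta> \<subseteq> A" by (auto simp: \<Delta>_def)
  define l where "l m j = - ln (cmod (z m $ j))" for m j
  have zpol: "z m $ j = \<theta> m j * of_real (exp (- l m j))" for m j
    using znz[of m j] by (simp add: \<theta>_def l_def sgn_div_norm scaleR_conv_of_real)
  have th1: "cmod (\<theta> m j) = 1" for m j using znz[of m j] by (simp add: \<theta>_def norm_sgn)
  have monom_mod: "cmod (monom (z m) \<nu>) = exp (- (\<Sum>j\<in>UNIV. real (\<nu> j) * l m j))" for m \<nu>
    unfolding monom_polar[OF zpol] by (simp add: norm_mult norm_power th1 flip: prod_norm)
  have ln_y: "ln (cmod (y m \<nu>)) = - (\<Sum>j\<in>UNIV. real (\<nu> j) * l m j) - ln (M m)" for m \<nu>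
    using M[of m] by (simp add: y_def norm_divide monom_mod ln_div)
  have ypos: "cmod (y m \<nu>) > 0" for m \<nu> using M[of m] monom_nonzero[of "z m" \<nu>] znz by (simp add: y_def)
  \<comment> \<open>The pairing of \<open>\<nu> - \<nu>0\<close> with the logarithms is a log ratio
    of normalised monomials, in which the unknown scale \<open>M m\<close> cancels. It stays bounded
    where the limit is nonzero and tends to infinity where it vanishes.\<close>
  have d_eq: "(\<Sum>j\<in>UNIV. (real (\<nu> j) - real (\<nu>0 j)) * l m j) = ln (cmod (y m \<nu>0)) - ln (cmod (y m \<nu>))" for m \<nu>
    unfolding ln_y by (simp add: left_diff_distrib sum_subtractf)
  have lim0: "(\<lambda>m. ln (cmod (y m \<nu>0))) \<longlonglongrightarrow> ln (cmod (Y \<nu>0))"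
    using n0 by (intro tendsto_ln tendsto_norm Y) auto
  have bdd: "bounded (range (\<lambda>m. \<Sum>j\<in>UNIV. (real (\<nu> j) - real (\<nu>0 j)) * l m j))" if "\<nu> \<in> \<Delta>" for \<nu>
  proof -
    have "(\<lambda>m. ln (cmod (y m \<nu>))) \<longlonglongrightarrow> ln (cmod (Y \<nu>))"
      using that by (intro tendsto_ln tendsto_norm Y) (auto simp: \<Delta>_def)
    then have "(\<lambda>m. ln (cmod (y m \<nu>0)) - ln (cmod (y m \<nu>))) \<longlonglongrightarrow> ln (cmod (Y \<nu>0)) - ln (cmod (Y \<nu>))"
      by (intro tendsto_diff lim0)
    then show ?thesis unfolding d_eq by (rule convergent_imp_bounded)
  qed
  have ln_bot: "filterlim (\<lambda>m. - ln (x m)) at_top sequentially"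
    if "x \<longlonglongrightarrow> 0" "\<And>m. x m > 0" for x :: "nat \<Rightarrow> real"
  proof -
    have "filterlim x (at_right 0) sequentially" using that by (intro tendsto_imp_filterlim_at_right) auto
    then have "filterlim (\<lambda>m. ln (x m)) at_bot sequentially" by (rule filterlim_compose[OF ln_at_0])
    then show ?thesis by (simp add: filterlim_uminus_at_bot)
  qed
  have inf: "filterlim (\<lambda>m. \<Sum>j\<in>UNIV. (real (\<nu> j) - real (\<nu>0 j)) * l m j) at_top sequentially" if "\<nu> \<in> A - \<Delta>" for \<nu>
  proof -
    have "(\<lambda>m. cmod (y m \<nu>)) \<longlonglongrightarrow> 0" using tendsto_norm[OF Y[of \<nu>]] that by (auto simp: \<Delta>_def)
    then have "filterlim (\<lambda>m. - ln (cmod (y m \<nu>))) at_top sequentially" using ypos by (rule ln_bot)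
    from filterlim_tendsto_add_at_top[OF lim0 this] show ?thesis unfolding d_eq by simp
  qed
  have linf: "filterlim (\<lambda>m. l m j) at_top sequentially" for j
    unfolding l_def using zlim znz by (intro ln_bot) auto
  obtain P :: "'n \<Rightarrow> nat" where P: "\<And>j. P j > 0"
    and Peq: "\<And>\<nu>. \<nu> \<in> \<Delta> \<Longrightarrow> (\<Sum>j\<in>UNIV. P j * \<nu> j) = (\<Sum>j\<in>UNIV. P j * \<nu>0 j)"
    and Pgt: "\<And>\<nu>. \<nu> \<in> A - \<Delta> \<Longrightarrow> (\<Sum>j\<in>UNIV. P j * \<nu> j) > (\<Sum>j\<in>UNIV. P j * \<nu>0 j)"
    using integral_weight[OF finA DA bdd inf linf] by blast
  have face: "face_exps c P = \<Delta>"
  proof (rule face_exps_eq)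
    show "\<Delta> \<subseteq> supp c" using DA by (auto simp: A_def low_exps_def)
    show "\<nu>0 \<in> \<Delta>" using n0 by (simp add: \<Delta>_def)
    show "\<And>\<nu>. \<nu> \<in> \<Delta> \<Longrightarrow> (\<Sum>j\<in>UNIV. P j * \<nu> j) = (\<Sum>j\<in>UNIV. P j * \<nu>0 j)" by (rule Peq)
    fix \<nu> assume n: "\<nu> \<in> supp c - \<Delta>"
    show "(\<Sum>j\<in>UNIV. P j * \<nu> j) > (\<Sum>j\<in>UNIV. P j * \<nu>0 j)"
    proof (cases "\<nu> \<in> A")
      case False
      then obtain j where j: "\<nu> j > N j" using n by (auto simp: A_def low_exps_def not_le)
      \<comment> \<open>An exponent outside the box exceeds some \<open>N j\<close>, so its weight
        is greater than that of the pure power \<open>axis_exp (N j) j\<close>, which lies in the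
        box and already has at least the minimal weight.\<close>
      have "(\<Sum>i\<in>UNIV. P i * \<nu>0 i) \<le> (\<Sum>i\<in>UNIV. P i * axis_exp (N j) j i)"
        using Peq[of "axis_exp (N j) j"] Pgt[of "axis_exp (N j) j"] axisA[of j] by (cases "axis_exp (N j) j \<in> \<Delta>") auto
      also have "\<dots> = P j * N j" by (simp add: axis_exp_def if_distrib cong: if_cong)
      also have "\<dots> < P j * \<nu> j" using j P[of j] by simp
      also have "\<dots> \<le> (\<Sum>i\<in>UNIV. P i * \<nu> i)" by (rule member_le_sum) auto
      finally show ?thesis .
    qed (use Pgt n in auto)
  qed
  define D where "D = (\<lambda>\<nu>. nuvec \<nu> - nuvec \<nu>0) ` \<Delta>"
  define lv where "lv m = (\<chi> j. l m j)" for m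
  have finD: "finite D" unfolding D_def using DA finA by (auto intro: finite_subset)
  have in_d: "(nuvec \<nu> - nuvec \<nu>0) \<bullet> x = (\<Sum>j\<in>UNIV. (real (\<nu> j) - real (\<nu>0 j)) * x $ j)" for \<nu> and x :: "real^'n"
    by (simp add: inner_vec_def nuvec_def)
  have "bounded (range (\<lambda>m. x \<bullet> lv m))" if "x \<in> D" for x
    using that bdd unfolding D_def by (auto simp: in_d lv_def)
  then obtain b where b: "bounded (range b)" and bD: "\<And>x m. x \<in> D \<Longrightarrow> x \<bullet> b m = x \<bullet> lv m"
    using bounded_lift[OF finD] by blast
  obtain \<beta> s3 where s3: "strict_mono (s3 :: nat \<Rightarrow> nat)" and \<beta>: "(b \<circ> s3) \<longlonglongrightarrow> \<beta>"
    using bounded_imp_convergent_subsequence[OF b] by blast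
  \<comment> \<open>The phases of \<open>z m\<close> with bounded replacements for the logarithms of
    its moduli. Its limit \<open>U\<close> has no zero coordinate, whereas \<open>z m\<close> itself
    tends to 0.\<close>
  define u where "u m = (\<chi> j. \<theta> m j * of_real (exp (- b m $ j)))" for m
  define U where "U = (\<chi> j. \<Theta> j * of_real (exp (- \<beta> $ j)))"
  have upol: "u m $ j = \<theta> m j * of_real (exp (- b m $ j))" for m j by (simp add: u_def)
  have Th1: "cmod (\<Theta> j) = 1" for j
    using tendsto_norm[OF \<Theta>[of j]] by (simp add: th1 LIMSEQ_const_iff)
  have Unz: "U $ j \<noteq> 0" for j using Th1[of j] by (auto simp: U_def)
  have ulim: "(\<lambda>m. u (s3 m) $ j) \<longlonglongrightarrow> U $ j" for j
    unfolding u_def U_def vec_lambda_beta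
    using LIMSEQ_subseq_LIMSEQ[OF \<Theta>[of j] s3] tendsto_vec_nth[OF \<beta>, of j]
    by (intro tendsto_mult tendsto_of_real tendsto_exp tendsto_minus) (auto simp: o_def)
  \<comment> \<open>\<open>b m\<close> and \<open>l m\<close> have equal pairings with differences
    of exponents in \<open>\<Delta>\<close>; hence \<open>u m\<close> and \<open>z m\<close> have
    the same ratios of monomials there.\<close>
  have cross: "y m \<nu> * monom (u m) \<nu>0 = y m \<nu>0 * monom (u m) \<nu>" if "\<nu> \<in> \<Delta>" for m \<nu>
  proof -
    have "(\<Sum>j\<in>UNIV. (real (\<nu> j) - real (\<nu>0 j)) * b m $ j) = (\<Sum>j\<in>UNIV. (real (\<nu> j) - real (\<nu>0 j)) * l m j)"
      using bD[of "nuvec \<nu> - nuvec \<nu>0" m] that unfolding in_d D_def by (simp add: lv_def)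
    then have "(\<Sum>j\<in>UNIV. real (\<nu> j) * l m j) + (\<Sum>j\<in>UNIV. real (\<nu>0 j) * b m $ j) =
        (\<Sum>j\<in>UNIV. real (\<nu>0 j) * l m j) + (\<Sum>j\<in>UNIV. real (\<nu> j) * b m $ j)"
      by (simp add: left_diff_distrib sum_subtractf)
    then have "exp (- (\<Sum>j\<in>UNIV. real (\<nu> j) * l m j)) * exp (- (\<Sum>j\<in>UNIV. real (\<nu>0 j) * b m $ j)) =
        exp (- (\<Sum>j\<in>UNIV. real (\<nu>0 j) * l m j)) * exp (- (\<Sum>j\<in>UNIV. real (\<nu> j) * b m $ j))"
      unfolding exp_add[symmetric] by simp
    then have "monom (z m) \<nu> * monom (u m) \<nu>0 = monom (z m) \<nu>0 * monom (u m) \<nu>"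
      unfolding monom_polar[OF zpol] monom_polar[OF upol]
      by (simp add: mult_ac flip: of_real_mult)
    then show ?thesis by (simp add: y_def)
  qed
  \<comment> \<open>In the limit, the monomials of \<open>U\<close> on the face are one common
    multiple of the limits \<open>Y\<close>. Identities for \<open>Y\<close> therefore become
    identities for the face function at \<open>U\<close>.\<close>
  have U: "monom U \<nu> = monom U \<nu>0 / Y \<nu>0 * Y \<nu>" if "\<nu> \<in> \<Delta>" for \<nu>
  proof -
    have yl: "(\<lambda>m. y (s3 m) \<mu>) \<longlonglongrightarrow> Y \<mu>" if "\<mu> \<in> A" for \<mu>
      using LIMSEQ_subseq_LIMSEQ[OF Y[OF that] s3] by (simp add: o_def)
    have "(\<lambda>m. y (s3 m) \<nu> * monom (u (s3 m)) \<nu>0) \<longlonglongrightarrow> Y \<nu> * monom U \<nu>0"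
      using that DA by (intro tendsto_mult yl tendsto_monom ulim) auto
    moreover have "(\<lambda>m. y (s3 m) \<nu>0 * monom (u (s3 m)) \<nu>) \<longlonglongrightarrow> Y \<nu>0 * monom U \<nu>"
      using n0 by (intro tendsto_mult yl tendsto_monom ulim) auto
    ultimately have "Y \<nu> * monom U \<nu>0 = Y \<nu>0 * monom U \<nu>"
      unfolding cross[OF that] by (rule LIMSEQ_unique)
    then show ?thesis using n0 by (simp add: field_simps)
  qed
  define H where "H j = (\<Sum>\<nu>\<in>A. of_nat (\<nu> j) * (c \<nu> * Y \<nu>))" for j
  have lowE: "low_euler c A (z m) j / of_real (M m) = (\<Sum>\<nu>\<in>A. of_nat (\<nu> j) * (c \<nu> * y m \<nu>))" for m j
    by (simp add: low_euler_def y_def sum_divide_distrib)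
  have lowF: "low_poly c A (z m) / of_real (M m) = (\<Sum>\<nu>\<in>A. c \<nu> * y m \<nu>)" for m
    by (simp add: low_poly_def y_def sum_divide_distrib)
  have cY: "(\<Sum>\<nu>\<in>A. c \<nu> * Y \<nu>) = 0"
  proof -
    have "norm (low_poly c A (z m) / of_real (M m)) \<le> defect c A (z m) (v m) / M m" for m
      using M[of m] by (simp add: norm_divide defect_def divide_right_mono sum_nonneg)
    then have "(\<lambda>m. low_poly c A (z m) / of_real (M m)) \<longlonglongrightarrow> 0"
      by (intro Lim_null_comparison[OF _ dlim]) auto
    moreover have "(\<lambda>m. low_poly c A (z m) / of_real (M m)) \<longlonglongrightarrow> (\<Sum>\<nu>\<in>A. c \<nu> * Y \<nu>)"
      unfolding lowF by (intro tendsto_sum tendsto_mult tendsto_const Y)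
    ultimately show ?thesis using LIMSEQ_unique by blast
  qed
  have vlim: "(\<lambda>m. v m j / of_real (M m)) \<longlonglongrightarrow> H j" for j
  proof -
    have "norm (low_euler c A (z m) j / of_real (M m) - v m j / of_real (M m)) \<le> defect c A (z m) (v m) / M m" for m
    proof -
      have "cmod (low_euler c A (z m) j - v m j) \<le> (\<Sum>j\<in>UNIV. cmod (low_euler c A (z m) j - v m j))"
        by (rule member_le_sum) auto
      also have "\<dots> \<le> defect c A (z m) (v m)" by (simp add: defect_def)
      finally show ?thesis using M[of m]
        by (simp add: norm_divide divide_right_mono flip: diff_divide_distrib)
    qed
    then have "(\<lambda>m. low_euler c A (z m) j / of_real (M m) - v m j / of_real (M m)) \<longlonglongrightarrow> 0"
      by (intro Lim_null_comparison[OF _ dlim]) auto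
    moreover have "(\<lambda>m. low_euler c A (z m) j / of_real (M m)) \<longlonglongrightarrow> H j"
      unfolding lowE H_def by (intro tendsto_sum tendsto_mult tendsto_const Y)
    ultimately have "(\<lambda>m. low_euler c A (z m) j / of_real (M m) -
        (low_euler c A (z m) j / of_real (M m) - v m j / of_real (M m))) \<longlonglongrightarrow> H j - 0"
      by (intro tendsto_diff)
    then show ?thesis by simp
  qed
  \<comment> \<open>The inequality defining \<open>aligned\<close> is invariant under scaling by
    \<open>M m\<close> and passes to the limit for the weight \<open>P\<close> just found.\<close>
  have "(\<Sum>j\<in>UNIV. cmod (H j)) \<le> cmod (\<Sum>j\<in>UNIV. of_nat (P j) * H j)"
  proof (rule tendsto_le)
    show "(\<lambda>m. cmod (\<Sum>j\<in>UNIV. of_nat (P j) * (v m j / of_real (M m)))) \<longlonglongrightarrow> cmod (\<Sum>j\<in>UNIV. of_nat (P j) * H j)"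
      by (intro tendsto_norm tendsto_sum tendsto_mult tendsto_const vlim)
    show "(\<lambda>m. \<Sum>j\<in>UNIV. cmod (v m j / of_real (M m))) \<longlonglongrightarrow> (\<Sum>j\<in>UNIV. cmod (H j))"
      by (intro tendsto_sum tendsto_norm vlim)
    have "(\<Sum>j\<in>UNIV. cmod (v m j / of_real (M m))) \<le> cmod (\<Sum>j\<in>UNIV. of_nat (P j) * (v m j / of_real (M m)))" for m
    proof -
      have "(\<Sum>j\<in>UNIV. cmod (v m j)) \<le> cmod (\<Sum>j\<in>UNIV. of_nat (P j) * v m j)"
        using v0[of "s m"] P unfolding aligned_def v_def by blast
      then show ?thesis using M[of m]
        by (simp add: norm_divide divide_right_mono flip: sum_divide_distrib)
    qed
    then show "\<forall>\<^sub>F m in sequentially. (\<Sum>j\<in>UNIV. cmod (v m j / of_real (M m))) \<le> cmod (\<Sum>j\<in>UNIV. of_nat (P j) * (v m j / of_real (M m)))"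
      by simp
  qed simp
  also have "(\<Sum>j\<in>UNIV. of_nat (P j) * H j) = (\<Sum>\<nu>\<in>A. of_nat (\<Sum>j\<in>UNIV. P j * \<nu> j) * (c \<nu> * Y \<nu>))"
    unfolding H_def sum_distrib_left by (subst sum.swap) (simp add: sum_distrib_right mult.assoc)
  \<comment> \<open>Euler relation: on the face the weight is constant, and off the face
    \<open>Y \<nu>\<close> is zero. The constant comes out of the sum, leaving the limit of the
    truncated function, which is 0.\<close>
  also have "\<dots> = (\<Sum>\<nu>\<in>A. of_nat (\<Sum>j\<in>UNIV. P j * \<nu>0 j) * (c \<nu> * Y \<nu>))"
  proof (rule sum.cong[OF refl])
    fix \<nu> assume "\<nu> \<in> A"
    then show "of_nat (\<Sum>j\<in>UNIV. P j * \<nu> j) * (c \<nu> * Y \<nu>) = of_nat (\<Sum>j\<in>UNIV. P j * \<nu>0 j) * (c \<nu> * Y \<nu>)"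
      using Peq[of \<nu>] by (cases "Y \<nu> = 0") (simp_all only: \<Delta>_def mem_Collect_eq, auto)
  qed
  also have "\<dots> = 0" unfolding sum_distrib_left[symmetric] cY by simp
  finally have "(\<Sum>j\<in>UNIV. cmod (H j)) = 0" by (simp add: sum_nonneg antisym)
  then have H0: "H j = 0" for j by (subst (asm) sum_nonneg_eq_0_iff) auto
  have sumD: "(\<Sum>\<nu>\<in>\<Delta>. g \<nu> * (c \<nu> * monom U \<nu>)) = monom U \<nu>0 / Y \<nu>0 * (\<Sum>\<nu>\<in>A. g \<nu> * (c \<nu> * Y \<nu>))" for g
  proof -
    have "(\<Sum>\<nu>\<in>A. g \<nu> * (c \<nu> * Y \<nu>)) = (\<Sum>\<nu>\<in>\<Delta>. g \<nu> * (c \<nu> * Y \<nu>))"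
      by (rule sum.mono_neutral_right[OF finA DA]) (auto simp: \<Delta>_def)
    then show ?thesis by (simp add: sum_distrib_left U mult_ac)
  qed
  have "face_fun c P U = 0"
    using sumD[of "\<lambda>_. 1"] cY by (simp add: face_fun_def face)
  moreover have "partial_zero (face_fun c P) j U" for j
  proof (rule partial_zero_face_fun)
    show "finite (face_exps c P)" unfolding face using DA finA finite_subset by blast
    show "U $ j \<noteq> 0" by (rule Unz)
    show "(\<Sum>\<nu>\<in>face_exps c P. of_nat (\<nu> j) * (c \<nu> * monom U \<nu>)) = 0"
      unfolding face sumD using H0[of j] by (simp add: H_def)
  qed
  ultimately show False using nondeg P Unz unfolding non_degenerate_def by blast
qed

section \<open>Composition with the mixed covering\<close>

lemma aligned_scale:
  assumes "k \<noteq> 0"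
  shows "aligned (\<lambda>j. k * v j) \<longleftrightarrow> aligned v"
proof -
  have "(\<Sum>j\<in>UNIV. cmod (k * v j)) = cmod k * (\<Sum>j\<in>UNIV. cmod (v j))"
    by (simp add: norm_mult sum_distrib_left)
  moreover have "cmod (\<Sum>j\<in>UNIV. of_nat (P j) * (k * v j)) = cmod k * cmod (\<Sum>j\<in>UNIV. of_nat (P j) * v j)" for P
    unfolding norm_mult[symmetric] by (simp add: sum_distrib_left mult_ac)
  ultimately show ?thesis using assms by (simp add: aligned_def)
qed

text \<open>Zero coordinates are replaced by small positive ones tending to 0. Both sides are
  continuous in \<open>z\<close>; \<open>v\<close> is kept fixed, so its alignment is not
  disturbed.\<close>

lemma lower_bound_closure:
  fixes c :: "('n::finite \<Rightarrow> nat) \<Rightarrow> complex"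
  assumes bound: "\<And>z. (\<forall>j. z $ j \<noteq> 0 \<and> cmod (z $ j) < \<epsilon>) \<Longrightarrow> \<delta> * monom_size A z \<le> defect c A z v"
    and z: "\<And>j. cmod (z $ j) < \<epsilon>"
  shows "\<delta> * monom_size A z \<le> defect c A z v"
proof -
  have \<epsilon>: "\<epsilon> > 0" using z[of undefined] by (smt (verit) norm_ge_zero)
  define zk :: "nat \<Rightarrow> complex^'n" where
    "zk k = (\<chi> j. if z $ j = 0 then of_real (\<epsilon> / 2 * inverse (real (Suc k))) else z $ j)" for k
  have "(\<lambda>k. zk k $ j) \<longlonglongrightarrow> z $ j" for j
  proof (cases "z $ j = 0")
    case True
    have "(\<lambda>k. complex_of_real (\<epsilon> / 2 * inverse (real (Suc k)))) \<longlonglongrightarrow> of_real (\<epsilon> / 2 * 0)"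
      by (intro tendsto_of_real tendsto_mult tendsto_const LIMSEQ_inverse_real_of_nat)
    then show ?thesis using True by (simp add: zk_def)
  qed (simp add: zk_def)
  then have lim: "(\<lambda>k. monom (zk k) \<nu>) \<longlonglongrightarrow> monom z \<nu>" for \<nu> by (rule tendsto_monom)
  have "zk k $ j \<noteq> 0 \<and> cmod (zk k $ j) < \<epsilon>" for k j
  proof -
    have "\<epsilon> / 2 * inverse (real (Suc k)) \<le> \<epsilon> / 2 * 1" using \<epsilon> by (intro mult_left_mono) (auto simp: field_simps)
    moreover have "0 < \<epsilon> / 2 * inverse (real (Suc k))" using \<epsilon> by simp
    ultimately show ?thesis using z[of j] \<epsilon> by (auto simp: zk_def norm_mult norm_divide simp del: of_real_mult)
  qed
  then have "\<delta> * monom_size A (zk k) \<le> defect c A (zk k) v" for k by (intro bound) blast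
  moreover have "(\<lambda>k. \<delta> * monom_size A (zk k)) \<longlonglongrightarrow> \<delta> * monom_size A z"
    unfolding monom_size_def by (intro tendsto_mult tendsto_const tendsto_sum tendsto_norm lim)
  moreover have "(\<lambda>k. defect c A (zk k) v) \<longlonglongrightarrow> defect c A z v"
    unfolding defect_def low_poly_def low_euler_def
    by (intro tendsto_add tendsto_norm tendsto_sum tendsto_diff tendsto_mult tendsto_const lim)
  ultimately show ?thesis by (intro LIMSEQ_le) auto
qed

text \<open>At a zero of \<open>f\<close> the exact Euler vector has defect at most one tail for the
  function and one for each coordinate. If it were aligned, the lower bound of order
  \<open>monom_size\<close> would contradict this for small \<open>norm z\<close>.\<close>

lemma euler_vector_not_aligned:
  fixes c :: "('n::finite \<Rightarrow> nat) \<Rightarrow> complex" and f :: "complex^'n \<Rightarrow> complex"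
  assumes holo: "holo_germ c f" and conv: "convenient c" and nondeg: "non_degenerate c"
  obtains \<epsilon> pd where "\<epsilon> > 0"
    "\<forall>z\<in>ball 0 \<epsilon>. (f has_derivative (\<lambda>h. \<Sum>j\<in>UNIV. pd z j * h $ j)) (at z)"
    "\<forall>z\<in>ball 0 \<epsilon>. z \<noteq> 0 \<longrightarrow> f z = 0 \<longrightarrow> \<not> aligned (\<lambda>j. z $ j * pd z j)"
proof -
  obtain r pd where r: "0 < r" "r < 1" and S: "(\<lambda>\<nu>. cmod (c \<nu>) * (2 * r) ^ mdeg \<nu>) summable_on UNIV"
    and fs: "\<forall>z\<in>ball 0 r. ((\<lambda>\<nu>. c \<nu> * monom z \<nu>) has_sum f z) UNIV"
    and fd: "\<forall>z\<in>ball 0 r. (f has_derivative (\<lambda>h. \<Sum>j\<in>UNIV. pd z j * h $ j)) (at z)"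
    and fe: "\<forall>z\<in>ball 0 r. \<forall>j. ((\<lambda>\<nu>. of_nat (\<nu> j) * (c \<nu> * monom z \<nu>)) has_sum (z $ j * pd z j)) UNIV"
    by (rule holo_germ_expansion[OF holo])
  have "\<exists>N. axis_exp N j \<in> supp c" for j using convenient_axis_exponent[OF conv] by metis
  then obtain N where N: "\<And>j. axis_exp (N j) j \<in> supp c" by metis
  let ?A = "low_exps c N"
  have axisA: "axis_exp (N j) j \<in> ?A" for j using N[of j] by (auto simp: low_exps_def axis_exp_def)
  obtain K where K: "K > 0" and tail: "\<And>z w p. z \<in> ball 0 r \<Longrightarrow> (\<And>\<nu>. p \<nu> \<le> mdeg \<nu> + 1) \<Longrightarrow>
       ((\<lambda>\<nu>. of_nat (p \<nu>) * (c \<nu> * monom z \<nu>)) has_sum w) UNIV \<Longrightarrow>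
       cmod (w - (\<Sum>\<nu>\<in>?A. of_nat (p \<nu>) * (c \<nu> * monom z \<nu>))) \<le> K * norm z * monom_size ?A z"
    using tail_estimate[OF r S N] by blast
  obtain \<delta> \<epsilon>1 where \<delta>: "\<delta> > 0" and \<epsilon>1: "\<epsilon>1 > 0"
    and bound: "\<forall>z v. (\<forall>j. z $ j \<noteq> 0 \<and> cmod (z $ j) < \<epsilon>1) \<longrightarrow> aligned v \<longrightarrow> \<delta> * monom_size ?A z \<le> defect c ?A z v"
    using torus_lower_bound[OF nondeg N] by blast
  \<comment> \<open>The number of tail terms in \<open>defect\<close>: one for the function and one
    per Euler component.\<close>
  define n1 where "n1 = real CARD('n) + 1"
  have n1: "n1 > 0" by (simp add: n1_def)
  define \<epsilon> where "\<epsilon> = min r (min \<epsilon>1 (\<delta> / (n1 * K)))"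
  have \<epsilon>: "\<epsilon> > 0" using r \<epsilon>1 \<delta> K n1 by (simp add: \<epsilon>_def)
  have "\<not> aligned (\<lambda>j. z $ j * pd z j)" if z: "z \<in> ball 0 \<epsilon>" "z \<noteq> 0" "f z = 0" for z
  proof
    define v where "v = (\<lambda>j. z $ j * pd z j)"
    assume "aligned (\<lambda>j. z $ j * pd z j)"
    then have al: "aligned v" by (simp add: v_def)
    have zr: "z \<in> ball 0 r" using z(1) by (simp add: \<epsilon>_def)
    let ?M = "monom_size ?A z" and ?B = "K * norm z * monom_size ?A z"
    obtain i where "z $ i \<noteq> 0" using z(2) by (auto simp: vec_eq_iff)
    then have "0 < cmod (z $ i) ^ N i" by simp
    also have "\<dots> \<le> ?M" by (rule monom_size_axis[OF finite_low_exps axisA])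
    finally have M: "?M > 0" .
    have "\<delta> * ?M \<le> defect c ?A z v"
    proof (rule lower_bound_closure[of \<epsilon>1])
      show "cmod (z $ j) < \<epsilon>1" for j
        using z(1) Finite_Cartesian_Product.norm_nth_le[of z j] by (simp add: \<epsilon>_def)
    qed (simp add: bound[rule_format] al)
    also have "\<dots> \<le> ?B + (\<Sum>j\<in>(UNIV :: 'n set). ?B)"
      unfolding defect_def
    proof (intro add_mono sum_mono)
      show "cmod (low_poly c ?A z) \<le> ?B"
        using tail[OF zr, of "\<lambda>_. 1" "f z"] bspec[OF fs zr] z(3) by (simp add: low_poly_def)
      fix j
      have dg: "\<nu> j \<le> mdeg \<nu> + 1" for \<nu> :: "'n \<Rightarrow> nat" using mdeg_split[of \<nu> j] by simp
      have "((\<lambda>\<nu>. of_nat (\<nu> j) * (c \<nu> * monom z \<nu>)) has_sum (z $ j * pd z j)) UNIV" using fe zr by blast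
      from tail[where p="\<lambda>\<nu>. \<nu> j", OF zr dg this]
      have "cmod (v j - low_euler c ?A z j) \<le> ?B" unfolding v_def low_euler_def .
      then show "cmod (low_euler c ?A z j - v j) \<le> ?B" by (simp add: norm_minus_commute)
    qed
    also have "\<dots> = n1 * K * norm z * ?M" by (simp add: n1_def algebra_simps)
    finally have "\<delta> \<le> n1 * K * norm z" using M by simp
    moreover have "norm z < \<delta> / (n1 * K)" using z(1) by (simp add: \<epsilon>_def)
    then have "n1 * K * norm z < \<delta>" using n1 K by (simp add: field_simps)
    ultimately show False by simp
  qed
  then show thesis using that[OF \<epsilon>, of pd] fd by (auto simp: \<epsilon>_def)
qed

section \<open>The differential of the composite in polar form\<close>

lemma linear_axis: "linear (axis j :: complex \<Rightarrow> complex^'n::finite)"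
  by (rule linearI) (auto simp: axis_def vec_eq_iff)

lemma has_derivative_vec_lambda:
  fixes F :: "'n::finite \<Rightarrow> 'a::real_normed_vector \<Rightarrow> complex"
  assumes "\<And>j. (F j has_derivative F' j) (at x)"
  shows "((\<lambda>x. \<chi> j. F j x) has_derivative (\<lambda>h. \<chi> j. F' j h)) (at x)"
proof -
  have ax: "(\<chi> j. G j) = (\<Sum>j\<in>UNIV. axis j (G j))" for G :: "'n \<Rightarrow> complex"
    by (auto simp: vec_eq_iff axis_def if_distrib cong: if_cong)
  have bl: "bounded_linear (axis j :: complex \<Rightarrow> complex^'n)" for j
    using linear_axis linear_conv_bounded_linear by blast
  show ?thesis unfolding ax
    by (rule has_derivative_sum) (rule bounded_linear.has_derivative[OF bl assms])
qed

lemma phi_ab_zero: "a > 0 \<Longrightarrow> phi_ab a b 0 = 0"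
  by (simp add: phi_ab_def vec_eq_iff zero_power)

lemma phi_ab_nonzero: "w \<noteq> 0 \<Longrightarrow> phi_ab a b w \<noteq> 0"
  by (auto simp: phi_ab_def vec_eq_iff)

lemma norm_phi_ab_le:
  fixes w :: "complex^'n::finite"
  assumes "norm w \<le> 1" "a > 0"
  shows "norm (phi_ab a b w) \<le> norm w"
proof -
  have "cmod (phi_ab a b w $ j) \<le> cmod (w $ j)" for j
  proof -
    have w1: "cmod (w $ j) \<le> 1" using Finite_Cartesian_Product.norm_nth_le[of w j] assms by simp
    have "cmod (phi_ab a b w $ j) = cmod (w $ j) ^ (a + b)"
      by (simp add: phi_ab_def norm_mult norm_power power_add)
    also have "\<dots> \<le> cmod (w $ j) ^ 1" using assms(2) w1 by (intro power_decreasing) auto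
    finally show ?thesis by simp
  qed
  then show ?thesis by (intro norm_le_componentwise_cart) auto
qed

text \<open>The factor \<open>t\<close> is made so that \<open>t * cnj e\<close> and
  \<open>t * e\<close> are the powers with one \<open>x\<close>, respectively one
  \<open>cnj x\<close>, removed. At \<open>x = 0\<close> the phase is an arbitrary unit, and both
  sides vanish because \<open>a\<close> and \<open>b\<close> are positive.\<close>

lemma mixed_power_polar:
  fixes x u :: complex
  assumes a: "a > 0" and b: "b > 0"
  defines "e \<equiv> (if x = 0 then 1 else sgn x)" and "t \<equiv> (if x = 0 then 0 else x ^ a * cnj x ^ b / of_real (cmod x))"
  shows "of_nat a * u * x ^ (a - 1) * cnj x ^ b + x ^ a * (of_nat b * cnj u * cnj x ^ (b - 1)) =
    t * (of_nat a * cnj e * u + of_nat b * e * cnj u)"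
proof (cases "x = 0")
  case True
  then show ?thesis using a b by (simp add: t_def zero_power)
next
  case False
  obtain a' b' where ab: "a = Suc a'" "b = Suc b'" using a b by (metis gr0_implies_Suc)
  have sq: "complex_of_real (cmod x) * of_real (cmod x) = x * cnj x"
    using complex_norm_square[of x] by (simp add: power2_eq_square)
  have e: "e = x / of_real (cmod x)" using False by (simp add: e_def sgn_div_norm scaleR_conv_of_real divide_inverse mult.commute)
  have "t * cnj e = x ^ a' * cnj x ^ b * (x * cnj x) / (of_real (cmod x) * of_real (cmod x))"
    using False by (simp add: t_def e ab)
  then have 1: "t * cnj e = x ^ a' * cnj x ^ b" unfolding sq using False by simp
  have "t * e = x ^ a * cnj x ^ b' * (x * cnj x) / (of_real (cmod x) * of_real (cmod x))"
    using False by (simp add: t_def e ab)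
  then have 2: "t * e = x ^ a * cnj x ^ b'" unfolding sq using False by simp
  have "t * (of_nat a * cnj e * u + of_nat b * e * cnj u) = of_nat a * u * (t * cnj e) + of_nat b * cnj u * (t * e)"
    by (simp only: algebra_simps)
  then show ?thesis unfolding 1 2 using ab by (simp only: diff_Suc_1 mult_ac)
qed

lemma polar_differential_composite:
  fixes f :: "complex^'n::finite \<Rightarrow> complex"
  assumes n2: "CARD('n) \<ge> 2" and a: "a > 0" and b: "b > 0" and ab: "a \<noteq> b" and w: "w \<noteq> 0"
    and fd: "(f has_derivative (\<lambda>h. \<Sum>j\<in>UNIV. F j * h $ j)) (at (phi_ab a b w))"
    and na: "\<not> aligned (\<lambda>j. phi_ab a b w $ j * F j)"
  obtains L q \<epsilon> where "polar_differential w L q \<epsilon> (real a) (real b)"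
    "((f \<circ> phi_ab a b) has_derivative L) (at w)"
proof -
  define \<epsilon> where "\<epsilon> j = (if w $ j = 0 then 1 else sgn (w $ j))" for j
  define t where "t j = (if w $ j = 0 then 0 else (w $ j) ^ a * cnj (w $ j) ^ b / of_real (cmod (w $ j)))" for j
  define q where "q j = F j * t j" for j
  define L where "L u = (\<Sum>j\<in>UNIV. q j * (of_real (real a) * cnj (\<epsilon> j) * u $ j + of_real (real b) * \<epsilon> j * cnj (u $ j)))"
    for u :: "complex^'n"
  let ?D = "\<lambda>j u. of_nat a * u $ j * (w $ j) ^ (a - 1) * cnj (w $ j) ^ b +
      (w $ j) ^ a * (of_nat b * cnj (u $ j) * cnj (w $ j) ^ (b - 1))"
  have d1: "((\<lambda>w. (w $ j) ^ a * cnj (w $ j) ^ b) has_derivative ?D j) (at w)" for j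
  proof -
    have n: "((\<lambda>w :: complex^'n. w $ j) has_derivative (\<lambda>u. u $ j)) (at w)"
      by (intro bounded_linear_imp_has_derivative bounded_linear_vec_nth)
    then have c: "((\<lambda>w :: complex^'n. cnj (w $ j)) has_derivative (\<lambda>u. cnj (u $ j))) (at w)"
      by (rule bounded_linear.has_derivative[OF bounded_linear_cnj])
    show ?thesis
      using has_derivative_mult[OF has_derivative_power[OF n, of a] has_derivative_power[OF c, of b]]
      by (simp add: add.commute)
  qed
  have "(phi_ab a b has_derivative (\<lambda>u. \<chi> j. ?D j u)) (at w)"
    unfolding phi_ab_def[abs_def] by (rule has_derivative_vec_lambda) (rule d1)
  from diff_chain_at[OF this fd]
  have "((f \<circ> phi_ab a b) has_derivative (\<lambda>u. \<Sum>j\<in>UNIV. F j * ?D j u)) (at w)"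
    by (simp add: o_def)
  moreover have "(\<lambda>u. \<Sum>j\<in>UNIV. F j * ?D j u) = L"
    unfolding L_def q_def t_def \<epsilon>_def mixed_power_polar[OF a b] by (simp add: mult.assoc)
  ultimately have gd: "((f \<circ> phi_ab a b) has_derivative L) (at w)" by simp
  have "polar_differential w L q \<epsilon> (real a) (real b)"
  proof
    show "cmod (\<epsilon> j) = 1" for j by (simp add: \<epsilon>_def norm_sgn)
    show "w $ j = \<epsilon> j * of_real (cmod (w $ j))" for j
      by (simp add: \<epsilon>_def sgn_div_norm scaleR_conv_of_real)
    show "\<nexists>l. \<forall>j. q j = l * of_real (cmod (w $ j))"
    proof
      assume "\<exists>l. \<forall>j. q j = l * of_real (cmod (w $ j))"
      then obtain l where l: "\<And>j. q j = l * of_real (cmod (w $ j))" by blast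
      \<comment> \<open>Multiplying \<open>q j\<close> by the modulus of \<open>w $ j\<close> gives
        the Euler component; proportional \<open>q\<close> would thus put the Euler vector in the
        cone of \<open>aligned_cone\<close>.\<close>
      have "phi_ab a b w $ j * F j = l * of_real ((cmod (w $ j))\<^sup>2)" for j
      proof (cases "w $ j = 0")
        case True
        then show ?thesis using a by (simp add: phi_ab_def zero_power)
      next
        case False
        then have "phi_ab a b w $ j * F j = q j * of_real (cmod (w $ j))" by (simp add: phi_ab_def q_def t_def)
        then show ?thesis by (simp add: l power2_eq_square)
      qed
      then show False using na aligned_cone[of "\<lambda>j. (cmod (w $ j))\<^sup>2" l] by simp
    qed
  qed (use n2 a b ab w in \<open>auto simp: L_def\<close>)
  then show thesis using gd that by blast
qed

text \<open>Collects all pointwise conclusions, with a real \<open>s\<close> carrying the sign, so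
  that the cases \<open>a > b\<close> and \<open>a < b\<close> share one argument.\<close>

definition link_sign :: "(complex^'n::finite \<Rightarrow> complex) \<Rightarrow> real \<Rightarrow> complex^'n \<Rightarrow> bool" where
  "link_sign g s w \<longleftrightarrow> link_smooth_at g w \<and> mixed_regular g w \<and> s * C_g g w > 0 \<and>
     (\<forall>v. pos_tangent_frame g w v \<longrightarrow> s * contact_vol w v > 0)"

lemma link_sign_composite:
  fixes f :: "complex^'n::finite \<Rightarrow> complex"
  assumes "CARD('n) \<ge> 2" "a > 0" "b > 0" "a \<noteq> b" "w \<noteq> 0"
    "(f has_derivative (\<lambda>h. \<Sum>j\<in>UNIV. F j * h $ j)) (at (phi_ab a b w))"
    "\<not> aligned (\<lambda>j. phi_ab a b w $ j * F j)"
  shows "link_sign (f \<circ> phi_ab a b) (real a - real b) w"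
proof -
  obtain L q \<epsilon> where p: "polar_differential w L q \<epsilon> (real a) (real b)"
    and d: "((f \<circ> phi_ab a b) has_derivative L) (at w)"
    by (rule polar_differential_composite[OF assms])
  interpret polar_differential w L q \<epsilon> "real a" "real b" by (rule p)
  show ?thesis using link_smooth[OF d] C_g_sign[OF d] contact_sign[OF d] by (simp add: link_sign_def)
qed

lemma isolated_mixed_sing_link_sign:
  assumes "g 0 = 0" "r0 > 0" "cball 0 r0 \<subseteq> U" "\<And>w. w \<in> U \<Longrightarrow> w \<noteq> 0 \<Longrightarrow> g w = 0 \<Longrightarrow> link_sign g s w"
  shows "isolated_mixed_sing g"
  unfolding isolated_mixed_sing_def
proof (intro conjI exI[of _ r0] allI impI)
  fix w assume w: "w \<noteq> 0 \<and> norm w < r0 \<and> g w = 0"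
  then have "w \<in> U" using assms(3) by auto
  then show "mixed_regular g w" using assms(4) w by (auto simp: link_sign_def)
qed (use assms in auto)

lemma strictly_like_link_sign:
  assumes "g 0 = 0" "r0 > 0" "cball 0 r0 \<subseteq> U" "\<And>w. w \<in> U \<Longrightarrow> w \<noteq> 0 \<Longrightarrow> g w = 0 \<Longrightarrow> link_sign g s w"
  shows "s > 0 \<Longrightarrow> strictly_hol_like g U" "s < 0 \<Longrightarrow> strictly_antihol_like g U"
proof -
  have iso: "isolated_mixed_sing g" by (rule isolated_mixed_sing_link_sign[OF assms])
  have sC: "s * C_g g w > 0" if "w \<in> U" "g w = 0 \<and> w \<noteq> 0 \<and> mixed_regular g w" for w
    using assms(4)[of w] that unfolding link_sign_def by blast
  show "strictly_hol_like g U" if "s > 0"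
    unfolding strictly_hol_like_def using iso sC that by (simp add: zero_less_mult_iff)
  show "strictly_antihol_like g U" if "s < 0"
    unfolding strictly_antihol_like_def using iso sC that by (simp add: zero_less_mult_iff)
qed

lemma contact_link_sign:
  assumes "r > 0" "\<And>w. norm w = r \<Longrightarrow> g w = 0 \<Longrightarrow> link_sign g s w"
  shows "s > 0 \<Longrightarrow> positive_contact g r" "s < 0 \<Longrightarrow> negative_contact g r"
proof -
  have "link_sign g s p" if "p \<in> link g r" for p
  proof -
    have "(norm p)\<^sup>2 = r\<^sup>2" using that by (simp add: link_def rho_def)
    then have "norm p = r" using assms(1) by (simp add: power2_eq_iff_nonneg)
    then show ?thesis using assms(2) that by (simp add: link_def)
  qed
  then show "s > 0 \<Longrightarrow> positive_contact g r" "s < 0 \<Longrightarrow> negative_contact g r"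
    by (auto simp: positive_contact_def negative_contact_def link_sign_def zero_less_mult_iff)
qed

text \<open>Homogeneity writes \<open>f\<close> as a constant times \<open>f\<close> after a linear
  contraction \<open>S\<close>, so the derivative near 0 is transported to \<open>z\<close>. The
  Euler vector at \<open>z\<close> is a nonzero multiple of that at \<open>S z\<close>, and
  \<open>aligned\<close> does not see such multiples.\<close>

lemma weighted_homogeneous_rescale:
  fixes f :: "complex^'n::finite \<Rightarrow> complex"
  assumes wh: "weighted_homogeneous f" and \<epsilon>: "\<epsilon> > 0"
    and fd: "\<forall>z\<in>ball 0 \<epsilon>. (f has_derivative (\<lambda>h. \<Sum>j\<in>UNIV. pd z j * h $ j)) (at z)"
    and na: "\<forall>z\<in>ball 0 \<epsilon>. z \<noteq> 0 \<longrightarrow> f z = 0 \<longrightarrow> \<not> aligned (\<lambda>j. z $ j * pd z j)"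
    and z: "z \<noteq> 0" "f z = 0"
  obtains F where "(f has_derivative (\<lambda>h. \<Sum>j\<in>UNIV. F j * h $ j)) (at z)" "\<not> aligned (\<lambda>j. z $ j * F j)"
proof -
  obtain p d where p: "\<And>j. p j > 0" and hom: "\<And>t z. f (\<chi> j. t ^ p j * z $ j) = t ^ d * f z"
    using wh unfolding weighted_homogeneous_def by blast
  \<comment> \<open>As \<open>t \<le> 1\<close> and all weights are at least 1, \<open>S\<close>
    shrinks each coordinate by at least the factor \<open>t\<close>, which brings \<open>z\<close>
    into the ball.\<close>
  define t where "t = min 1 (\<epsilon> / (2 * norm z))"
  have t: "0 < t" "t \<le> 1" using \<epsilon> z(1) by (auto simp: t_def)
  have "t \<le> \<epsilon> / (2 * norm z)" by (simp add: t_def)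
  then have tz: "t * norm z < \<epsilon>" using z(1) \<epsilon> by (simp add: field_simps)
  define T where "T = complex_of_real t"
  have T0: "T \<noteq> 0" using t by (simp add: T_def)
  define S where "S x = (\<chi> j. T ^ p j * x $ j)" for x :: "complex^'n"
  have "norm (S z) \<le> norm (t *\<^sub>R z)"
  proof (rule norm_le_componentwise_cart)
    fix j
    have "t ^ p j \<le> t ^ 1" using t p[of j] by (intro power_decreasing) auto
    then show "norm (S z $ j) \<le> norm ((t *\<^sub>R z) $ j)"
      using t by (simp add: S_def T_def norm_mult norm_power mult_right_mono)
  qed
  also have "\<dots> = t * norm z" using t by simp
  finally have Sz: "S z \<in> ball 0 \<epsilon>" using tz by simp
  have Sz0: "S z \<noteq> 0" using z(1) T0 by (auto simp: S_def vec_eq_iff)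
  have fS: "f (S x) = T ^ d * f x" for x unfolding S_def by (rule hom)
  define F where "F j = inverse (T ^ d) * (pd (S z) j * T ^ p j)" for j
  have "(S has_derivative S) (at z)"
  proof (rule linear_imp_has_derivative, rule linearI)
    show "S (x + y) = S x + S y" for x y by (simp add: S_def vec_eq_iff algebra_simps)
    show "S (r *\<^sub>R x) = r *\<^sub>R S x" for r x by (simp add: S_def vec_eq_iff)
  qed
  from diff_chain_at[OF this bspec[OF fd Sz]]
  have "((\<lambda>x. f (S x)) has_derivative (\<lambda>h. \<Sum>j\<in>UNIV. pd (S z) j * S h $ j)) (at z)"
    by (simp add: o_def)
  then have "((\<lambda>x. inverse (T ^ d) * f (S x)) has_derivative
      (\<lambda>h. inverse (T ^ d) * (\<Sum>j\<in>UNIV. pd (S z) j * S h $ j))) (at z)"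
    by (rule has_derivative_mult_right)
  moreover have "(\<lambda>x. inverse (T ^ d) * f (S x)) = f" using T0 by (simp add: fS fun_eq_iff flip: mult.assoc)
  moreover have "(\<lambda>h. inverse (T ^ d) * (\<Sum>j\<in>UNIV. pd (S z) j * S h $ j)) = (\<lambda>h. \<Sum>j\<in>UNIV. F j * h $ j)"
    by (simp add: F_def S_def sum_distrib_left mult_ac)
  ultimately have "(f has_derivative (\<lambda>h. \<Sum>j\<in>UNIV. F j * h $ j)) (at z)" by simp
  moreover have "\<not> aligned (\<lambda>j. z $ j * F j)"
  proof -
    have "(\<lambda>j. z $ j * F j) = (\<lambda>j. inverse (T ^ d) * (S z $ j * pd (S z) j))"
      by (simp add: F_def S_def mult_ac)
    moreover have "\<not> aligned (\<lambda>j. S z $ j * pd (S z) j)" using na Sz Sz0 z(2) by (simp add: fS)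
    ultimately show ?thesis
      using aligned_scale[of "inverse (T ^ d)" "\<lambda>j. S z $ j * pd (S z) j"] T0 by simp
  qed
  ultimately show thesis using that by blast
qed

theorem theorem13:
  fixes f :: "complex^'n::finite \<Rightarrow> complex"
    and c :: "('n \<Rightarrow> nat) \<Rightarrow> complex"
    and a b :: nat
  assumes n2: "CARD('n) \<ge> 2"
    and holo: "holo_germ c f"
    and f0: "f 0 = 0"
    and conv: "convenient c"
    and nondeg: "non_degenerate c"
  shows "(b > 0 \<and> a > b \<longrightarrow>
            (\<exists>r0>0. strictly_hol_like (f \<circ> phi_ab a b) (cball 0 r0) \<and>
               (\<forall>r. 0 < r \<and> r \<le> r0 \<longrightarrow> positive_contact (f \<circ> phi_ab a b) r))) \<and>
         (a > 0 \<and> a < b \<longrightarrow>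
            (\<exists>r0>0. strictly_antihol_like (f \<circ> phi_ab a b) (cball 0 r0) \<and>
               (\<forall>r. 0 < r \<and> r \<le> r0 \<longrightarrow> negative_contact (f \<circ> phi_ab a b) r))) \<and>
         (weighted_homogeneous f \<longrightarrow>
            (b > 0 \<and> a > b \<longrightarrow> strictly_hol_like (f \<circ> phi_ab a b) UNIV \<and>
               (\<forall>r>0. positive_contact (f \<circ> phi_ab a b) r)) \<and>
            (a > 0 \<and> a < b \<longrightarrow> strictly_antihol_like (f \<circ> phi_ab a b) UNIV \<and>
               (\<forall>r>0. negative_contact (f \<circ> phi_ab a b) r)))"
proof -
  let ?g = "f \<circ> phi_ab a b" and ?s = "real a - real b"
  obtain \<epsilon> pd where \<epsilon>: "\<epsilon> > 0"
    and fd: "\<forall>z\<in>ball 0 \<epsilon>. (f has_derivative (\<lambda>h. \<Sum>j\<in>UNIV. pd z j * h $ j)) (at z)"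
    and na: "\<forall>z\<in>ball 0 \<epsilon>. z \<noteq> 0 \<longrightarrow> f z = 0 \<longrightarrow> \<not> aligned (\<lambda>j. z $ j * pd z j)"
    by (rule euler_vector_not_aligned[OF holo conv nondeg])
  \<comment> \<open>The bound 1 makes \<open>phi_ab\<close> norm-nonincreasing; half of
    \<open>\<epsilon>\<close> keeps the closed ball inside the open one.\<close>
  define r0 where "r0 = min 1 (\<epsilon> / 2)"
  have r0: "r0 > 0" "r0 \<le> 1" "r0 < \<epsilon>" using \<epsilon> by (auto simp: r0_def)
  have g0: "?g 0 = 0" if "a > 0" using that f0 by (simp add: phi_ab_zero)
  have loc: "link_sign ?g ?s w" if "a > 0" "b > 0" "a \<noteq> b" "w \<in> cball 0 r0" "w \<noteq> 0" "?g w = 0" for w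
  proof -
    have "norm (phi_ab a b w) \<le> norm w" using that r0 by (intro norm_phi_ab_le) auto
    then have z: "phi_ab a b w \<in> ball 0 \<epsilon>" using that(4) r0 by auto
    have "phi_ab a b w \<noteq> 0" by (rule phi_ab_nonzero[OF that(5)])
    then show ?thesis
      using that(6) z fd na by (intro link_sign_composite[where F="pd (phi_ab a b w)"] n2 that) auto
  qed
  have glob: "link_sign ?g ?s w" if wh: "weighted_homogeneous f" and ab: "a > 0" "b > 0" "a \<noteq> b"
    and w: "w \<noteq> 0" "?g w = 0" for w
  proof -
    have z: "phi_ab a b w \<noteq> 0" "f (phi_ab a b w) = 0" using phi_ab_nonzero[OF w(1)] w(2) by auto
    obtain F where "(f has_derivative (\<lambda>h. \<Sum>j\<in>UNIV. F j * h $ j)) (at (phi_ab a b w))"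
      "\<not> aligned (\<lambda>j. phi_ab a b w $ j * F j)"
      by (rule weighted_homogeneous_rescale[OF wh \<epsilon> fd na z])
    then show ?thesis by (intro link_sign_composite n2 ab w)
  qed
  have loc_contact: "(?s > 0 \<longrightarrow> positive_contact ?g r) \<and> (?s < 0 \<longrightarrow> negative_contact ?g r)"
    if "a > 0" "b > 0" "a \<noteq> b" "0 < r" "r \<le> r0" for r
  proof -
    have "link_sign ?g ?s w" if "norm w = r" "?g w = 0" for w
      using that \<open>a > 0\<close> \<open>b > 0\<close> \<open>a \<noteq> b\<close> \<open>0 < r\<close> \<open>r \<le> r0\<close> by (intro loc) auto
    from contact_link_sign[OF \<open>0 < r\<close> this] show ?thesis by blast
  qed
  have glob_contact: "(?s > 0 \<longrightarrow> positive_contact ?g r) \<and> (?s < 0 \<longrightarrow> negative_contact ?g r)"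
    if "weighted_homogeneous f" "a > 0" "b > 0" "a \<noteq> b" "0 < r" for r
  proof -
    have "link_sign ?g ?s w" if "norm w = r" "?g w = 0" for w
      using that \<open>weighted_homogeneous f\<close> \<open>a > 0\<close> \<open>b > 0\<close> \<open>a \<noteq> b\<close> \<open>0 < r\<close> by (intro glob) auto
    from contact_link_sign[OF \<open>0 < r\<close> this] show ?thesis by blast
  qed
  have loc_like: "(?s > 0 \<longrightarrow> strictly_hol_like ?g (cball 0 r0)) \<and> (?s < 0 \<longrightarrow> strictly_antihol_like ?g (cball 0 r0))"
    if "a > 0" "b > 0" "a \<noteq> b"
    using strictly_like_link_sign[OF g0[OF that(1)] r0(1) order_refl loc[OF that]] by blast
  have glob_like: "(?s > 0 \<longrightarrow> strictly_hol_like ?g UNIV) \<and> (?s < 0 \<longrightarrow> strictly_antihol_like ?g UNIV)"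
    if "weighted_homogeneous f" "a > 0" "b > 0" "a \<noteq> b"
    using strictly_like_link_sign[OF g0[OF that(2)] r0(1) subset_UNIV glob[OF that]] by blast
  show ?thesis
  proof (intro conjI impI)
    assume ab: "b > 0 \<and> a > b"
    then have "a > 0" "b > 0" "a \<noteq> b" "?s > 0" by auto
    then show "\<exists>r0>0. strictly_hol_like ?g (cball 0 r0) \<and> (\<forall>r. 0 < r \<and> r \<le> r0 \<longrightarrow> positive_contact ?g r)"
      using loc_like loc_contact r0(1) by blast
  next
    assume ab: "a > 0 \<and> a < b"
    then have "a > 0" "b > 0" "a \<noteq> b" "?s < 0" by auto
    then show "\<exists>r0>0. strictly_antihol_like ?g (cball 0 r0) \<and> (\<forall>r. 0 < r \<and> r \<le> r0 \<longrightarrow> negative_contact ?g r)"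
      using loc_like loc_contact r0(1) by blast
  next
    assume wh: "weighted_homogeneous f" and ab: "b > 0 \<and> a > b"
    then have *: "a > 0" "b > 0" "a \<noteq> b" "?s > 0" by auto
    show "strictly_hol_like ?g UNIV" using glob_like[OF wh *(1-3)] *(4) by blast
    show "\<forall>r>0. positive_contact ?g r" using glob_contact[OF wh *(1-3)] *(4) by blast
  next
    assume wh: "weighted_homogeneous f" and ab: "a > 0 \<and> a < b"
    then have *: "a > 0" "b > 0" "a \<noteq> b" "?s < 0" by auto
    show "strictly_antihol_like ?g UNIV" using glob_like[OF wh *(1-3)] *(4) by blast
    show "\<forall>r>0. negative_contact ?g r" using glob_contact[OF wh *(1-3)] *(4) by blast
  qed
qed

end
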